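(* Let $T>0$, $n\in\mathbb{N}=\{1,2,\dots\}$, and let $\Lambda_n$, $\gamma_{1,n}$, $\lambda_j$, $\lambda_j(a)$ be as defined in the context. Let $a\in\Lambda_n$ and let $u$ be any nontrivial solution of $$u''(t)+a(t)u(t)=0,\ t\in(0,T),\qquad u(0)-u(T)=u'(0)-u'(T)=0,$$ such that $u(0)=u(T)=0$. Denote the zeros of $u$ in $[0,T]$ by $0=t_0<t_2<\dots<t_{2m}=T$ and the zeros of $u'$ in $(0,T)$ by $t_1<t_3<\dots<t_{2m-1}$ (the zeros of $u$ and of $u'$ interlace, so $t_i<t_{i+1}$). Then: 1. $t_{i+1}-t_i\le \frac{T}{4n}$ for all $0\le i\le 2m-1$, and at least one of these inequalities is strict. 2. $m$ is an even number and $m\ge 2(n+1)$. Any even value $m\ge 2(n+1)$ is possible (that is, it occurs for some $a\in\Lambda_n$ and some such $u$). 3. The infimum $\gamma_{1,n}$ is not attained, and $$\gamma_{1,n}=T\lambda_{2n-1}+\frac{8\pi n(n+1)}{T}\cot\frac{n\pi}{2(n+1)}.$$ 4. If $a\in L_T(\mathbb{R},\mathbb{R})$ satisfies $\lambda_{2n-1}\prec a$ and $\|a\|_{L^1(0,T)}\le\gamma_{1,n}$, then $\lambda_{2n}(a)<0<\lambda_{2n+1}(a)$.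
   Context: $L_T(\mathbb{R},\mathbb{R})$ is the set of $T$-periodic functions $a:\mathbb{R}\to\mathbb{R}$ with $a|_{[0,T]}\in L^1(0,T)$. For $c,d\in L^1(0,T)$, $c\prec d$ means $c(t)\le d(t)$ for a.e. $t\in[0,T]$ and $c(t)<d(t)$ on a set of positive measure. For $a\in L_T(\mathbb{R},\mathbb{R})$, $\lambda_0(a)<\lambda_1(a)\le\lambda_2(a)<\dots<\lambda_{2n-1}(a)\le\lambda_{2n}(a)<\dots$ denote the eigenvalues (counted with multiplicity) $\lambda$ of the periodic problem $u''(t)+(\lambda+a(t))u(t)=0$ on $(0,T)$, $u(0)-u(T)=u'(0)-u'(T)=0$. Write $\lambda_j=\lambda_j(0)$; thus $\lambda_0=0$ and $\lambda_{2n-1}=\lambda_{2n}=(2n)^2\pi^2/T^2$ for $n\in\mathbb{N}$. $\Lambda_n$ is the set of all $a\in L_T(\mathbb{R},\mathbb{R})$ such that $\lambda_{2n-1}\prec a$ and the problem $u''+a(t)u=0$ on $(0,T)$, $u(0)-u(T)=u'(0)-u'(T)=0$, has nontrivial solutions. Finally $\gamma_{1,n}=\inf_{a\in\Lambda_n}\|a\|_{L^1(0,T)}$. *)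

theory Defs
  imports "HOL-Analysis.Analysis" "HOL-Library.Function_Algebras"
begin

definition L_per :: "real \<Rightarrow> (real \<Rightarrow> real) set" where
  "L_per T = {a. (\<forall>t. a (t + T) = a t) \<and> set_integrable lebesgue {0..T} a}"

definition L1_norm :: "real \<Rightarrow> (real \<Rightarrow> real) \<Rightarrow> real" where
  "L1_norm T a = (LINT t:{0..T}|lebesgue. \<bar>a t\<bar>)"

definition ae_prec :: "real \<Rightarrow> (real \<Rightarrow> real) \<Rightarrow> (real \<Rightarrow> real) \<Rightarrow> bool" where
  "ae_prec T c d \<longleftrightarrow>
     (AE t in lebesgue. t \<in> {0..T} \<longrightarrow> c t \<le> d t) \<and>
     emeasure lebesgue {t \<in> {0..T}. c t < d t} > 0"

text \<open>
  \<open>u\<close> lies in \<open>W\<^sup>2\<^sup>,\<^sup>1(0,T)\<close> with first and second derivatives \<open>u'\<close>, \<open>u''\<close>: \<open>u\<close> is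
  differentiable on \<open>[0,T]\<close> (one-sidedly at the ends), and \<open>u'\<close> is the absolutely continuous
  function whose derivative is the \<open>L\<^sup>1\<close> function \<open>u''\<close>.
\<close>

definition W21_derivs ::
  "real \<Rightarrow> (real \<Rightarrow> real) \<Rightarrow> (real \<Rightarrow> real) \<Rightarrow> (real \<Rightarrow> real) \<Rightarrow> bool" where
  "W21_derivs T u u' u'' \<longleftrightarrow>
     (\<forall>t\<in>{0..T}. (u has_real_derivative u' t) (at t within {0..T})) \<and>
     set_integrable lebesgue {0..T} u'' \<and>
     (\<forall>t\<in>{0..T}. u' t = u' 0 + (LINT s:{0..t}|lebesgue. u'' s))"

text \<open>
  As \<open>q\<close> is only integrable, the equation \<open>u'' + q u = 0\<close> is required almost everywhere.
  The derivative \<open>u'\<close> is an explicit argument because of its values at the end points.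
\<close>

definition periodic_solution ::
  "real \<Rightarrow> (real \<Rightarrow> real) \<Rightarrow> (real \<Rightarrow> real) \<Rightarrow> (real \<Rightarrow> real) \<Rightarrow> bool" where
  "periodic_solution T q u u' \<longleftrightarrow>
     (\<exists>u''. W21_derivs T u u' u'' \<and>
        (AE t in lebesgue. t \<in> {0<..<T} \<longrightarrow> u'' t + q t * u t = 0)) \<and>
     u 0 - u T = 0 \<and> u' 0 - u' T = 0"

definition nontrivial_on :: "real \<Rightarrow> (real \<Rightarrow> real) \<Rightarrow> bool" where
  "nontrivial_on T u \<longleftrightarrow> (\<exists>t\<in>{0..T}. u t \<noteq> 0)"

text \<open>
  A function on \<open>[0,T]\<close> is represented by its extension by zero; without this normalisation the
  space of solutions would be infinite-dimensional because of the values outside \<open>[0,T]\<close>.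
\<close>

definition eigenspace :: "real \<Rightarrow> (real \<Rightarrow> real) \<Rightarrow> real \<Rightarrow> (real \<Rightarrow> real) set" where
  "eigenspace T a \<mu> =
     {u. (\<exists>u'. periodic_solution T (\<lambda>t. \<mu> + a t) u u') \<and> (\<forall>t. t \<notin> {0..T} \<longrightarrow> u t = 0)}"

definition fun_scale :: "real \<Rightarrow> (real \<Rightarrow> real) \<Rightarrow> real \<Rightarrow> real" where
  "fun_scale c f = (\<lambda>t. c * f t)"

lemma vector_space_fun_scale: "vector_space fun_scale"
  by unfold_locales (auto simp: fun_scale_def fun_eq_iff algebra_simps)

definition multiplicity_eig :: "real \<Rightarrow> (real \<Rightarrow> real) \<Rightarrow> real \<Rightarrow> nat" where
  "multiplicity_eig T a \<mu> = vector_space.dim fun_scale (eigenspace T a \<mu>)"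

text \<open>
  \<open>eig T a k\<close> is the \<open>k\<close>-th eigenvalue, \<open>k = 0, 1, 2, \<dots>\<close>: the eigenvalues are arranged in the
  nondecreasing sequence in which each \<open>\<mu>\<close> occurs as often as its multiplicity says
  (so a \<open>\<mu>\<close> that is not an eigenvalue does not occur).
\<close>

definition eig :: "real \<Rightarrow> (real \<Rightarrow> real) \<Rightarrow> nat \<Rightarrow> real" where
  "eig T a = (THE L. mono L \<and>
     (\<forall>\<mu>. finite {k. L k = \<mu>} \<and> card {k. L k = \<mu>} = multiplicity_eig T a \<mu>))"

definition eig0 :: "real \<Rightarrow> nat \<Rightarrow> real" where
  "eig0 T j = eig T (\<lambda>_. 0) j"

definition Lambda_set :: "real \<Rightarrow> nat \<Rightarrow> (real \<Rightarrow> real) set" where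
  "Lambda_set T n = {a \<in> L_per T. ae_prec T (\<lambda>_. eig0 T (2 * n - 1)) a \<and>
     (\<exists>u u'. periodic_solution T a u u' \<and> nontrivial_on T u)}"

definition gamma1 :: "real \<Rightarrow> nat \<Rightarrow> real" where
  "gamma1 T n = (INF a\<in>Lambda_set T n. L1_norm T a)"

text \<open>
  \<open>0 = t\<^sub>0 < t\<^sub>2 < \<dots> < t\<^sub>2\<^sub>m = T\<close> are all the zeros of \<open>u\<close> in \<open>[0,T]\<close> and
  \<open>t\<^sub>1 < t\<^sub>3 < \<dots> < t\<^sub>2\<^sub>m\<^sub>-\<^sub>1\<close> all those of \<open>u'\<close> in \<open>(0,T)\<close>. That the two families interlace is
  not part of this definition.
\<close>

definition zero_listing ::
  "real \<Rightarrow> (real \<Rightarrow> real) \<Rightarrow> (real \<Rightarrow> real) \<Rightarrow> nat \<Rightarrow> (nat \<Rightarrow> real) \<Rightarrow> bool" where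
  "zero_listing T u u' m t \<longleftrightarrow>
     t 0 = 0 \<and> t (2 * m) = T \<and>
     (\<forall>i j. i < j \<and> j \<le> m \<longrightarrow> t (2 * i) < t (2 * j)) \<and>
     (\<forall>i j. i < j \<and> j < m \<longrightarrow> t (2 * i + 1) < t (2 * j + 1)) \<and>
     {s \<in> {0..T}. u s = 0} = (\<lambda>i. t (2 * i)) ` {..m} \<and>
     {s \<in> {0<..<T}. u' s = 0} = (\<lambda>i. t (2 * i + 1)) ` {..<m}"

end

theory Submission
  imports Defs
begin

text \<open>
  Fix \<open>w = 2 \<pi> n / T\<close>, so that \<open>\<lambda>\<^sub>2\<^sub>n\<^sub>-\<^sub>1 = w\<^sup>2\<close>, and write solutions as \<open>u = r sin \<Theta>\<close>, \<open>u' = w r cos \<Theta>\<close>.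
  Then \<open>\<Theta>' = w + (a - w\<^sup>2) / w sin\<^sup>2 \<Theta>\<close>, so for \<open>a \<ge> w\<^sup>2\<close> the zeros of \<open>u\<close> and \<open>u'\<close> are the points where the
  increasing function \<open>\<Theta>\<close> meets the multiples of \<open>\<pi> / 2\<close>, and \<open>\<Theta>' \<ge> w\<close> bounds their distances by
  \<open>T / (4 n)\<close>. A Wronskian with \<open>sin (w (t - z))\<close> gives \<open>\<integral> (a - w\<^sup>2) \<ge> w cot (w l)\<close> on a piece of length \<open>l\<close>
  between a zero of \<open>u\<close> and a neighbouring zero of \<open>u'\<close>; the tangent of \<open>cot\<close> at \<open>w T / (4 (n + 1))\<close>
  then bounds the sum over all pieces. The periodic eigenvalues are the shifts \<open>\<mu>\<close> for which the maximum or
  the minimum over initial angles of the turning \<open>\<Theta>(T) - \<Theta>(0)\<close> is an integral multiple of \<open>2 \<pi>\<close>: a matrix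
  of determinant one that maps some direction to itself fixes a vector exactly when it moves no two directions
  to opposite sides. The sign of an eigenvalue is thus read off from the turning of \<open>a\<close> itself, and the last
  part follows by deforming \<open>a\<close> to \<open>w\<^sup>2\<close>.
\<close>

section \<open>Absolutely continuous functions on the line\<close>

text \<open>The eigenvalues are given only as the sequence that \<open>eig\<close> selects by
  counting dimensions of eigenspaces, so existence, order and multiplicity have to be proved before
  any sign can be discussed. What makes the turning suitable is that the turnings of two initial
  angles always differ by less than \<pi>. Minimum and maximum therefore cannot meet different
  multiples of 2 \<pi> at the same shift, and the shifts at which one or the other is critical
  interlace: minimum \<open>2 k \<pi>\<close> gives eigenvalue number \<open>2 k\<close>, maximum
  \<open>2 k \<pi>\<close> number \<open>2 k - 1\<close>.

  The infimum is not attained because equality in the Wronskian estimate would require the whole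
  excess over \<open>w\<^sup>2\<close> to sit in point masses at the extrema of \<open>u\<close>. No
  integrable potential does this, but potentials concentrating there come arbitrarily close.
  Strictness therefore has to be carried along through comparison and summation; it also decides the
  borderline norm in the last part. Potentials are merely integrable, so densities are compared
  almost everywhere and a potential may be unbounded above, which complicates pushing the turning
  down by a shift.\<close>

definition locint :: "(real \<Rightarrow> real) \<Rightarrow> bool" where
  "locint f \<longleftrightarrow> (\<forall>s t. f absolutely_integrable_on {s..t})"

text \<open>Absolute continuity is encoded by the fundamental theorem with an explicit density
  \<open>f\<close>, so that no derivative has to be taken almost everywhere, and on the whole line,
  so that solutions can be translated, reflected and continued past the period.\<close>

definition ac :: "(real \<Rightarrow> real) \<Rightarrow> (real \<Rightarrow> real) \<Rightarrow> bool" where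
  "ac F f \<longleftrightarrow> locint f \<and> (\<forall>s t. s \<le> t \<longrightarrow> (f has_integral (F t - F s)) {s..t})"

lemma locint_mult:
  assumes "g \<in> borel_measurable borel" "\<And>s t. bounded (g ` {s..t})" "locint f"
  shows "locint (\<lambda>t. g t * f t)"
  unfolding locint_def
proof (intro allI)
  fix s t :: real
  have "g \<in> borel_measurable (lebesgue_on {s..t})"
    using assms(1) by (simp add: borel_measurable_if_D measurable_completion measurable_restrict_space1)
  then show "(\<lambda>t. g t * f t) absolutely_integrable_on {s..t}"
    using assms(2,3) by (intro absolutely_integrable_bounded_measurable_product_real)
      (auto simp: locint_def)
qed

lemma locint_mult_cont:
  assumes "continuous_on UNIV g" "locint f"
  shows "locint (\<lambda>t. g t * f t)"
  using assms
  by (intro locint_mult borel_measurable_continuous_onI compact_imp_bounded compact_continuous_image)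
    (auto intro: continuous_on_subset)

lemma locint_mult_cont2:
  assumes "continuous_on UNIV g" "locint f"
  shows "locint (\<lambda>t. f t * g t)"
  using locint_mult_cont[OF assms] by (simp add: mult.commute)

lemma locint_add: "locint f \<Longrightarrow> locint g \<Longrightarrow> locint (\<lambda>t. f t + g t)"
  by (auto simp: locint_def)

lemma locint_diff: "locint f \<Longrightarrow> locint g \<Longrightarrow> locint (\<lambda>t. f t - g t)"
  by (auto simp: locint_def)

lemma locint_cmul: "locint f \<Longrightarrow> locint (\<lambda>t. c * f t)"
  by (rule locint_mult_cont) auto

lemma locint_abs: "locint f \<Longrightarrow> locint (\<lambda>t. \<bar>f t\<bar>)"
  by (auto simp: locint_def intro: set_integrable_abs)

lemma locint_cont: "continuous_on UNIV f \<Longrightarrow> locint f"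
  by (auto simp: locint_def intro!: absolutely_integrable_continuous_real intro: continuous_on_subset)

lemma locint_const [simp]: "locint (\<lambda>t. c)"
  by (rule locint_cont) auto

lemma locint_uminus: "locint f \<Longrightarrow> locint (\<lambda>t. - f t)"
  using locint_cmul[of f "-1"] by simp

lemma locint_div: "locint f \<Longrightarrow> locint (\<lambda>t. f t / c)"
  using locint_cmul[of f "1/c"] by simp

lemmas locint_intros = locint_add locint_diff locint_cmul locint_abs locint_const locint_uminus
  locint_div

lemma locint_integrable: "locint f \<Longrightarrow> f integrable_on {s..t}"
  by (auto simp: locint_def intro: set_lebesgue_integral_eq_integral)

lemma locint_measurable:
  assumes "locint f" shows "f \<in> borel_measurable (lebesgue_on {s..t})"
  using assms unfolding locint_def
  by (auto intro: absolutely_integrable_measurable[THEN iffD1, THEN conjunct1])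

section \<open>Calculus of absolutely continuous functions\<close>

lemma acI:
  assumes "locint f" "\<And>s t. s \<le> t \<Longrightarrow> (f has_integral (F t - F s)) {s..t}"
  shows "ac F f"
  using assms by (auto simp: ac_def)

lemma ac_locint: "ac F f \<Longrightarrow> locint f"
  by (simp add: ac_def)

lemma ac_int: "ac F f \<Longrightarrow> s \<le> t \<Longrightarrow> integral {s..t} f = F t - F s"
  by (auto simp: ac_def)

lemma ac_has_int: "ac F f \<Longrightarrow> s \<le> t \<Longrightarrow> (f has_integral (F t - F s)) {s..t}"
  by (auto simp: ac_def)

lemma ac_cong: "ac F f \<Longrightarrow> (\<And>t. F t = G t) \<Longrightarrow> (\<And>t. f t = g t) \<Longrightarrow> ac G g"
  by (subgoal_tac "F = G \<and> f = g") auto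

lemma ac_cont:
  assumes "ac F f" shows "continuous_on UNIV F"
proof -
  have "isCont F x" for x
  proof -
    have "continuous_on {x-1..x+1} (\<lambda>t. F (x-1) + integral {x-1..t} f)"
      using assms by (intro continuous_intros indefinite_integral_continuous_1 locint_integrable ac_locint)
    then have "continuous_on {x-1..x+1} F"
      by (rule continuous_on_eq) (use assms ac_int in auto)
    then show ?thesis
      by (rule continuous_on_interior) auto
  qed
  then show ?thesis by (simp add: continuous_at_imp_continuous_on)
qed

lemma ac_primitive:
  assumes "locint f" obtains F where "ac F f" "F s = 0"
proof -
  \<comment> \<open>One of the two integrals runs over an empty or one-point interval and is
    \<open>0\<close>, so the same formula serves on both sides of \<open>s\<close>.\<close>
  let ?F = "\<lambda>t. integral {s..t} f - integral {t..s} f"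
  have i: "f integrable_on {s..t}" for s t by (rule locint_integrable[OF assms])
  have "ac ?F f"
  proof (rule acI[OF assms])
    fix u v :: real assume "u \<le> v"
    have *: "integral {u..v} f = ?F v - ?F u"
    proof -
      consider "s \<le> u" | "u \<le> s" "s \<le> v" | "v \<le> s" using \<open>u \<le> v\<close> by linarith
      then show ?thesis
      proof cases
        case 1
        have *: "integral {x..s} f = 0" if "x \<in> {u,v}" for x
          using 1 \<open>u \<le> v\<close> that by (cases "x = s") auto
        show ?thesis using 1 \<open>u \<le> v\<close> Henstock_Kurzweil_Integration.integral_combine[of s u v f] i *[of u] *[of v] by auto
      next
        case 2
        have "integral {v..s} f = 0" "integral {s..u} f = 0"
          using 2 by (cases "v = s"; auto)(cases "u = s"; use 2 in auto)
        then show ?thesis using 2 Henstock_Kurzweil_Integration.integral_combine[of u s v f] i by auto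
      next
        case 3
        have *: "integral {s..x} f = 0" if "x \<in> {u,v}" for x
          using 3 \<open>u \<le> v\<close> that by (cases "x = s") auto
        show ?thesis using 3 \<open>u \<le> v\<close> Henstock_Kurzweil_Integration.integral_combine[of u v s f] i *[of u] *[of v] by auto
      qed
    qed
    show "(f has_integral (?F v - ?F u)) {u..v}"
      unfolding *[symmetric] by (rule integrable_integral[OF i])
  qed
  then show thesis by (rule that) simp
qed

lemma ac_add:
  assumes "ac F f" "ac G g" shows "ac (\<lambda>t. F t + G t) (\<lambda>t. f t + g t)"
proof (rule acI)
  show "locint (\<lambda>t. f t + g t)" using assms by (auto simp: ac_def intro: locint_add)
  fix s t :: real assume "s \<le> t"
  then show "((\<lambda>t. f t + g t) has_integral F t + G t - (F s + G s)) {s..t}"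
    using has_integral_add[OF ac_has_int[OF assms(1)] ac_has_int[OF assms(2)], of s t]
    by (simp add: algebra_simps)
qed

lemma ac_cmul:
  assumes "ac F f" shows "ac (\<lambda>t. c * F t) (\<lambda>t. c * f t)"
proof (rule acI)
  show "locint (\<lambda>t. c * f t)" using assms by (auto simp: ac_def intro: locint_cmul)
  fix s t :: real assume "s \<le> t"
  then show "((\<lambda>t. c * f t) has_integral c * F t - c * F s) {s..t}"
    using has_integral_mult_right[OF ac_has_int[OF assms(1)], of s t c]
    by (simp add: algebra_simps)
qed

lemma ac_uminus: "ac F f \<Longrightarrow> ac (\<lambda>t. - F t) (\<lambda>t. - f t)"
  using ac_cmul[of F f "-1"] by simp

lemma ac_diff: "ac F f \<Longrightarrow> ac G g \<Longrightarrow> ac (\<lambda>t. F t - G t) (\<lambda>t. f t - g t)"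
  using ac_add[OF _ ac_uminus, of F f G g] by simp

lemma ac_const: "ac (\<lambda>t. c) (\<lambda>t. 0)"
  by (rule acI) auto

lemma has_integral_bound_abs:
  fixes f g :: "real \<Rightarrow> real"
  assumes "(f has_integral i) {s..t}" "(g has_integral j) {s..t}" "\<And>x. x \<in> {s..t} \<Longrightarrow> \<bar>f x\<bar> \<le> g x"
  shows "\<bar>i\<bar> \<le> j"
  using has_integral_le[OF assms(1,2)] has_integral_le[OF has_integral_neg[OF assms(1)] assms(2)] assms(3)
  by (smt (verit, ccfv_SIG))

lemma ac_bound:
  assumes "ac F f" "ac G g" "\<And>x. \<bar>f x\<bar> \<le> g x"
  shows "\<bar>F t - F s\<bar> \<le> \<bar>G t - G s\<bar>"
proof (cases "s \<le> t")
  case True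
  then show ?thesis using has_integral_bound_abs[OF ac_has_int[OF assms(1)] ac_has_int[OF assms(2)], of s t] assms(3)
    by auto
next
  case False
  then show ?thesis using has_integral_bound_abs[OF ac_has_int[OF assms(1)] ac_has_int[OF assms(2)], of t s] assms(3)
    by auto
qed

text \<open>
  The increments of \<open>H = G \<circ> F - \<integral>(g \<circ> F) f\<close> on short intervals are small relative to \<open>\<integral>\<bar>f\<bar>\<close>;
  summing over a fine partition shows that \<open>H\<close> is constant.
\<close>

lemma ac_chain:
  assumes F: "ac F f" and G: "\<And>x. (G has_real_derivative g x) (at x)" and g: "continuous_on UNIV g"
  shows "ac (\<lambda>t. G (F t)) (\<lambda>t. g (F t) * f t)"
proof -
  have cF: "continuous_on UNIV F" using ac_cont[OF F] .
  have cgF: "continuous_on UNIV (\<lambda>t. g (F t))"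
    using continuous_on_compose[OF cF continuous_on_subset[OF g]] by (auto simp: o_def)
  have li: "locint (\<lambda>t. g (F t) * f t)"
    by (intro locint_mult_cont cgF ac_locint[OF F])
  obtain P where P: "ac P (\<lambda>t. g (F t) * f t)" using ac_primitive[OF li] by blast
  obtain V where V: "ac V (\<lambda>t. \<bar>f t\<bar>)" using ac_primitive[OF locint_abs[OF ac_locint[OF F]]] by blast
  have "((\<lambda>t. g (F t) * f t) has_integral G (F t) - G (F s)) {s..t}" if st: "s \<le> t" for s t
  proof -
  define H where "H = (\<lambda>t. G (F t) - P t)"
  have small: "\<exists>d>0. \<forall>u v. s \<le> u \<and> u \<le> v \<and> v \<le> t \<and> v - u < d \<longrightarrow> \<bar>H v - H u\<bar> \<le> e * (V v - V u)"
    if "e > 0" for e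
  proof -
    have "uniformly_continuous_on {s..t} (\<lambda>t. g (F t))"
      by (intro compact_uniformly_continuous continuous_on_subset[OF cgF]) auto
    then obtain d where d: "d > 0" "\<And>x y. x \<in> {s..t} \<Longrightarrow> y \<in> {s..t} \<Longrightarrow> \<bar>x - y\<bar> < d \<Longrightarrow> \<bar>g (F x) - g (F y)\<bar> < e"
      using \<open>e > 0\<close> unfolding uniformly_continuous_on_def dist_real_def by blast
    have "\<bar>H v - H u\<bar> \<le> e * (V v - V u)" if uv: "s \<le> u" "u \<le> v" "v \<le> t" "v - u < d" for u v
    proof -
      have "\<exists>x\<in>{u..v}. G (F v) - G (F u) = (F v - F u) * g (F x)"
      proof -
        have c: "continuous_on {u..v} F" using cF continuous_on_subset by blast
        have *: "\<exists>z. min (F u) (F v) \<le> z \<and> z \<le> max (F u) (F v) \<and> G (F v) - G (F u) = (F v - F u) * g z"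
        proof -
          consider "F u < F v" | "F v < F u" | "F u = F v" by linarith
          then show ?thesis
          proof cases
            case 1
            from MVT2[OF 1, of G g] G obtain z where "F u < z" "z < F v" "G (F v) - G (F u) = (F v - F u) * g z" by blast
            then show ?thesis by (intro exI[of _ z]) auto
          next
            case 2
            from MVT2[OF 2, of G g] G obtain z where "F v < z" "z < F u" "G (F u) - G (F v) = (F u - F v) * g z" by blast
            then show ?thesis by (intro exI[of _ z]) (auto simp: algebra_simps)
          qed auto
        qed
        then obtain z where z: "min (F u) (F v) \<le> z" "z \<le> max (F u) (F v)" "G (F v) - G (F u) = (F v - F u) * g z" by blast
        have "\<exists>x. u \<le> x \<and> x \<le> v \<and> F x = z"
        proof (cases "F u \<le> F v")
          case True then show ?thesis using IVT'[of F u z v] z uv c by auto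
        next
          case False then show ?thesis using IVT2'[of F v z u] z uv c by auto
        qed
        then show ?thesis using z by auto
      qed
      then obtain x where x: "x \<in> {u..v}" "G (F v) - G (F u) = (F v - F u) * g (F x)" by blast
      have "((\<lambda>r. g (F x) * f r - g (F r) * f r) has_integral (g (F x) * (F v - F u) - (P v - P u))) {u..v}"
        by (intro has_integral_diff has_integral_mult_right ac_has_int[OF F] ac_has_int[OF P] uv)
      moreover have "((\<lambda>r. e * \<bar>f r\<bar>) has_integral (e * (V v - V u))) {u..v}"
        by (intro has_integral_mult_right ac_has_int[OF V] uv)
      moreover have "\<bar>g (F x) * f r - g (F r) * f r\<bar> \<le> e * \<bar>f r\<bar>" if "r \<in> {u..v}" for r
      proof -
        have "\<bar>g (F x) - g (F r)\<bar> < e" using x that uv by (intro d) auto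
        then show ?thesis unfolding left_diff_distrib[symmetric] abs_mult by (intro mult_right_mono) auto
      qed
      ultimately have "\<bar>g (F x) * (F v - F u) - (P v - P u)\<bar> \<le> e * (V v - V u)"
        by (rule has_integral_bound_abs)
      then show ?thesis using x(2) by (simp add: H_def algebra_simps)
    qed
    then show ?thesis using d(1) by blast
  qed
  have bd: "\<bar>H t - H s\<bar> \<le> e * (V t - V s)" if e: "e > 0" for e
  proof -
    obtain d where d: "d > 0" "\<And>u v. s \<le> u \<Longrightarrow> u \<le> v \<Longrightarrow> v \<le> t \<Longrightarrow> v - u < d \<Longrightarrow> \<bar>H v - H u\<bar> \<le> e * (V v - V u)"
      using small[OF e] by blast
    \<comment> \<open>\<open>Bolzano\<close> stands in for an explicit partition: the bound passes
      to the union of adjacent intervals and holds for all short ones.\<close>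
    define P where "P = (\<lambda>a b. s \<le> a \<and> a \<le> b \<and> b \<le> t \<longrightarrow> \<bar>H b - H a\<bar> \<le> e * (V b - V a))"
    have "P s t"
    proof (rule Bolzano[OF st])
      fix a b c assume "P a b" "P b c" "a \<le> b" "b \<le> c"
      then show "P a c" unfolding P_def by (auto simp: right_diff_distrib)
    next
      fix x assume "s \<le> x" "x \<le> t"
      show "\<exists>d>0. \<forall>a b. a \<le> x \<and> x \<le> b \<and> b - a < d \<longrightarrow> P a b"
        using d unfolding P_def by blast
    qed
    then show ?thesis using st by (simp add: P_def)
  qed
  have "H t - H s = 0"
  proof (rule ccontr)
    assume ne: "H t - H s \<noteq> 0"
    \<comment> \<open>With this \<open>e\<close> the bound reads \<open>x \<le> x / 2\<close>; the
      \<open>+ 1\<close> keeps the denominator positive when \<open>V\<close> does not vary.\<close>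
    define e where "e = \<bar>H t - H s\<bar> / (2 * (\<bar>V t - V s\<bar> + 1))"
    have "e > 0" unfolding e_def using ne by (intro divide_pos_pos) (auto intro: add_nonneg_pos)
    from bd[OF this] have "\<bar>H t - H s\<bar> \<le> e * (\<bar>V t - V s\<bar> + 1)"
      using \<open>e > 0\<close> by (smt (verit) mult_left_mono)
    also have "\<dots> = \<bar>H t - H s\<bar> / 2"
    proof -
      have "\<bar>V t - V s\<bar> + 1 > 0" by linarith
      then show ?thesis by (simp add: e_def field_simps)
    qed
    finally have "\<bar>H t - H s\<bar> \<le> \<bar>H t - H s\<bar> / 2" .
    moreover have "\<bar>H t - H s\<bar> > 0" using ne by simp
    ultimately show False by simp
  qed
  then have "G (F t) - G (F s) = P t - P s" by (simp add: H_def)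
  then show ?thesis
    using ac_has_int[OF P st] by simp
  qed
  then show ?thesis using li by (intro acI)
qed

text \<open>Polarisation, \<open>4 F G = (F + G)^2 - (F - G)^2\<close>, reduces the product rule to
  the chain rule for the square.\<close>

lemma ac_mult:
  assumes "ac F f" "ac G g"
  shows "ac (\<lambda>t. F t * G t) (\<lambda>t. f t * G t + F t * g t)"
proof -
  have sq: "ac (\<lambda>t. (H t)\<^sup>2) (\<lambda>t. 2 * H t * h t)" if "ac H h" for H h
    by (rule ac_chain[OF that, where G = "\<lambda>x. x\<^sup>2" and g = "\<lambda>x. 2 * x"])
      (auto intro!: derivative_eq_intros continuous_intros)
  have "ac (\<lambda>t. (1/4) * ((F t + G t)\<^sup>2 - (F t - G t)\<^sup>2)) (\<lambda>t. (1/4) * (2 * (F t + G t) * (f t + g t) - 2 * (F t - G t) * (f t - g t)))"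
    by (intro ac_cmul ac_diff sq ac_add assms)
  then show ?thesis
    by (rule ac_cong) (auto simp: power2_eq_square algebra_simps)
qed

lemma ac_exp: "ac F f \<Longrightarrow> ac (\<lambda>t. exp (F t)) (\<lambda>t. exp (F t) * f t)"
  by (erule ac_chain[where G = exp and g = exp]) (auto intro!: derivative_eq_intros continuous_intros)

lemma ac_sin: "ac F f \<Longrightarrow> ac (\<lambda>t. sin (F t)) (\<lambda>t. cos (F t) * f t)"
  by (erule ac_chain[where G = sin and g = cos]) (auto intro!: derivative_eq_intros continuous_intros)

lemma ac_cos: "ac F f \<Longrightarrow> ac (\<lambda>t. cos (F t)) (\<lambda>t. - sin (F t) * f t)"
  by (erule ac_chain[where G = cos and g = "\<lambda>x. - sin x"]) (auto intro!: derivative_eq_intros continuous_intros)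

section \<open>Comparison of integrals almost everywhere and Gronwall's inequality\<close>

lemma AE_lebesgue_iff: "(AE x in lebesgue. P x) \<longleftrightarrow> negligible {x. \<not> P x}"
  by (simp add: completion.AE_iff_null_sets negligible_iff_null_sets)

lemma has_integral_mono_AE:
  fixes f :: "real \<Rightarrow> real"
  assumes "(f has_integral i) {s..t}" "(g has_integral j) {s..t}"
    "AE x in lebesgue. x \<in> {s..t} \<longrightarrow> f x \<le> g x"
  shows "i \<le> j"
proof -
  obtain N where N: "negligible N" "\<And>x. x \<in> {s..t} \<Longrightarrow> x \<notin> N \<Longrightarrow> f x \<le> g x"
    using assms(3) by (auto simp: eventually_ae_filter negligible_iff_null_sets)
  have "((\<lambda>x. if x \<in> N then g x else f x) has_integral i) {s..t}"
    by (rule has_integral_spike[OF N(1) _ assms(1)]) auto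
  then show ?thesis by (rule has_integral_le[OF _ assms(2)]) (use N in auto)
qed

lemma has_integral_0_nonneg_negligible:
  fixes f :: "real \<Rightarrow> real"
  assumes "(f has_integral 0) S" "\<And>x. x \<in> S \<Longrightarrow> 0 \<le> f x"
  shows "negligible {x \<in> S. f x \<noteq> 0}"
proof -
  have "f absolutely_integrable_on S"
    using assms by (intro nonnegative_absolutely_integrable_1) (auto simp: has_integral_iff)
  then have "integrable lebesgue (\<lambda>x. indicator S x *\<^sub>R f x)" "integral\<^sup>L lebesgue (\<lambda>x. indicator S x *\<^sub>R f x) = 0"
    using assms set_lebesgue_integral_eq_integral(2)[of S f]
    by (auto simp: set_integrable_def set_lebesgue_integral_def has_integral_iff)
  then have "AE x in lebesgue. indicator S x *\<^sub>R f x = 0"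
    by (subst (asm) integral_nonneg_eq_0_iff_AE) (use assms in \<open>auto simp: indicator_def\<close>)
  then show ?thesis
    unfolding AE_lebesgue_iff by (rule negligible_subset) auto
qed

lemma has_integral_mono_AE_strict:
  fixes f :: "real \<Rightarrow> real"
  assumes f: "(f has_integral i) {s..t}" and g: "(g has_integral j) {s..t}"
    and le: "AE x in lebesgue. x \<in> {s..t} \<longrightarrow> f x \<le> g x"
    and neg: "\<not> negligible {x \<in> {s..t}. f x < g x}"
  shows "i < j"
proof -
  have "i \<noteq> j"
  proof
    assume "i = j"
    obtain N where N: "negligible N" "\<And>x. x \<in> {s..t} \<Longrightarrow> x \<notin> N \<Longrightarrow> f x \<le> g x"
      using le by (auto simp: eventually_ae_filter negligible_iff_null_sets)
    have h: "((\<lambda>x. g x - f x) has_integral 0) ({s..t})"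
      using has_integral_diff[OF g f] \<open>i = j\<close> by simp
    \<comment> \<open>Overwriting the exceptional null set makes the integrand nonnegative
      everywhere, as the vanishing criterion requires.\<close>
    have h2: "((\<lambda>x. if x \<in> N then 0 else g x - f x) has_integral 0) ({s..t})"
      by (rule has_integral_spike[OF N(1) _ h]) auto
    have "negligible {x \<in> {s..t}. (if x \<in> N then 0 else g x - f x) \<noteq> 0}"
      by (rule has_integral_0_nonneg_negligible[OF h2]) (use N in auto)
    then have "negligible ({x \<in> {s..t}. (if x \<in> N then 0 else g x - f x) \<noteq> 0} \<union> N)"
      using N by auto
    then have "negligible {x \<in> {s..t}. f x < g x}"
      by (rule negligible_subset) auto
    then show False using neg by blast
  qed
  then show ?thesis using has_integral_mono_AE[OF f g le] by auto
qed

lemma ac_mono: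
  assumes "ac F f" "s \<le> t" "AE x in lebesgue. x \<in> {s..t} \<longrightarrow> 0 \<le> f x"
  shows "F s \<le> F t"
  using has_integral_mono_AE[OF has_integral_0 ac_has_int[OF assms(1,2)] assms(3)] by simp

lemma ac_mono_strict:
  assumes "ac F f" "s \<le> t" "AE x in lebesgue. x \<in> {s..t} \<longrightarrow> 0 \<le> f x"
    "\<not> negligible {x \<in> {s..t}. 0 < f x}"
  shows "F s < F t"
  using has_integral_mono_AE_strict[OF has_integral_0 ac_has_int[OF assms(1,2)] assms(3,4)] by simp

lemma ac_integrating_factor:
  assumes "ac y y'" "ac K k"
  shows "ac (\<lambda>t. y t * exp (- K t)) (\<lambda>t. (y' t - k t * y t) * exp (- K t))"
  using ac_mult[OF assms(1) ac_exp[OF ac_uminus[OF assms(2)]]]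
  by (rule ac_cong) (auto simp: algebra_simps)

text \<open>Gronwall's inequality: after multiplication by \<open>exp (- K)\<close> the hypothesis
  says that the density is nonnegative almost everywhere.\<close>

lemma ac_comparison:
  assumes "ac y y'" "ac K k" "s \<le> t" "AE x in lebesgue. x \<in> {s..t} \<longrightarrow> k x * y x \<le> y' x"
  shows "y s * exp (K t - K s) \<le> y t"
proof -
  have "y s * exp (- K s) \<le> y t * exp (- K t)"
    by (rule ac_mono[OF ac_integrating_factor[OF assms(1,2)] assms(3)])
      (use assms(4) in \<open>auto elim!: eventually_mono\<close>)
  then have "y s * exp (- K s) * exp (K t) \<le> y t * exp (- K t) * exp (K t)"
    by (rule mult_right_mono) auto
  then show ?thesis by (simp add: mult.assoc flip: exp_add)
qed

lemma has_real_derivative_ac: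
  assumes "ac F f" "isCont f t"
  shows "(F has_real_derivative f t) (at t)"
proof -
  have "((\<lambda>u. F (t - 1) + integral {t-1..u} f) has_vector_derivative f t) (at t within {t-1..t+1})"
    using integral_has_vector_derivative_continuous_at[of f "t-1" "t+1" t "{}"] assms
    by (auto intro!: derivative_eq_intros locint_integrable ac_locint intro: continuous_at_imp_continuous_at_within)
  then have "(F has_vector_derivative f t) (at t within {t-1..t+1})"
    by (rule has_vector_derivative_transform[rotated 2]) (use assms ac_int in auto)
  then have "(F has_vector_derivative f t) (at t within {t-1<..<t+1})"
    by (rule has_vector_derivative_within_subset) auto
  then show ?thesis
    by (subst (asm) at_within_open) (auto simp: has_real_derivative_iff_has_vector_derivative)
qed

lemma ac_deriv:
  assumes "ac F f" "continuous_on UNIV f"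
  shows "(F has_real_derivative f t) (at t)"
  using has_real_derivative_ac assms continuous_on_eq_continuous_at by blast

lemma deriv_ac:
  assumes "\<And>t. (F has_real_derivative f t) (at t)" "continuous_on UNIV f"
  shows "ac F f"
proof (rule acI[OF locint_cont[OF assms(2)]])
  fix s t :: real assume "s \<le> t"
  then show "(f has_integral F t - F s) {s..t}"
    by (rule fundamental_theorem_of_calculus)
      (use assms(1) in \<open>auto simp flip: has_real_derivative_iff_has_vector_derivative intro: has_field_derivative_at_within\<close>)
qed

lemma ac_ident: "ac (\<lambda>t. t) (\<lambda>t. 1)"
  by (rule deriv_ac) auto

section \<open>Pruefer angles and solutions\<close>

text \<open>The scaling makes the potential \<open>w\<^sup>2\<close> rotate every direction with
  constant speed \<open>w\<close>. The equation involves the angle alone; the radius follows from it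
  by one integration.\<close>

definition is_prufer :: "real \<Rightarrow> (real \<Rightarrow> real) \<Rightarrow> (real \<Rightarrow> real) \<Rightarrow> bool" where
  "is_prufer w q \<Theta> \<longleftrightarrow> ac \<Theta> (\<lambda>t. w * (cos (\<Theta> t))\<^sup>2 + q t / w * (sin (\<Theta> t))\<^sup>2)"

text \<open>The value at \<open>0\<close> makes \<open>sinc_mult\<close> hold without exception.
  Nonlinear terms in the angle thereby become the angle times a bounded measurable coefficient, and
  linear theory applies.\<close>

definition sinc :: "real \<Rightarrow> real" where
  "sinc x = (if x = 0 then 1 else sin x / x)"

lemma sinc_mult: "sinc x * x = sin x"
  by (simp add: sinc_def)

lemma abs_sinc_le_1: "\<bar>sinc x\<bar> \<le> 1"
  using abs_sin_x_le_abs_x[of x] by (auto simp: sinc_def divide_simps)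

lemma sinc_measurable [measurable]: "sinc \<in> borel_measurable borel"
  unfolding sinc_def by measurable

lemma sin_squared_diff: "(sin x)\<^sup>2 - (sin y)\<^sup>2 = sin (x + y) * sin (x - y)" for x y :: real
proof -
  have "(sin x)\<^sup>2 - (sin y)\<^sup>2 = (sin x)\<^sup>2 * ((sin y)\<^sup>2 + (cos y)\<^sup>2) - (sin y)\<^sup>2 * ((sin x)\<^sup>2 + (cos x)\<^sup>2)"
    by simp
  also have "\<dots> = sin (x + y) * sin (x - y)"
    by (simp add: sin_add sin_diff power2_eq_square algebra_simps del: sin_cos_squared_add3)
  finally show ?thesis .
qed

lemma abs_sin_squared_diff_le: "\<bar>(sin x)\<^sup>2 - (sin y)\<^sup>2\<bar> \<le> \<bar>x - y\<bar>" for x y :: real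
  unfolding sin_squared_diff abs_mult
  using mult_mono[OF abs_sin_le_one[of "x + y"] abs_sin_x_le_abs_x[of "x - y"]] by simp

lemma locint_prufer_rhs:
  assumes "locint q" "continuous_on UNIV X"
  shows "locint (\<lambda>t. w * (cos (X t))\<^sup>2 + q t / w * (sin (X t))\<^sup>2)"
  by (intro locint_add locint_cont locint_mult_cont2 locint_div assms continuous_intros)

text \<open>Picard iteration on the whole line at once. The unknown is the angle divided by the
  weight \<open>cosh (2 * K t)\<close>; in this weighted supremum norm the integral operator
  contracts by \<open>1/2\<close>, whatever the size of the integral of \<open>q\<close>. The weight
  is even because \<open>K\<close> takes both signs.\<close>

lemma prufer_exists:
  assumes w: "w > 0" and q: "locint q"
  shows "\<exists>\<Theta>. is_prufer w q \<Theta> \<and> \<Theta> 0 = \<theta>"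
proof -
  \<comment> \<open>A common bound for the right-hand side and for its Lipschitz constant in the
    angle.\<close>
  define k where "k = (\<lambda>t. w + \<bar>q t\<bar> / w)"
  have "locint k" unfolding k_def by (intro locint_intros q)
  then obtain K where K: "ac K k" "K 0 = 0" using ac_primitive by blast
  have cK: "continuous_on UNIV K" using ac_cont[OF K(1)] .
  define X where "X = (\<lambda>(y :: real \<Rightarrow>\<^sub>C real) t. cosh (2 * K t) * apply_bcontfun y t)"
  define f where "f = (\<lambda>y t. w * (cos (X y t))\<^sup>2 + q t / w * (sin (X y t))\<^sup>2)"
  have "continuous_on UNIV (X y)" for y
    unfolding X_def by (intro continuous_intros cK) auto
  then have "locint (f y)" for y
    unfolding f_def by (intro locint_prufer_rhs q)
  then have "\<forall>y. \<exists>P. ac P (f y) \<and> P 0 = 0" using ac_primitive by metis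
  then obtain P where P: "\<And>y. ac (P y) (f y)" "\<And>y. P y 0 = 0" by metis
  define \<Phi> where "\<Phi> = (\<lambda>y. Bcontfun (\<lambda>t. (\<theta> + P y t) / cosh (2 * K t)))"
  have K_cosh: "\<bar>K t\<bar> \<le> cosh (2 * K t)" for t
  proof -
    have "1 + 2 * \<bar>K t\<bar> \<le> exp (2 * \<bar>K t\<bar>)" by (rule exp_ge_add_one_self)
    also have "\<dots> \<le> exp (2 * K t) + exp (- (2 * K t))"
      by (cases "K t \<ge> 0") auto
    also have "\<dots> = 2 * cosh (2 * K t)" by (simp add: cosh_field_def)
    finally show ?thesis by simp
  qed
  have f_bound: "\<bar>f y t\<bar> \<le> k t" for y t
  proof -
    have a: "(cos x)\<^sup>2 \<le> 1" "(sin x)\<^sup>2 \<le> 1" for x :: real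
      by (auto simp: abs_square_le_1)
    have "\<bar>f y t\<bar> \<le> w * (cos (X y t))\<^sup>2 + \<bar>q t\<bar> / w * (sin (X y t))\<^sup>2"
      unfolding f_def using w by (intro order_trans[OF abs_triangle_ineq]) (auto simp: abs_mult)
    also have "\<dots> \<le> w * 1 + \<bar>q t\<bar> / w * 1"
      using w a by (intro add_mono mult_left_mono) auto
    finally show ?thesis by (simp add: k_def)
  qed
  have f_lip: "\<bar>f y t - f z t\<bar> \<le> k t * \<bar>X y t - X z t\<bar>" for y z t
  proof -
    have "f y t - f z t = (q t / w - w) * ((sin (X y t))\<^sup>2 - (sin (X z t))\<^sup>2)"
      unfolding f_def cos_squared_eq by (simp add: algebra_simps)
    moreover have "\<bar>q t / w - w\<bar> \<le> k t" unfolding k_def using w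
      by (intro order_trans[OF abs_triangle_ineq4]) auto
    ultimately show ?thesis
      by (simp add: abs_mult mult_mono abs_sin_squared_diff_le k_def w)
  qed
  have ap: "apply_bcontfun (\<Phi> y) = (\<lambda>t. (\<theta> + P y t) / cosh (2 * K t))" for y
  proof -
    have "(\<lambda>t. (\<theta> + P y t) / cosh (2 * K t)) \<in> bcontfun"
    proof (rule bcontfun_normI)
      show "continuous_on UNIV (\<lambda>t. (\<theta> + P y t) / cosh (2 * K t))"
        using ac_cont[OF P(1)] by (intro continuous_intros cK) auto
      fix t
      have "\<bar>P y t - P y 0\<bar> \<le> \<bar>K t - K 0\<bar>"
        by (rule ac_bound[OF P(1) K(1) f_bound])
      then have "\<bar>P y t\<bar> \<le> \<bar>K t\<bar>"
        using P(2) K(2) by simp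
      then have "\<bar>\<theta> + P y t\<bar> \<le> \<bar>\<theta>\<bar> * cosh (2 * K t) + 1 * cosh (2 * K t)"
        using K_cosh[of t] mult_left_mono[OF cosh_real_ge_1, of "\<bar>\<theta>\<bar>" "2 * K t"] by auto
      then show "norm ((\<theta> + P y t) / cosh (2 * K t)) \<le> \<bar>\<theta>\<bar> + 1"
        by (simp add: pos_divide_le_eq algebra_simps)
    qed
    then show ?thesis unfolding \<Phi>_def by (rule Bcontfun_inverse)
  qed
  have "\<exists>!y. \<Phi> y = y"
  proof (rule banach_fix_type[of "1/2"])
    show "\<forall>y z. dist (\<Phi> y) (\<Phi> z) \<le> 1 / 2 * dist y z"
    proof (intro allI dist_bound)
      fix y z :: "real \<Rightarrow>\<^sub>C real" and t :: real
      let ?c = "dist y z"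
      \<comment> \<open>\<open>k * cosh (2 * K)\<close> integrates to
        \<open>sinh (2 * K) / 2\<close>, at most half the weight: the source of the contraction
        factor.\<close>
      have sh: "ac (\<lambda>t. ?c * (1 / 2 * sinh (2 * K t))) (\<lambda>t. ?c * (1 / 2 * (cosh (2 * K t) * (2 * k t))))"
        by (intro ac_cmul ac_chain[where G = sinh and g = cosh] K(1))
          (auto intro!: derivative_eq_intros continuous_intros)
      have "\<bar>X y t - X z t\<bar> \<le> cosh (2 * K t) * ?c" for t
        using dist_bounded[where f = y and g = z and x = t] by (simp add: X_def dist_real_def abs_mult flip: right_diff_distrib)
      then have "k t * \<bar>X y t - X z t\<bar> \<le> k t * (cosh (2 * K t) * ?c)" for t
        using w by (intro mult_left_mono) (auto simp: k_def)
      then have "\<bar>f y t - f z t\<bar> \<le> ?c * (1 / 2 * (cosh (2 * K t) * (2 * k t)))" for t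
        using order_trans[OF f_lip] by (simp add: mult_ac)
      then have "\<bar>(P y t - P z t) - (P y 0 - P z 0)\<bar>
        \<le> \<bar>?c * (1 / 2 * sinh (2 * K t)) - ?c * (1 / 2 * sinh (2 * K 0))\<bar>"
        by (intro ac_bound[OF ac_diff[OF P(1) P(1)] sh])
      then have "\<bar>P y t - P z t\<bar> \<le> \<bar>?c * (1 / 2 * sinh (2 * K t))\<bar>"
        using P(2) K(2) by simp
      also have "\<dots> \<le> ?c * (1 / 2 * cosh (2 * K t))"
        unfolding abs_mult using sinh_less_cosh_real[of "2 * K t"] sinh_less_cosh_real[of "- (2 * K t)"]
        by (intro mult_mono) auto
      finally have "\<bar>(P y t - P z t) / cosh (2 * K t)\<bar> \<le> ?c / 2"
        by (simp add: pos_divide_le_eq)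
      then show "dist (apply_bcontfun (\<Phi> y) t) (apply_bcontfun (\<Phi> z) t) \<le> 1 / 2 * ?c"
        by (simp add: ap dist_real_def diff_divide_distrib add_divide_distrib)
    qed
  qed auto
  then obtain y where y: "\<Phi> y = y" by blast
  have eq: "X y t = \<theta> + P y t" for t
    using fun_cong[OF ap[of y], of t] y by (simp add: X_def)
  have "ac (X y) (f y)"
    using ac_add[OF ac_const[of \<theta>] P(1)[of y]] by (rule ac_cong) (auto simp: eq)
  then show ?thesis
    using eq[of 0] P(2) by (intro exI[of _ "X y"]) (auto simp: is_prufer_def f_def)
qed

lemma is_prufer_cont: "is_prufer w q \<Theta> \<Longrightarrow> continuous_on UNIV \<Theta>"
  unfolding is_prufer_def by (rule ac_cont)

lemma ac_abs_le_int:
  assumes "ac F f" "locint k" "F 0 = 0" "\<And>t. \<bar>f t\<bar> \<le> k t" "t \<ge> 0"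
  shows "\<bar>F t\<bar> \<le> integral {0..t} k"
proof -
  obtain K where K: "ac K k" "K 0 = 0" using ac_primitive[OF assms(2)] by blast
  have "K 0 \<le> K t" 
    by (rule ac_mono[OF K(1) assms(5)]) (use assms(4) in \<open>auto intro!: AE_I2 intro: order_trans[OF abs_ge_zero]\<close>)
  then show ?thesis
    using ac_bound[OF assms(1) K(1) assms(4), of t 0] ac_int[OF K(1) assms(5)] K(2) assms(3) by simp
qed

text \<open>
  The difference of two Pruefer angles satisfies a linear equation:
  \<open>(\<Theta>\<^sub>2 - \<Theta>\<^sub>1)' = c (\<Theta>\<^sub>2 - \<Theta>\<^sub>1) + (q\<^sub>2 - q\<^sub>1) / w * sin\<^sup>2 \<Theta>\<^sub>2\<close>. Here \<open>C\<close> is the primitive of \<open>c\<close>.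
\<close>

lemma prufer_diff:
  assumes q1: "locint q1" and T1: "is_prufer w q1 \<Theta>1" and T2: "is_prufer w q2 \<Theta>2"
  obtains C where "C 0 = 0"
    "\<And>t. t \<ge> 0 \<Longrightarrow> \<bar>C t\<bar> \<le> integral {0..t} (\<lambda>x. \<bar>q1 x / w - w\<bar>)"
    "ac (\<lambda>t. (\<Theta>2 t - \<Theta>1 t) * exp (- C t)) (\<lambda>t. (q2 t - q1 t) / w * (sin (\<Theta>2 t))\<^sup>2 * exp (- C t))"
proof -
  \<comment> \<open>The difference quotient of the squared sine, by \<open>sin_squared_diff\<close>;
    it is bounded by \<open>1\<close>, and \<open>sinc\<close> gives it a meaning where the angles
    coincide.\<close>
  define g where "g = (\<lambda>t. sin (\<Theta>1 t + \<Theta>2 t) * sinc (\<Theta>2 t - \<Theta>1 t))"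
  have [measurable]: "\<Theta>1 \<in> borel_measurable borel" "\<Theta>2 \<in> borel_measurable borel"
    using is_prufer_cont[OF T1] is_prufer_cont[OF T2] by (auto intro: borel_measurable_continuous_onI)
  have gm: "g \<in> borel_measurable borel" unfolding g_def by measurable
  have g1: "\<bar>g t\<bar> \<le> 1" for t
    unfolding g_def abs_mult using mult_mono[OF abs_sin_le_one abs_sinc_le_1] by simp
  have li: "locint (\<lambda>t. g t * (q1 t / w - w))"
    using g1 by (intro locint_mult gm locint_intros q1) (auto simp: bounded_iff)
  then obtain C where C: "ac C (\<lambda>t. g t * (q1 t / w - w))" "C 0 = 0" using ac_primitive by blast
  have "ac (\<lambda>t. (\<Theta>2 t - \<Theta>1 t) * exp (- C t)) (\<lambda>t. (q2 t - q1 t) / w * (sin (\<Theta>2 t))\<^sup>2 * exp (- C t))"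
    using ac_integrating_factor[OF ac_diff[OF T2[unfolded is_prufer_def] T1[unfolded is_prufer_def]] C(1)]
  proof (rule ac_cong)
    fix t
    have "g t * (\<Theta>2 t - \<Theta>1 t) = (sin (\<Theta>2 t))\<^sup>2 - (sin (\<Theta>1 t))\<^sup>2"
      using sinc_mult[of "\<Theta>2 t - \<Theta>1 t"] by (simp add: g_def sin_squared_diff add.commute mult.assoc)
    then have *: "g t * (q1 t / w - w) * (\<Theta>2 t - \<Theta>1 t) = (q1 t / w - w) * ((sin (\<Theta>2 t))\<^sup>2 - (sin (\<Theta>1 t))\<^sup>2)"
      by (simp add: mult_ac)
    show "(w * (cos (\<Theta>2 t))\<^sup>2 + q2 t / w * (sin (\<Theta>2 t))\<^sup>2 - (w * (cos (\<Theta>1 t))\<^sup>2 + q1 t / w * (sin (\<Theta>1 t))\<^sup>2)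
       - g t * (q1 t / w - w) * (\<Theta>2 t - \<Theta>1 t)) * exp (- C t) = (q2 t - q1 t) / w * (sin (\<Theta>2 t))\<^sup>2 * exp (- C t)"
      unfolding * cos_squared_eq by (simp add: algebra_simps diff_divide_distrib)
  qed auto
  moreover have "\<bar>C t\<bar> \<le> integral {0..t} (\<lambda>x. \<bar>q1 x / w - w\<bar>)" if "t \<ge> 0" for t
    by (rule ac_abs_le_int[OF C(1) _ C(2) _ that])
      (use g1 in \<open>auto intro!: locint_intros q1 simp: abs_mult mult_left_le_one_le\<close>)
  ultimately show thesis using that C(2) by blast
qed

text \<open>For equal potentials the inhomogeneous term of \<open>prufer_diff\<close> drops out, so
  the difference times a positive factor is constant and keeps its sign for all times.\<close>

lemma prufer_order:
  assumes "locint q" "is_prufer w q \<Theta>1" "is_prufer w q \<Theta>2"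
  shows "\<Theta>1 s < \<Theta>2 s \<longleftrightarrow> \<Theta>1 t < \<Theta>2 t"
proof -
  obtain C where C: "ac (\<lambda>t. (\<Theta>2 t - \<Theta>1 t) * exp (- C t)) (\<lambda>t. 0)"
    using prufer_diff[OF assms] by (auto simp: assms)
  have "(\<Theta>2 s - \<Theta>1 s) * exp (- C s) = (\<Theta>2 t - \<Theta>1 t) * exp (- C t)"
    using ac_int[OF C, of s t] ac_int[OF C, of t s] by (cases "s \<le> t") auto
  then have "(\<Theta>2 s - \<Theta>1 s) * exp (- C s) > 0 \<longleftrightarrow> (\<Theta>2 t - \<Theta>1 t) * exp (- C t) > 0" by simp
  then show ?thesis by (simp add: zero_less_mult_iff)
qed

lemma prufer_unique:
  assumes "locint q" "is_prufer w q \<Theta>1" "is_prufer w q \<Theta>2" "\<Theta>1 s = \<Theta>2 s"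
  shows "\<Theta>1 t = \<Theta>2 t"
  using prufer_order[OF assms(1,2,3), of s t] prufer_order[OF assms(1,3,2), of s t] assms(4) by auto

section \<open>The linear equation and its initial value problem\<close>

definition sol :: "(real \<Rightarrow> real) \<Rightarrow> (real \<Rightarrow> real) \<Rightarrow> (real \<Rightarrow> real) \<Rightarrow> bool" where
  "sol q u v \<longleftrightarrow> ac u v \<and> ac v (\<lambda>t. - q t * u t)"

text \<open>The energy obeys \<open>|E'| \<le> (1 + |q|) E\<close>, and Gronwall in both directions
  carries its vanishing across the interval. The equation is assumed only almost everywhere, so that
  the lemma also identifies functions known to solve it up to a null set.\<close>

lemma ac_energy_zero:
  assumes "ac u v" "ac v f" "locint q" "s \<le> t" "AE x in lebesgue. x \<in> {s..t} \<longrightarrow> f x = - q x * u x"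
  shows "u s = 0 \<and> v s = 0 \<longleftrightarrow> u t = 0 \<and> v t = 0"
proof -
  define E where "E = (\<lambda>t. (u t)\<^sup>2 + (v t)\<^sup>2)"
  define E' where "E' = (\<lambda>t. 2 * (u t * v t) + 2 * (v t * f t))"
  have E: "ac E E'" unfolding E_def
    using ac_add[OF ac_mult[OF assms(1,1)] ac_mult[OF assms(2,2)]]
    by (rule ac_cong) (auto simp: E'_def power2_eq_square)
  have "locint (\<lambda>t. 1 + \<bar>q t\<bar>)" by (intro locint_intros assms(3))
  then obtain K where K: "ac K (\<lambda>t. 1 + \<bar>q t\<bar>)" using ac_primitive by blast
  have b: "\<bar>E' x\<bar> \<le> (1 + \<bar>q x\<bar>) * E x" if "f x = - q x * u x" for x
  proof -
    have "E' x = 2 * (u x * v x) * (1 - q x)" using that by (simp add: E'_def algebra_simps)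
    moreover have "\<bar>2 * (u x * v x)\<bar> \<le> E x"
      unfolding E_def using sum_squares_bound[of "u x" "v x"] sum_squares_bound[of "u x" "- v x"]
      by (auto simp: abs_le_iff)
    moreover have "\<bar>1 - q x\<bar> \<le> 1 + \<bar>q x\<bar>" by simp
    moreover have "0 \<le> E x" by (simp add: E_def)
    ultimately have "\<bar>E' x\<bar> \<le> E x * (1 + \<bar>q x\<bar>)"
      using mult_mono[of "\<bar>2 * (u x * v x)\<bar>" "E x" "\<bar>1 - q x\<bar>" "1 + \<bar>q x\<bar>"]
      by (simp add: abs_mult)
    then show ?thesis by (simp add: mult.commute)
  qed
  have b2: "- (1 + \<bar>q x\<bar>) * E x \<le> E' x" "(1 + \<bar>q x\<bar>) * (- E x) \<le> - E' x" if "f x = - q x * u x" for x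
    using b[OF that] unfolding abs_le_iff by linarith+
  have ae: "AE x in lebesgue. x \<in> {s..t} \<longrightarrow> - (1 + \<bar>q x\<bar>) * E x \<le> E' x"
    "AE x in lebesgue. x \<in> {s..t} \<longrightarrow> (1 + \<bar>q x\<bar>) * (- E x) \<le> - E' x"
    by (rule eventually_mono[OF assms(5)], use b2 in blast)+
  have "E s * exp (- K t - - K s) \<le> E t"
    by (rule ac_comparison[OF E ac_uminus[OF K] assms(4) ae(1)])
  moreover have "- E s * exp (K t - K s) \<le> - E t"
    by (rule ac_comparison[OF ac_uminus[OF E] K assms(4) ae(2)])
  ultimately have "E s = 0 \<longleftrightarrow> E t = 0"
    by (smt (verit, best) E_def exp_gt_zero mult_pos_pos sum_power2_ge_zero mult_eq_0_iff)
  then show ?thesis by (simp add: E_def sum_power2_eq_zero_iff)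
qed

lemma ac_energy_zero_on:
  assumes "ac u v" "ac v f" "locint q" "AE x in lebesgue. x \<in> {s..t} \<longrightarrow> f x = - q x * u x"
    "u r = 0" "v r = 0" "r \<in> {s..t}" "x \<in> {s..t}"
  shows "u x = 0 \<and> v x = 0"
proof (cases "r \<le> x")
  case True
  have "AE y in lebesgue. y \<in> {r..x} \<longrightarrow> f y = - q y * u y"
    using assms(4,7,8) by (auto elim!: eventually_mono)
  from ac_energy_zero[OF assms(1,2,3) True this] assms(5,6) show ?thesis by simp
next
  case False
  then have le: "x \<le> r" by simp
  have "AE y in lebesgue. y \<in> {x..r} \<longrightarrow> f y = - q y * u y"
    using assms(4,7,8) by (auto elim!: eventually_mono)
  from ac_energy_zero[OF assms(1,2,3) le this] assms(5,6) show ?thesis by simp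
qed

lemma sol_lincomb:
  assumes "sol q u1 v1" "sol q u2 v2"
  shows "sol q (\<lambda>t. c * u1 t + d * u2 t) (\<lambda>t. c * v1 t + d * v2 t)"
  unfolding sol_def
proof
  show "ac (\<lambda>t. c * u1 t + d * u2 t) (\<lambda>t. c * v1 t + d * v2 t)"
    using assms by (intro ac_add ac_cmul) (auto simp: sol_def)
  have "ac (\<lambda>t. c * v1 t + d * v2 t) (\<lambda>t. c * (- q t * u1 t) + d * (- q t * u2 t))"
    using assms by (intro ac_add ac_cmul) (auto simp: sol_def)
  then show "ac (\<lambda>t. c * v1 t + d * v2 t) (\<lambda>t. - q t * (c * u1 t + d * u2 t))"
    by (rule ac_cong) (auto simp: algebra_simps)
qed

lemma sol_zero:
  assumes "locint q" "sol q u v" "u s = 0" "v s = 0"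
  shows "u t = 0" "v t = 0"
  using ac_energy_zero_on[of u v "\<lambda>t. - q t * u t" q "min s t" "max s t" s t] assms
  by (auto simp: sol_def)

lemma sol_unique:
  assumes "locint q" "sol q u1 v1" "sol q u2 v2" "u1 s = u2 s" "v1 s = v2 s"
  shows "u1 t = u2 t" "v1 t = v2 t"
  using sol_zero[OF assms(1) sol_lincomb[OF assms(2,3), of 1 "-1"], of s t] assms(4,5) by auto

text \<open>\<open>R\<close> is the logarithm of the radius. With this density the terms of each
  component combine to a multiple of \<open>sin^2 + cos^2\<close>.\<close>

lemma sol_of_prufer:
  assumes w: "w > 0" and T: "is_prufer w q \<Theta>" and R: "ac R (\<lambda>t. (w - q t / w) * (sin (\<Theta> t) * cos (\<Theta> t)))"
  shows "sol q (\<lambda>t. exp (R t) * sin (\<Theta> t)) (\<lambda>t. w * (exp (R t) * cos (\<Theta> t)))"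
proof -
  have sc: "sin x * sin x + cos x * cos x = 1" for x :: real using sin_cos_squared_add3[of x] by linarith
  note T = T[unfolded is_prufer_def]
  have "ac (\<lambda>t. exp (R t) * sin (\<Theta> t)) (\<lambda>t. w * (exp (R t) * cos (\<Theta> t)))"
    using ac_mult[OF ac_exp[OF R] ac_sin[OF T]]
  proof (rule ac_cong)
    fix t
    let ?s = "sin (\<Theta> t)" and ?c = "cos (\<Theta> t)"
    have "exp (R t) * ((w - q t / w) * (?s * ?c)) * ?s + exp (R t) * (?c * (w * ?c\<^sup>2 + q t / w * ?s\<^sup>2))
      = w * (exp (R t) * ?c) * (?s * ?s + ?c * ?c)"
      by (simp only: power2_eq_square ring_distribs) (simp add: mult_ac del: sin_cos_squared_add3)
    then show "exp (R t) * ((w - q t / w) * (?s * ?c)) * ?s + exp (R t) * (?c * (w * ?c\<^sup>2 + q t / w * ?s\<^sup>2))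
      = w * (exp (R t) * ?c)" by (simp only: sc)
  qed simp
  moreover have "ac (\<lambda>t. w * (exp (R t) * cos (\<Theta> t))) (\<lambda>t. - q t * (exp (R t) * sin (\<Theta> t)))"
    using ac_cmul[OF ac_mult[OF ac_exp[OF R] ac_cos[OF T]], of w]
  proof (rule ac_cong)
    fix t
    let ?s = "sin (\<Theta> t)" and ?c = "cos (\<Theta> t)"
    have "w * (exp (R t) * ((w - q t / w) * (?s * ?c)) * ?c + exp (R t) * (- ?s * (w * ?c\<^sup>2 + q t / w * ?s\<^sup>2)))
      = - (w * (q t / w)) * (exp (R t) * ?s) * (?s * ?s + ?c * ?c)"
      by (simp only: power2_eq_square ring_distribs) (simp add: mult_ac)
    then show "w * (exp (R t) * ((w - q t / w) * (?s * ?c)) * ?c + exp (R t) * (- ?s * (w * ?c\<^sup>2 + q t / w * ?s\<^sup>2)))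
      = - q t * (exp (R t) * ?s)" using w by (simp only: sc) simp
  qed simp
  ultimately show ?thesis by (simp add: sol_def)
qed

lemma sol_prufer:
  assumes w: "w > 0" and q: "locint q" and s: "sol q u v" and nz: "u 0 = \<rho> * sin \<theta>" "v 0 = w * (\<rho> * cos \<theta>)" "\<rho> > 0"
  obtains \<Theta> r where "is_prufer w q \<Theta>" "\<Theta> 0 = \<theta>" "\<And>t. r t > 0" "r 0 = \<rho>"
    "\<And>t. u t = r t * sin (\<Theta> t)" "\<And>t. v t = w * (r t * cos (\<Theta> t))"
proof -
  obtain \<Theta> where T: "is_prufer w q \<Theta>" "\<Theta> 0 = \<theta>" using prufer_exists[OF w q] by blast
  have "locint (\<lambda>t. (w - q t / w) * (sin (\<Theta> t) * cos (\<Theta> t)))"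
    by (intro locint_mult_cont2 locint_intros q continuous_intros is_prufer_cont[OF T(1)])
  then obtain R where R: "ac R (\<lambda>t. (w - q t / w) * (sin (\<Theta> t) * cos (\<Theta> t)))" "R 0 = 0" using ac_primitive by blast
  have s2: "sol q (\<lambda>t. \<rho> * (exp (R t) * sin (\<Theta> t)) + 0 * (exp (R t) * sin (\<Theta> t))) 
    (\<lambda>t. \<rho> * (w * (exp (R t) * cos (\<Theta> t))) + 0 * (w * (exp (R t) * cos (\<Theta> t))))"
    by (intro sol_lincomb sol_of_prufer[OF w T(1) R(1)])
  show thesis
    by (rule that[of \<Theta> "\<lambda>t. \<rho> * exp (R t)"])
      (use sol_unique[OF q s s2, of 0] T R nz in \<open>auto simp: mult_ac\<close>)
qed

lemma polar_real:
  fixes x y :: real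
  assumes "x \<noteq> 0 \<or> y \<noteq> 0"
  obtains r a where "r > 0" "x = r * sin a" "y = r * cos a"
proof -
  define r where "r = sqrt (x\<^sup>2 + y\<^sup>2)"
  have r: "r > 0" using assms by (simp add: r_def sum_power2_gt_zero_iff)
  have "(y / r)\<^sup>2 + (x / r)\<^sup>2 = 1"
    using r assms by (simp add: power_divide r_def add_divide_distrib[symmetric] add.commute sum_power2_eq_zero_iff)
  then obtain a where "y / r = cos a" "x / r = sin a" using sincos_total_2pi by metis
  then show thesis using that[of r a] r by (auto simp: field_simps)
qed

text \<open>Existence for the linear equation is inherited from the angle, here with scale
  \<open>1\<close>; only the zero initial data have no angle and are treated apart.\<close>

lemma sol_exists:
  assumes "locint q" shows "\<exists>u v. sol q u v \<and> u 0 = x \<and> v 0 = y"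
proof (cases "x = 0 \<and> y = 0")
  case True
  then show ?thesis using ac_const[of 0] by (intro exI[of _ "\<lambda>_. 0"]) (auto simp: sol_def)
next
  case False
  then obtain \<rho> \<theta> where p: "\<rho> > 0" "x = \<rho> * sin \<theta>" "y = \<rho> * cos \<theta>" using polar_real by metis
  obtain \<Theta> where T: "is_prufer 1 q \<Theta>" "\<Theta> 0 = \<theta>" using prufer_exists[of 1 q \<theta>] assms by auto
  have "locint (\<lambda>t. (1 - q t / 1) * (sin (\<Theta> t) * cos (\<Theta> t)))"
    by (intro locint_mult_cont2 locint_intros assms continuous_intros is_prufer_cont[OF T(1)])
  then obtain R where R: "ac R (\<lambda>t. (1 - q t / 1) * (sin (\<Theta> t) * cos (\<Theta> t)))" "R 0 = 0" using ac_primitive by blast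
  from sol_lincomb[OF sol_of_prufer[OF _ T(1) R(1)] sol_of_prufer[OF _ T(1) R(1)], of \<rho> 0]
  have "sol q (\<lambda>t. \<rho> * (exp (R t) * sin (\<Theta> t))) (\<lambda>t. \<rho> * (exp (R t) * cos (\<Theta> t)))" by simp
  then show ?thesis using p T R by (intro exI[of _ "\<lambda>t. \<rho> * (exp (R t) * sin (\<Theta> t))"] exI[of _ "\<lambda>t. \<rho> * (exp (R t) * cos (\<Theta> t))"]) auto
qed

section \<open>The action of a unimodular matrix on directions\<close>

text \<open>The first-order condition at an extremum, in the limit-free form that suits the
  quadratic form \<open>wedge\<close>.\<close>

lemma linear_quadratic_le_zero:
  fixes e k :: real
  assumes "\<And>x. e * x + k * x\<^sup>2 \<le> 0"
  shows "e = 0"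
proof (rule ccontr)
  assume "e \<noteq> 0"
  \<comment> \<open>Large enough that \<open>k + d > 0\<close>; at \<open>x = e / d\<close> the
    linear term then wins.\<close>
  define d where "d = \<bar>k\<bar> + 1"
  have d: "d > 0" "k + d > 0" by (auto simp: d_def)
  have "e * (e / d) + k * (e / d)\<^sup>2 = e\<^sup>2 * (k + d) / d\<^sup>2"
    using d by (simp add: power2_eq_square field_simps)
  moreover have "\<dots> > 0" using \<open>e \<noteq> 0\<close> d by simp
  ultimately show False using assms[of "e / d"] by simp
qed

lemma sin_cos_eq_iff_int:
  fixes x y :: real
  shows "sin x = sin y \<and> cos x = cos y \<longleftrightarrow> (\<exists>k::int. x = y + 2 * pi * of_int k)"
  by (subst sin_cos_eq_iff) (auto simp: mult_ac)

context
  fixes m11 m12 m21 m22 :: real and \<rho> \<phi> :: "real \<Rightarrow> real"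
  assumes det: "m11 * m22 - m12 * m21 = 1"
    and pos: "\<And>\<theta>. \<rho> \<theta> > 0"
    and img_sin: "\<And>\<theta>. \<rho> \<theta> * sin (\<phi> \<theta>) = m11 * sin \<theta> + m12 * cos \<theta>"
    and img_cos: "\<And>\<theta>. \<rho> \<theta> * cos (\<phi> \<theta>) = m21 * sin \<theta> + m22 * cos \<theta>"
    and width: "\<And>\<theta> \<theta>'. \<bar>(\<phi> \<theta> - \<theta>) - (\<phi> \<theta>' - \<theta>')\<bar> < pi"
begin

text \<open>The determinant of the image of \<open>(x, y)\<close> and \<open>(x, y)\<close> itself;
  its sign tells to which side the matrix moves this direction.\<close>

definition wedge :: "real \<Rightarrow> real \<Rightarrow> real" where
  "wedge x y = (m11 * x + m12 * y) * y - (m21 * x + m22 * y) * x"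

lemma wedge_sin_cos: "wedge (sin \<theta>) (cos \<theta>) = \<rho> \<theta> * sin (\<phi> \<theta> - \<theta>)"
  unfolding wedge_def img_sin[symmetric] img_cos[symmetric] by (simp add: sin_diff algebra_simps)

lemma wedge_polar: "wedge (r * sin \<theta>) (r * cos \<theta>) = r\<^sup>2 * (\<rho> \<theta> * sin (\<phi> \<theta> - \<theta>))"
  unfolding wedge_sin_cos[symmetric] by (simp add: wedge_def power2_eq_square algebra_simps)

text \<open>By \<open>width\<close> the turning of \<open>\<theta>\<close> lies within \<pi> of the
  turning \<open>2 k \<pi>\<close> of \<open>\<alpha>\<close>, and there the sine has the sign of
  its argument. The factor \<open>\<sigma>\<close> serves maximum and minimum together.\<close>

lemma planar_sign:
  assumes "\<phi> \<alpha> - \<alpha> = 2 * pi * of_int k" "\<sigma> = 1 \<or> \<sigma> = -1"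
  shows "\<sigma> * wedge (sin \<theta>) (cos \<theta>) \<le> 0 \<longleftrightarrow> \<sigma> * (\<phi> \<theta> - \<theta> - 2 * pi * of_int k) \<le> 0"
proof -
  define x where "x = \<phi> \<theta> - \<theta> - 2 * pi * of_int k"
  have x: "- pi < x" "x < pi"
    using width[of \<theta> \<alpha>] assms(1) by (auto simp: x_def)
  have "sin (\<phi> \<theta> - \<theta>) = sin (x + 2 * pi * of_int k)" by (simp add: x_def)
  also have "\<dots> = sin x" using sin_cos_eq_iff_int by blast
  finally have w: "wedge (sin \<theta>) (cos \<theta>) = \<rho> \<theta> * sin x" by (simp add: wedge_sin_cos)
  have "x > 0 \<Longrightarrow> sin x > 0" "x < 0 \<Longrightarrow> sin x < 0"
    using x sin_gt_zero[of x] sin_gt_zero[of "- x"] by auto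
  then have "sin x \<le> 0 \<longleftrightarrow> x \<le> 0" "sin x \<ge> 0 \<longleftrightarrow> x \<ge> 0" by (metis linorder_not_less order_less_imp_le sin_zero order_le_less)+
  then show ?thesis
    using assms(2) pos[of \<theta>] unfolding w x_def[symmetric] by (auto simp: mult_le_0_iff zero_le_mult_iff)
qed

text \<open>An extremal direction whose turning is a multiple of 2 \<pi> is an eigenvector with some
  factor \<open>r > 0\<close>. Tilting it by \<open>x\<close> changes \<open>wedge\<close> to first
  order by \<open>(1 / r - r) * x\<close>, where \<open>1 / r\<close> comes from determinant one; as
  \<open>wedge\<close> keeps its sign, \<open>r = 1\<close>.\<close>

lemma planar_extremum_fixed:
  assumes \<alpha>: "\<phi> \<alpha> - \<alpha> = 2 * pi * of_int k"
    and \<sigma>: "\<sigma> = 1 \<or> \<sigma> = -1" and ext: "\<And>\<theta>. \<sigma> * (\<phi> \<theta> - \<theta> - 2 * pi * of_int k) \<le> 0"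
  shows "m11 * sin \<alpha> + m12 * cos \<alpha> = sin \<alpha>" "m21 * sin \<alpha> + m22 * cos \<alpha> = cos \<alpha>"
proof -
  define s c r where "s = sin \<alpha>" "c = cos \<alpha>" "r = \<rho> \<alpha>"
  have sc: "s * s + c * c = 1" using sin_cos_squared_add3[of \<alpha>] by (simp add: s_c_r_def add.commute)
  have "\<phi> \<alpha> = \<alpha> + 2 * pi * of_int k" using \<alpha> by simp
  then have "sin (\<phi> \<alpha>) = s" "cos (\<phi> \<alpha>) = c" using sin_cos_eq_iff_int unfolding s_c_r_def by blast+
  then have M: "m11 * s + m12 * c = r * s" "m21 * s + m22 * c = r * c"
    using img_sin[of \<alpha>] img_cos[of \<alpha>] by (auto simp: s_c_r_def)
  \<comment> \<open>The image of \<open>(c, - s)\<close>, the vector orthogonal to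
    \<open>(s, c)\<close>.\<close>
  define A B where "A = m11 * c - m12 * s" "B = m21 * c - m22 * s"
  have "(m11 * s + m12 * c) * B - (m21 * s + m22 * c) * A = - (m11 * m22 - m12 * m21) * (s * s + c * c)"
    unfolding A_B_def by (simp add: algebra_simps)
  then have "r * (A * c - B * s) = 1" unfolding M det sc by (simp add: algebra_simps)
  then have AB: "A * c - B * s = 1 / r" using pos[of \<alpha>] by (simp add: s_c_r_def field_simps)
  have neg: "\<sigma> * wedge x y \<le> 0" for x y
  proof (cases "x = 0 \<and> y = 0")
    case False
    then obtain R a where R: "x = R * sin a" "y = R * cos a" using polar_real by metis
    have "\<sigma> * wedge (sin a) (cos a) \<le> 0" using planar_sign[OF \<alpha> \<sigma>] ext by blast
    then have "R\<^sup>2 * (\<sigma> * wedge (sin a) (cos a)) \<le> 0" by (simp add: mult_nonneg_nonpos)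
    then show ?thesis unfolding R wedge_polar wedge_sin_cos by (simp add: mult_ac)
  qed (simp add: wedge_def)
  have "\<sigma> * (1 / r - r) * x + \<sigma> * (- A * s - B * c) * x\<^sup>2 \<le> 0" for x
  proof -
    have "wedge (s + x * c) (c - x * s) = ((m11 * s + m12 * c) + x * A) * (c - x * s) - ((m21 * s + m22 * c) + x * B) * (s + x * c)"
      unfolding wedge_def A_B_def by (simp add: algebra_simps)
    also have "\<dots> = x * ((A * c - B * s) - r * (s * s + c * c)) + x\<^sup>2 * (- A * s - B * c)"
      unfolding M by (simp add: algebra_simps power2_eq_square)
    also have "\<dots> = x * (1 / r - r) + x\<^sup>2 * (- A * s - B * c)" unfolding AB sc by simp
    finally have "\<sigma> * (x * (1 / r - r) + x\<^sup>2 * (- A * s - B * c)) \<le> 0"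
      using neg[of "s + x * c" "c - x * s"] by simp
    moreover have "\<sigma> * (1 / r - r) * x + \<sigma> * (- A * s - B * c) * x\<^sup>2
      = \<sigma> * (x * (1 / r - r) + x\<^sup>2 * (- A * s - B * c))"
      by (simp only: ring_distribs mult_ac)
    ultimately show ?thesis by simp
  qed
  from linear_quadratic_le_zero[OF this] have "1 / r = r" using \<sigma> by auto
  then have "r * r = 1" using pos[of \<alpha>] by (simp add: field_simps s_c_r_def)
  then have "r = 1" using pos[of \<alpha>] by (simp add: s_c_r_def square_eq_1_iff)
  then show "m11 * sin \<alpha> + m12 * cos \<alpha> = sin \<alpha>" "m21 * sin \<alpha> + m22 * cos \<alpha> = cos \<alpha>"
    using M by (auto simp: s_c_r_def)
qed

text \<open>With determinant one, a matrix with a fixed vector is a shear: all directions move to the same side.\<close>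

lemma planar_fixed_extremum:
  assumes fx: "m11 * x + m12 * y = x" "m21 * x + m22 * y = y" and nz: "x \<noteq> 0 \<or> y \<noteq> 0"
  obtains \<alpha> k \<sigma> where "\<phi> \<alpha> - \<alpha> = 2 * pi * of_int k" "\<sigma> = 1 \<or> \<sigma> = -1"
    "\<And>\<theta>. \<sigma> * (\<phi> \<theta> - \<theta> - 2 * pi * of_int k) \<le> 0"
proof -
  obtain R \<alpha> where R: "R > 0" "x = R * sin \<alpha>" "y = R * cos \<alpha>" using nz polar_real by metis
  define s c where "s = sin \<alpha>" "c = cos \<alpha>"
  have sc: "s * s + c * c = 1" using sin_cos_squared_add3[of \<alpha>] by (simp add: s_c_def add.commute)
  have "R * (m11 * s + m12 * c) = R * s" "R * (m21 * s + m22 * c) = R * c"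
    using fx unfolding R s_c_def by (auto simp: algebra_simps)
  then have M: "m11 * s + m12 * c = s" "m21 * s + m22 * c = c" using R(1) by auto
  have im: "\<rho> \<alpha> * sin (\<phi> \<alpha>) = s" "\<rho> \<alpha> * cos (\<phi> \<alpha>) = c" using img_sin[of \<alpha>] img_cos[of \<alpha>] M by (auto simp: s_c_def)
  have "(\<rho> \<alpha>)\<^sup>2 * ((sin (\<phi> \<alpha>))\<^sup>2 + (cos (\<phi> \<alpha>))\<^sup>2) = (\<rho> \<alpha> * sin (\<phi> \<alpha>))\<^sup>2 + (\<rho> \<alpha> * cos (\<phi> \<alpha>))\<^sup>2"
    by (simp only: power_mult_distrib distrib_left)
  also have "\<dots> = 1" unfolding im using sc by (simp add: power2_eq_square)
  finally have "\<rho> \<alpha> = 1" using pos[of \<alpha>] by (simp add: power2_eq_1_iff)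
  then have "sin (\<phi> \<alpha>) = sin \<alpha> \<and> cos (\<phi> \<alpha>) = cos \<alpha>" using im by (simp add: s_c_def)
  then obtain k :: int where k: "\<phi> \<alpha> - \<alpha> = 2 * pi * of_int k" unfolding sin_cos_eq_iff_int by auto
  define A B where "A = m11 * c - m12 * s" "B = m21 * c - m22 * s"
  have "(m11 * s + m12 * c) * B - (m21 * s + m22 * c) * A = - (m11 * m22 - m12 * m21) * (s * s + c * c)"
    unfolding A_B_def by (simp add: algebra_simps)
  then have AB: "A * c - B * s = 1" unfolding M det sc by (simp add: algebra_simps)
  \<comment> \<open>The shear constant: in the basis \<open>(s, c)\<close>, \<open>(c, - s)\<close>
    everything in \<open>wedge\<close> cancels except \<open>C\<close> times the square of the
    second coordinate.\<close>
  define C where "C = - A * s - B * c"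
  have w: "wedge x y = C * (x * c - y * s)\<^sup>2" for x y
  proof -
    define a b where "a = x * s + y * c" "b = x * c - y * s"
    have "a * s + b * c = x * (s * s + c * c)" "a * c - b * s = y * (s * s + c * c)"
      unfolding a_b_def by (simp_all add: algebra_simps)
    then have xy: "x = a * s + b * c" "y = a * c - b * s" unfolding sc by auto
    have "wedge (a * s + b * c) (a * c - b * s) = (a * (m11 * s + m12 * c) + b * A) * (a * c - b * s) - (a * (m21 * s + m22 * c) + b * B) * (a * s + b * c)"
      unfolding wedge_def A_B_def by (simp add: algebra_simps)
    also have "\<dots> = a * b * ((A * c - B * s) - (s * s + c * c)) + C * b\<^sup>2"
      unfolding M C_def by (simp add: algebra_simps power2_eq_square)
    also have "\<dots> = C * b\<^sup>2" unfolding AB sc by simp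
    finally show ?thesis unfolding xy[symmetric] by (simp add: a_b_def)
  qed
  define \<sigma> where "\<sigma> = (if C \<le> 0 then 1 else - 1 :: real)"
  have \<sigma>: "\<sigma> = 1 \<or> \<sigma> = -1" by (simp add: \<sigma>_def)
  have "\<sigma> * wedge (sin \<theta>) (cos \<theta>) \<le> 0" for \<theta>
    unfolding w \<sigma>_def by (auto intro: mult_nonpos_nonneg)
  then show thesis using that[OF k \<sigma>] planar_sign[OF k \<sigma>] by blast
qed

lemma planar_identity_iff:
  "m11 = 1 \<and> m12 = 0 \<and> m21 = 0 \<and> m22 = 1 \<longleftrightarrow> (\<exists>k::int. \<forall>\<theta>. \<phi> \<theta> - \<theta> = 2 * pi * of_int k)"
proof
  assume m: "m11 = 1 \<and> m12 = 0 \<and> m21 = 0 \<and> m22 = 1"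
  have "wedge x y = 0" for x y unfolding wedge_def using m by simp
  moreover have "m11 * 1 + m12 * 0 = 1" "m21 * 1 + m22 * 0 = 0" using m by auto
  then obtain \<alpha> k where "\<phi> \<alpha> - \<alpha> = 2 * pi * of_int k" by (rule planar_fixed_extremum) auto
  \<comment> \<open>No direction moves to either side, so both signs of \<open>planar_sign\<close>
    apply.\<close>
  ultimately have "\<phi> \<theta> - \<theta> = 2 * pi * of_int k" for \<theta>
    using planar_sign[of \<alpha> k 1 \<theta>] planar_sign[of \<alpha> k "-1" \<theta>] by auto
  then show "\<exists>k::int. \<forall>\<theta>. \<phi> \<theta> - \<theta> = 2 * pi * of_int k" by blast
next
  assume "\<exists>k::int. \<forall>\<theta>. \<phi> \<theta> - \<theta> = 2 * pi * of_int k"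
  then obtain k :: int where k: "\<And>\<theta>. \<phi> \<theta> - \<theta> = 2 * pi * of_int k" by blast
  \<comment> \<open>When the turning is constant every direction is extremal; the angles
    \<open>0\<close> and \<open>pi/2\<close> give the two columns.\<close>
  show "m11 = 1 \<and> m12 = 0 \<and> m21 = 0 \<and> m22 = 1"
    using planar_extremum_fixed[OF k[of 0], of 1] planar_extremum_fixed[OF k[of "pi/2"], of 1] k by simp
qed

end

section \<open>The turning of the Pruefer angle over a period\<close>

text \<open>The choice is harmless: \<open>prufer_unique\<close> leaves only one candidate once
  \<open>w > 0\<close> and \<open>q\<close> is locally integrable.\<close>

definition prufer :: "real \<Rightarrow> (real \<Rightarrow> real) \<Rightarrow> real \<Rightarrow> real \<Rightarrow> real" where
  "prufer w q \<theta> = (SOME \<Theta>. is_prufer w q \<Theta> \<and> \<Theta> 0 = \<theta>)"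

definition turn :: "real \<Rightarrow> real \<Rightarrow> (real \<Rightarrow> real) \<Rightarrow> real \<Rightarrow> real" where
  "turn w T q \<theta> = prufer w q \<theta> T - \<theta>"

definition turn_max :: "real \<Rightarrow> real \<Rightarrow> (real \<Rightarrow> real) \<Rightarrow> real" where
  "turn_max w T q = (SUP \<theta>. turn w T q \<theta>)"

definition turn_min :: "real \<Rightarrow> real \<Rightarrow> (real \<Rightarrow> real) \<Rightarrow> real" where
  "turn_min w T q = (INF \<theta>. turn w T q \<theta>)"

text \<open>The constant may depend on the base point because Gronwall's factor in the later
  estimates is taken from one of the two potentials.\<close>

lemma continuous_on_local_lipschitz:
  fixes F :: "real \<Rightarrow> real"
  assumes F: "\<And>x y. \<bar>F y - F x\<bar> \<le> C x * \<bar>y - x\<bar>"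
  shows "continuous_on UNIV F"
proof -
  have "isCont F x" for x
  proof -
    have "((\<lambda>y. C x * \<bar>y - x\<bar>) \<longlongrightarrow> C x * \<bar>x - x\<bar>) (at x)" by (intro tendsto_intros)
    then have "((\<lambda>y. C x * \<bar>y - x\<bar>) \<longlongrightarrow> 0) (at x)" by simp
    then have "((\<lambda>y. F y - F x) \<longlongrightarrow> 0) (at x)"
      by (rule Lim_null_comparison[rotated]) (rule always_eventually, use F in simp)
    then show ?thesis unfolding isCont_def by (rule LIM_zero_cancel)
  qed
  then show ?thesis by (simp add: continuous_at_imp_continuous_on)
qed

text \<open>At a limit point of zeros the difference quotients vanish arbitrarily close by, so it
  would be a double zero.\<close>

lemma finite_zeros:
  fixes u v :: "real \<Rightarrow> real"
  assumes d: "\<And>t. (u has_real_derivative v t) (at t)" and simple: "\<And>t. u t = 0 \<Longrightarrow> v t \<noteq> 0"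
  shows "finite {t \<in> {a..b}. u t = 0}"
proof (rule ccontr)
  assume inf: "infinite {t \<in> {a..b}. u t = 0}"
  have "compact {a..b}" by simp
  then obtain x where x: "x \<in> {a..b}" "x islimpt {t \<in> {a..b}. u t = 0}"
    using inf unfolding compact_eq_Bolzano_Weierstrass by blast
  have c: "isCont u x" using d DERIV_isCont by blast
  have fr: "\<exists>\<^sub>F t in at x. u t = 0"
    using x(2) unfolding islimpt_conv_frequently_at by (rule frequently_elim1) auto
  have u0: "u x = 0"
  proof (rule ccontr)
    assume "u x \<noteq> 0"
    then have "\<forall>\<^sub>F t in at x. u t \<noteq> 0" using c by (simp add: isCont_def tendsto_imp_eventually_ne)
    then show False using fr by (auto simp: frequently_def)
  qed
  have "((\<lambda>t. (u t - u x) / (t - x)) \<longlongrightarrow> v x) (at x)"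
    using d[of x] by (simp add: has_field_derivative_iff)
  then have "\<forall>\<^sub>F t in at x. (u t - u x) / (t - x) \<noteq> 0"
    using simple[OF u0] by (rule tendsto_imp_eventually_ne)
  then have "\<forall>\<^sub>F t in at x. u t \<noteq> 0"
    by (rule eventually_mono) (use u0 in auto)
  then show False using fr by (simp add: frequently_def)
qed

lemma reduce_pi: obtains n :: int where "a \<le> \<theta> + of_int n * pi" "\<theta> + of_int n * pi < a + pi"
proof -
  define f where "f = \<lfloor>(\<theta> - a) / pi\<rfloor>"
  have "of_int f \<le> (\<theta> - a) / pi" unfolding f_def by (rule of_int_floor_le)
  then have f1: "of_int f * pi \<le> \<theta> - a" using pos_le_divide_eq[OF pi_gt_zero] by blast
  have "(\<theta> - a) / pi < of_int f + 1" unfolding f_def by (rule real_of_int_floor_add_one_gt)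
  then have f2: "\<theta> - a < of_int f * pi + pi"
    using pos_divide_less_eq[OF pi_gt_zero, of "\<theta> - a" "of_int f + 1"] by (simp add: distrib_right)
  show thesis
  proof (rule that[of "- f"])
    show "a \<le> \<theta> + of_int (- f) * pi" "\<theta> + of_int (- f) * pi < a + pi"
      using f1 f2 by simp_all
  qed
qed

context
  fixes w :: real and q :: "real \<Rightarrow> real"
  assumes w: "w > 0" and q: "locint q"
begin

lemma prufer: "is_prufer w q (prufer w q \<theta>)" "prufer w q \<theta> 0 = \<theta>"
  using someI_ex[OF prufer_exists[OF w q, of \<theta>]] by (auto simp: prufer_def)

lemma prufer_eqI: "is_prufer w q \<Theta> \<Longrightarrow> prufer w q (\<Theta> 0) t = \<Theta> t"
  by (rule prufer_unique[OF q prufer(1), where s = 0]) (auto simp: prufer(2))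

lemma prufer_shift: "prufer w q (\<theta> + of_int n * pi) t = prufer w q \<theta> t + of_int n * pi"
proof -
  have s: "(sin (x + of_int n * pi))\<^sup>2 = (sin x)\<^sup>2" "(cos (x + of_int n * pi))\<^sup>2 = (cos x)\<^sup>2" for x :: real
  proof -
    have "cos (of_int n * pi) = 1 \<or> cos (of_int n * pi) = -1" "sin (of_int n * pi) = 0"
      using cos_npi_int[of n] sin_npi_int[of n] by (auto simp: mult.commute)
    then show "(sin (x + of_int n * pi))\<^sup>2 = (sin x)\<^sup>2" "(cos (x + of_int n * pi))\<^sup>2 = (cos x)\<^sup>2"
      by (auto simp: sin_add cos_add)
  qed
  have "is_prufer w q (\<lambda>t. prufer w q \<theta> t + of_int n * pi)"
    using ac_add[OF prufer(1)[of \<theta>, unfolded is_prufer_def] ac_const[of "of_int n * pi"]]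
    unfolding is_prufer_def s by simp
  from prufer_eqI[OF this] show ?thesis by (simp add: prufer(2))
qed

lemma prufer_strict_mono: "\<theta> < \<theta>' \<Longrightarrow> prufer w q \<theta> t < prufer w q \<theta>' t"
  using prufer_order[OF q prufer(1) prufer(1), of \<theta> 0 \<theta>' t] by (simp add: prufer(2))

lemma prufer_sol:
  obtains r where "r 0 = 1" "\<And>t. r t > 0" "sol q (\<lambda>t. r t * sin (prufer w q \<theta> t)) (\<lambda>t. w * (r t * cos (prufer w q \<theta> t)))"
proof -
  have "locint (\<lambda>t. (w - q t / w) * (sin (prufer w q \<theta> t) * cos (prufer w q \<theta> t)))"
    by (intro locint_mult_cont2 locint_intros q continuous_intros is_prufer_cont[OF prufer(1)])
  then obtain R where R: "ac R (\<lambda>t. (w - q t / w) * (sin (prufer w q \<theta> t) * cos (prufer w q \<theta> t)))" "R 0 = 0"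
    using ac_primitive by blast
  show thesis
    by (rule that[of "\<lambda>t. exp (R t)"]) (use sol_of_prufer[OF w prufer(1) R(1)] R(2) in auto)
qed

text \<open>The potential acts on the angle through the squared sine only; that this factor vanishes
  on a null set makes comparison strict.\<close>

lemma negligible_sin_prufer: "negligible {t \<in> {a..b}. sin (prufer w q \<theta> t) = 0}"
proof -
  obtain r :: "real \<Rightarrow> real" where "r 0 = 1" and r: "\<And>t. r t > 0" and s: "sol q (\<lambda>t. r t * sin (prufer w q \<theta> t)) (\<lambda>t. w * (r t * cos (prufer w q \<theta> t)))"
    using prufer_sol[of \<theta>] by blast
  have "finite {t \<in> {a..b}. r t * sin (prufer w q \<theta> t) = 0}"
  proof (rule finite_zeros)
    show "((\<lambda>t. r t * sin (prufer w q \<theta> t)) has_real_derivative w * (r t * cos (prufer w q \<theta> t))) (at t)" for t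
      using s unfolding sol_def by (intro ac_deriv[OF _ ac_cont]) auto
    show "w * (r t * cos (prufer w q \<theta> t)) \<noteq> 0" if "r t * sin (prufer w q \<theta> t) = 0" for t
      using that w r[of t] sin_zero_abs_cos_one[of "prufer w q \<theta> t"] by auto
  qed
  moreover have "{t \<in> {a..b}. r t * sin (prufer w q \<theta> t) = 0} = {t \<in> {a..b}. sin (prufer w q \<theta> t) = 0}"
    using r by (auto simp: less_le)
  ultimately show ?thesis using negligible_finite by auto
qed

lemma turn_shift: "turn w T q (\<theta> + of_int n * pi) = turn w T q \<theta>"
  by (simp add: turn_def prufer_shift)

end

context
  fixes w T :: real and q :: "real \<Rightarrow> real"
  assumes w: "w > 0" and T: "T > 0" and q: "locint q"
begin

text \<open>The flow preserves the order of angles and commutes with shifts by \<pi>. Once \<theta>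
  is shifted to lie between \<theta>' and \<theta>' + \<pi>, its end angle lies in the corresponding
  interval, again of length \<pi>.\<close>

lemma turn_width: "\<bar>turn w T q \<theta> - turn w T q \<theta>'\<bar> < pi"
proof -
  obtain n where n: "\<theta>' \<le> \<theta> + of_int n * pi" "\<theta> + of_int n * pi < \<theta>' + pi" by (rule reduce_pi)
  define x where "x = \<theta> + of_int n * pi"
  have "prufer w q \<theta>' T \<le> prufer w q x T"
    using prufer_strict_mono[OF w q, of \<theta>' x T] n by (cases "\<theta>' = x") (auto simp: x_def)
  moreover have "prufer w q x T < prufer w q (\<theta>' + of_int 1 * pi) T"
    using n by (intro prufer_strict_mono[OF w q]) (auto simp: x_def)
  ultimately have "\<bar>turn w T q x - turn w T q \<theta>'\<bar> < pi"
    using n unfolding prufer_shift[OF w q] by (auto simp: turn_def x_def abs_less_iff)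
  then show ?thesis unfolding x_def turn_shift[OF w q] .
qed

text \<open>Initial angle and potential vary together, which yields continuity of the turning in
  both. One factor \<open>exp M\<close> bounds the integrating factor under the integral, the other
  removes it at \<open>T\<close>; hence the \<open>2\<close>.\<close>

lemma prufer_lipschitz:
  assumes q2: "is_prufer w q2 \<Theta>2" "locint q2"
  shows "\<bar>\<Theta>2 T - prufer w q \<theta> T\<bar> \<le> exp (2 * integral {0..T} (\<lambda>x. \<bar>q x / w - w\<bar>)) *
    (\<bar>\<Theta>2 0 - \<theta>\<bar> + integral {0..T} (\<lambda>x. \<bar>q2 x - q x\<bar> / w))"
proof -
  let ?k = "\<lambda>x. \<bar>q x / w - w\<bar>" and ?\<Theta> = "prufer w q \<theta>"
  define M where "M = integral {0..T} ?k"
  obtain C where C: "C 0 = 0" "\<And>t. t \<ge> 0 \<Longrightarrow> \<bar>C t\<bar> \<le> integral {0..t} ?k" and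
    ac: "ac (\<lambda>t. (\<Theta>2 t - ?\<Theta> t) * exp (- C t)) (\<lambda>t. (q2 t - q t) / w * (sin (\<Theta>2 t))\<^sup>2 * exp (- C t))"
    using prufer_diff[OF q prufer(1)[OF w q] q2(1)] by blast
  have k: "?k integrable_on {s..t}" for s t by (intro locint_integrable locint_intros q)
  have CM: "\<bar>C t\<bar> \<le> M" if "t \<in> {0..T}" for t
  proof -
    have "integral {0..t} ?k \<le> M" unfolding M_def
      using that k by (intro integral_subset_le) auto
    then show ?thesis using C(2)[of t] that by auto
  qed
  have "(\<lambda>x. \<bar>q2 x - q x\<bar> / w) integrable_on {0..T}" by (intro locint_integrable locint_intros q q2)
  then have "((\<lambda>x. exp M * (\<bar>q2 x - q x\<bar> / w)) has_integral exp M * integral {0..T} (\<lambda>x. \<bar>q2 x - q x\<bar> / w)) {0..T}"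
    by (intro has_integral_mult_right integrable_integral)
  moreover have "\<bar>(q2 t - q t) / w * (sin (\<Theta>2 t))\<^sup>2 * exp (- C t)\<bar> \<le> exp M * (\<bar>q2 t - q t\<bar> / w)" if "t \<in> {0..T}" for t
  proof -
    have "exp (- C t) \<le> exp M" using CM[OF that] by simp
    moreover have "(sin (\<Theta>2 t))\<^sup>2 \<le> 1" by (simp add: abs_square_le_1)
    ultimately have "\<bar>(q2 t - q t) / w\<bar> * (sin (\<Theta>2 t))\<^sup>2 * exp (- C t) \<le> \<bar>(q2 t - q t) / w\<bar> * 1 * exp M"
      by (intro mult_mono) auto
    then show ?thesis using w by (simp add: abs_mult mult.commute)
  qed
  ultimately have "\<bar>(\<Theta>2 T - ?\<Theta> T) * exp (- C T) - (\<Theta>2 0 - ?\<Theta> 0) * exp (- C 0)\<bar> \<le> exp M * integral {0..T} (\<lambda>x. \<bar>q2 x - q x\<bar> / w)"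
    using T by (intro has_integral_bound_abs[OF ac_has_int[OF ac, of 0 T]]) auto
  then have *: "\<bar>\<Theta>2 T - ?\<Theta> T\<bar> * exp (- C T) \<le> \<bar>\<Theta>2 0 - \<theta>\<bar> + exp M * integral {0..T} (\<lambda>x. \<bar>q2 x - q x\<bar> / w)"
    unfolding C(1) prufer(2)[OF w q] using abs_mult[of "\<Theta>2 T - ?\<Theta> T" "exp (- C T)"] by simp
  have "M \<ge> 0" using CM[of 0] T by auto
  then have "\<bar>\<Theta>2 0 - \<theta>\<bar> \<le> exp M * \<bar>\<Theta>2 0 - \<theta>\<bar>"
    by (simp add: mult_le_cancel_right1)
  then have "\<bar>\<Theta>2 T - ?\<Theta> T\<bar> * exp (- C T) \<le> exp M * (\<bar>\<Theta>2 0 - \<theta>\<bar> + integral {0..T} (\<lambda>x. \<bar>q2 x - q x\<bar> / w))"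
    using * by (simp add: distrib_left)
  moreover have "\<bar>\<Theta>2 T - ?\<Theta> T\<bar> * exp (- M) \<le> \<bar>\<Theta>2 T - ?\<Theta> T\<bar> * exp (- C T)"
    using CM[of T] T by (intro mult_left_mono) auto
  ultimately have "\<bar>\<Theta>2 T - ?\<Theta> T\<bar> * exp (- M) \<le> exp M * (\<bar>\<Theta>2 0 - \<theta>\<bar> + integral {0..T} (\<lambda>x. \<bar>q2 x - q x\<bar> / w))" by linarith
  from mult_right_mono[OF this, of "exp M"]
  have "\<bar>\<Theta>2 T - ?\<Theta> T\<bar> * exp (- M) * exp M \<le> exp M * (\<bar>\<Theta>2 0 - \<theta>\<bar> + integral {0..T} (\<lambda>x. \<bar>q2 x - q x\<bar> / w)) * exp M"
    by simp
  moreover have "\<bar>\<Theta>2 T - ?\<Theta> T\<bar> * exp (- M) * exp M = \<bar>\<Theta>2 T - ?\<Theta> T\<bar>"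
    by (simp add: mult.assoc flip: exp_add)
  ultimately have "\<bar>\<Theta>2 T - ?\<Theta> T\<bar> \<le> (exp M * exp M) * (\<bar>\<Theta>2 0 - \<theta>\<bar> + integral {0..T} (\<lambda>x. \<bar>q2 x - q x\<bar> / w))"
    by (simp only: mult_ac)
  then show ?thesis by (simp add: M_def flip: exp_add)
qed

lemma turn_cont: "continuous_on UNIV (turn w T q)"
proof -
  have "continuous_on UNIV (\<lambda>\<theta>. prufer w q \<theta> T)"
    by (rule continuous_on_local_lipschitz)
      (use prufer_lipschitz[OF prufer(1)[OF w q] q] in \<open>simp add: prufer(2)[OF w q]\<close>)
  then show ?thesis unfolding turn_def by (intro continuous_intros)
qed

text \<open>Continuity and \<pi>-periodicity in the initial angle reduce the supremum to a compact
  interval.\<close>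

lemma turn_max: "turn w T q \<theta> \<le> turn_max w T q" "\<exists>\<theta>. turn w T q \<theta> = turn_max w T q"
proof -
  obtain a where a: "a \<in> {0..pi}" "\<And>\<theta>. \<theta> \<in> {0..pi} \<Longrightarrow> turn w T q \<theta> \<le> turn w T q a"
    using continuous_attains_sup[of "{0..pi}" "turn w T q"] continuous_on_subset[OF turn_cont] by auto
  have "turn w T q \<theta> \<le> turn w T q a" for \<theta>
  proof -
    obtain n where "0 \<le> \<theta> + of_int n * pi" "\<theta> + of_int n * pi < 0 + pi" by (rule reduce_pi)
    then show ?thesis using a(2)[of "\<theta> + of_int n * pi"] turn_shift[OF w q] by auto
  qed
  then have "turn_max w T q = turn w T q a" unfolding turn_max_def by (intro cSup_eq_maximum) auto
  then show "turn w T q \<theta> \<le> turn_max w T q" "\<exists>\<theta>. turn w T q \<theta> = turn_max w T q"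
    using \<open>\<And>\<theta>. turn w T q \<theta> \<le> turn w T q a\<close> by auto
qed

lemma turn_min: "turn_min w T q \<le> turn w T q \<theta>" "\<exists>\<theta>. turn w T q \<theta> = turn_min w T q"
proof -
  obtain a where a: "a \<in> {0..pi}" "\<And>\<theta>. \<theta> \<in> {0..pi} \<Longrightarrow> turn w T q a \<le> turn w T q \<theta>"
    using continuous_attains_inf[of "{0..pi}" "turn w T q"] continuous_on_subset[OF turn_cont] by auto
  have "turn w T q a \<le> turn w T q \<theta>" for \<theta>
  proof -
    obtain n where "0 \<le> \<theta> + of_int n * pi" "\<theta> + of_int n * pi < 0 + pi" by (rule reduce_pi)
    then show ?thesis using a(2)[of "\<theta> + of_int n * pi"] turn_shift[OF w q] by auto
  qed
  then have "turn_min w T q = turn w T q a" unfolding turn_min_def by (intro cInf_eq_minimum) auto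
  then show "turn_min w T q \<le> turn w T q \<theta>" "\<exists>\<theta>. turn w T q \<theta> = turn_min w T q"
    using \<open>\<And>\<theta>. turn w T q a \<le> turn w T q \<theta>\<close> by auto
qed

lemma turn_max_less_min: "turn_max w T q < turn_min w T q + pi"
proof -
  obtain \<theta> \<theta>' where "turn w T q \<theta> = turn_max w T q" "turn w T q \<theta>' = turn_min w T q"
    using turn_max(2) turn_min(2) by blast
  then show ?thesis using turn_width[of \<theta> \<theta>'] by simp
qed

lemma turn_min_le_max: "turn_min w T q \<le> turn_max w T q"
  using turn_max(1)[of 0] turn_min(1)[of 0] by linarith

text \<open>Along the angle from \<open>0\<close> the squared sine equals a bounded factor times the
  angle, so the angle solves a linear equation with source \<open>w > 0\<close>, and no sign of
  \<open>q\<close> enters. This later excludes the values \<open>2 k \<pi>\<close> with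
  \<open>k \<le> 0\<close> for the maximal turning.\<close>

lemma turn_0_pos: "turn w T q 0 > 0"
proof -
  let ?\<Theta> = "prufer w q 0"
  define g where "g = (\<lambda>t. sin (?\<Theta> t) * sinc (?\<Theta> t))"
  have [measurable]: "?\<Theta> \<in> borel_measurable borel"
    using is_prufer_cont[OF prufer(1)[OF w q]] by (auto intro: borel_measurable_continuous_onI)
  have gm: "g \<in> borel_measurable borel" unfolding g_def by measurable
  have g1: "\<bar>g t\<bar> \<le> 1" for t
    unfolding g_def abs_mult using mult_mono[OF abs_sin_le_one abs_sinc_le_1] by simp
  have "locint (\<lambda>t. g t * (q t / w - w))"
    using g1 by (intro locint_mult gm locint_intros q) (auto simp: bounded_iff)
  then obtain C where C: "ac C (\<lambda>t. g t * (q t / w - w))" using ac_primitive by blast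
  have gt: "g t * ?\<Theta> t = (sin (?\<Theta> t))\<^sup>2" for t
    using sinc_mult[of "?\<Theta> t"] by (simp add: g_def power2_eq_square mult.assoc)
  have "ac (\<lambda>t. ?\<Theta> t * exp (- C t)) (\<lambda>t. w * exp (- C t))"
    using ac_integrating_factor[OF prufer(1)[OF w q, of 0, unfolded is_prufer_def] C]
  proof (rule ac_cong)
    fix t
    have "g t * (q t / w - w) * ?\<Theta> t = (q t / w - w) * (g t * ?\<Theta> t)" by simp
    then show "(w * (cos (?\<Theta> t))\<^sup>2 + q t / w * (sin (?\<Theta> t))\<^sup>2 - g t * (q t / w - w) * ?\<Theta> t) * exp (- C t) = w * exp (- C t)"
      unfolding gt cos_squared_eq by (simp add: algebra_simps)
  qed simp
  moreover have "\<not> negligible {0..T}"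
    using T negligible_interval(1)[of 0 T] by (simp add: box_real)
  moreover have "{x \<in> {0..T}. 0 < w * exp (- C x)} = {0..T}" using w by auto
  ultimately have "0 < ?\<Theta> T * exp (- C T)"
    using w T ac_mono_strict[of "\<lambda>t. ?\<Theta> t * exp (- C t)" "\<lambda>t. w * exp (- C t)" 0 T]
    by (simp add: prufer(2)[OF w q])
  then show ?thesis by (simp add: turn_def zero_less_mult_iff)
qed

end

section \<open>Dependence of the turning on the potential\<close>

lemma prufer_mono:
  assumes w: "w > 0" and T: "T > 0" and q: "locint q1" "locint q2"
    and le: "AE x in lebesgue. x \<in> {0..T} \<longrightarrow> q1 x \<le> q2 x"
  shows "prufer w q1 \<theta> T \<le> prufer w q2 \<theta> T"
    and "\<not> negligible {x \<in> {0..T}. q1 x < q2 x} \<Longrightarrow> prufer w q1 \<theta> T < prufer w q2 \<theta> T"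
proof -
  let ?\<Theta>1 = "prufer w q1 \<theta>" and ?\<Theta>2 = "prufer w q2 \<theta>"
  obtain C where C: "C 0 = 0" "ac (\<lambda>t. (?\<Theta>2 t - ?\<Theta>1 t) * exp (- C t)) (\<lambda>t. (q2 t - q1 t) / w * (sin (?\<Theta>2 t))\<^sup>2 * exp (- C t))"
    using prufer_diff[OF q(1) prufer(1)[OF w q(1)] prufer(1)[OF w q(2)]] by blast
  have ae: "AE x in lebesgue. x \<in> {0..T} \<longrightarrow> 0 \<le> (q2 x - q1 x) / w * (sin (?\<Theta>2 x))\<^sup>2 * exp (- C x)"
    by (rule eventually_mono[OF le]) (use w in auto)
  have "0 \<le> (?\<Theta>2 T - ?\<Theta>1 T) * exp (- C T)"
    using ac_mono[OF C(2) _ ae] T by (simp add: prufer(2)[OF w] q)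
  then show "?\<Theta>1 T \<le> ?\<Theta>2 T" by (simp add: zero_le_mult_iff)
  assume neg: "\<not> negligible {x \<in> {0..T}. q1 x < q2 x}"
  \<comment> \<open>The density is positive wherever \<open>q1 < q2\<close>, except at the zeros of
    the sine, a null set.\<close>
  have "\<not> negligible {x \<in> {0..T}. 0 < (q2 x - q1 x) / w * (sin (?\<Theta>2 x))\<^sup>2 * exp (- C x)}"
  proof
    assume "negligible {x \<in> {0..T}. 0 < (q2 x - q1 x) / w * (sin (?\<Theta>2 x))\<^sup>2 * exp (- C x)}"
    from negligible_Un[OF this negligible_sin_prufer[OF w q(2), of 0 T \<theta>]]
    have "negligible {x \<in> {0..T}. q1 x < q2 x}"
      by (rule negligible_subset) (use w in \<open>auto simp: zero_less_mult_iff\<close>)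
    then show False using neg by blast
  qed
  then have "0 < (?\<Theta>2 T - ?\<Theta>1 T) * exp (- C T)"
    using ac_mono_strict[OF C(2) _ ae] T by (simp add: prufer(2)[OF w] q)
  then show "?\<Theta>1 T < ?\<Theta>2 T" by (simp add: zero_less_mult_iff)
qed

lemma turn_extrema_mono:
  assumes w: "w > 0" and T: "T > 0" and q: "locint q1" "locint q2"
    and le: "AE x in lebesgue. x \<in> {0..T} \<longrightarrow> q1 x \<le> q2 x"
  shows "turn_max w T q1 \<le> turn_max w T q2" "turn_min w T q1 \<le> turn_min w T q2"
    and "\<not> negligible {x \<in> {0..T}. q1 x < q2 x} \<Longrightarrow> turn_max w T q1 < turn_max w T q2"
    and "\<not> negligible {x \<in> {0..T}. q1 x < q2 x} \<Longrightarrow> turn_min w T q1 < turn_min w T q2"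
proof -
  note 1 = turn_max[OF w T q(1)] turn_min[OF w T q(1)] and 2 = turn_max[OF w T q(2)] turn_min[OF w T q(2)]
  have le': "turn w T q1 \<theta> \<le> turn w T q2 \<theta>" for \<theta>
    using prufer_mono(1)[OF assms] by (simp add: turn_def)
  have less: "turn w T q1 \<theta> < turn w T q2 \<theta>" if "\<not> negligible {x \<in> {0..T}. q1 x < q2 x}" for \<theta>
    using prufer_mono(2)[OF assms that] by (simp add: turn_def)
  show "turn_max w T q1 \<le> turn_max w T q2" using 1(2) 2(1) le' by (metis order_trans)
  show "turn_min w T q1 \<le> turn_min w T q2" using 1(3) 2(4) le' by (metis order_trans)
  assume n: "\<not> negligible {x \<in> {0..T}. q1 x < q2 x}"
  show "turn_max w T q1 < turn_max w T q2" using 1(2) 2(1) less[OF n] by (metis less_le_trans)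
  show "turn_min w T q1 < turn_min w T q2" using 1(3) 2(4) less[OF n] by (metis le_less_trans)
qed

lemma turn_extrema_lipschitz:
  assumes w: "w > 0" and T: "T > 0" and q: "locint q1" "locint q2"
  defines "L \<equiv> exp (2 * integral {0..T} (\<lambda>x. \<bar>q1 x / w - w\<bar>)) * integral {0..T} (\<lambda>x. \<bar>q2 x - q1 x\<bar> / w)"
  shows "\<bar>turn_max w T q2 - turn_max w T q1\<bar> \<le> L" "\<bar>turn_min w T q2 - turn_min w T q1\<bar> \<le> L"
proof -
  note 1 = turn_max[OF w T q(1)] turn_min[OF w T q(1)] and 2 = turn_max[OF w T q(2)] turn_min[OF w T q(2)]
  have b: "\<bar>turn w T q2 \<theta> - turn w T q1 \<theta>\<bar> \<le> L" for \<theta>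
    using prufer_lipschitz[OF w T q(1) prufer(1)[OF w q(2)] q(2), of \<theta> \<theta>]
    by (simp add: turn_def prufer(2)[OF w q(2)] L_def)
  show "\<bar>turn_max w T q2 - turn_max w T q1\<bar> \<le> L"
    using 1(1,2) 2(1,2) b by (smt (verit, ccfv_SIG))
  show "\<bar>turn_min w T q2 - turn_min w T q1\<bar> \<le> L"
    using 1(3,4) 2(3,4) b by (smt (verit, ccfv_SIG))
qed

section \<open>Periodic solutions and multiplicities\<close>

text \<open>Constancy of the Wronskian gives determinant one. The second coordinate is
  \<open>v / w\<close>, so that a solution with angle \<open>\<theta>\<close> starts in the
  direction \<open>(sin \<theta>, cos \<theta>)\<close>.\<close>

lemma monodromy:
  assumes w: "w > 0" and q: "locint q"
  obtains m11 m12 m21 m22 where "m11 * m22 - m12 * m21 = 1"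
    "\<And>u v. sol q u v \<Longrightarrow> u T = m11 * u 0 + m12 * (v 0 / w)"
    "\<And>u v. sol q u v \<Longrightarrow> v T / w = m21 * u 0 + m22 * (v 0 / w)"
proof -
  obtain u1 v1 where 1: "sol q u1 v1" "u1 0 = 1" "v1 0 = 0" using sol_exists[OF q] by metis
  obtain u2 v2 where 2: "sol q u2 v2" "u2 0 = 0" "v2 0 = w" using sol_exists[OF q] by metis
  have "ac (\<lambda>t. u1 t * v2 t - u2 t * v1 t) (\<lambda>t. 0)"
    using ac_diff[OF ac_mult ac_mult, of u1 v1 v2 "\<lambda>t. - q t * u2 t" u2 v2 v1 "\<lambda>t. - q t * u1 t"] 1 2
    unfolding sol_def by (auto elim!: ac_cong)
  from ac_int[OF this, of 0 T] ac_int[OF this, of T 0]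
  have W: "u1 T * v2 T - u2 T * v1 T = w" using 1 2 by (cases "0 \<le> T") auto
  show thesis
  proof (rule that[of "u1 T" "v2 T / w" "u2 T" "v1 T / w"])
    show "u1 T * (v2 T / w) - u2 T * (v1 T / w) = 1"
      using W w by (simp add: diff_divide_distrib[symmetric])
    fix u v assume s: "sol q u v"
    note un = sol_unique[OF q s sol_lincomb[OF 1(1) 2(1), of "u 0" "v 0 / w"], of 0 T]
    show "u T = u1 T * u 0 + u2 T * (v 0 / w)" "v T / w = v1 T / w * u 0 + v2 T / w * (v 0 / w)"
      using un 1 2 w by (auto simp: field_simps)
  qed
qed

context
  fixes w T :: real and q :: "real \<Rightarrow> real"
  assumes w: "w > 0" and T: "T > 0" and q: "locint q"
begin

text \<open>Periodic solutions are the fixed vectors of the monodromy matrix, and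
  \<open>prufer\<close> at time \<open>T\<close> lifts its action on directions; the planar lemmas
  apply with \<open>turn_width\<close> as their width condition.\<close>

lemma turn_extremum_iff:
  "(\<exists>k::int. turn_max w T q = 2 * pi * of_int k \<or> turn_min w T q = 2 * pi * of_int k) \<longleftrightarrow>
     (\<exists>u v. sol q u v \<and> u T = u 0 \<and> v T = v 0 \<and> (u 0 \<noteq> 0 \<or> v 0 \<noteq> 0))" (is "?A \<longleftrightarrow> ?B")
  and turn_extrema_iff:
  "(\<exists>k::int. turn_max w T q = 2 * pi * of_int k) \<and> (\<exists>k::int. turn_min w T q = 2 * pi * of_int k) \<longleftrightarrow>
     (\<forall>u v. sol q u v \<longrightarrow> u T = u 0 \<and> v T = v 0)" (is "?C \<longleftrightarrow> ?D")
proof -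
  obtain m11 m12 m21 m22 where det: "m11 * m22 - m12 * m21 = 1"
    and M: "\<And>u v. sol q u v \<Longrightarrow> u T = m11 * u 0 + m12 * (v 0 / w)"
      "\<And>u v. sol q u v \<Longrightarrow> v T / w = m21 * u 0 + m22 * (v 0 / w)"
    using monodromy[OF w q] by metis
  define \<phi> where "\<phi> = (\<lambda>\<theta>. prufer w q \<theta> T)"
  have "\<exists>r>0. r * sin (\<phi> \<theta>) = m11 * sin \<theta> + m12 * cos \<theta> \<and> r * cos (\<phi> \<theta>) = m21 * sin \<theta> + m22 * cos \<theta>" for \<theta>
  proof -
    obtain r :: "real \<Rightarrow> real" where r: "r 0 = 1" "\<And>t. r t > 0"
      and s: "sol q (\<lambda>t. r t * sin (prufer w q \<theta> t)) (\<lambda>t. w * (r t * cos (prufer w q \<theta> t)))"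
      using prufer_sol[OF w q, of \<theta>] by metis
    show ?thesis using M[OF s] r w by (intro exI[of _ "r T"]) (simp add: prufer(2)[OF w q] \<phi>_def)
  qed
  then obtain \<rho> where pos: "\<And>\<theta>. \<rho> \<theta> > (0::real)"
    and img: "\<And>\<theta>. \<rho> \<theta> * sin (\<phi> \<theta>) = m11 * sin \<theta> + m12 * cos \<theta>"
      "\<And>\<theta>. \<rho> \<theta> * cos (\<phi> \<theta>) = m21 * sin \<theta> + m22 * cos \<theta>" by metis
  have turn: "\<phi> \<theta> - \<theta> = turn w T q \<theta>" for \<theta> by (simp add: \<phi>_def turn_def)
  have width: "\<bar>(\<phi> \<theta> - \<theta>) - (\<phi> \<theta>' - \<theta>')\<bar> < pi" for \<theta> \<theta>' unfolding turn by (rule turn_width[OF w T q])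
  note planar = det pos img width
  note mx = turn_max[OF w T q] and mn = turn_min[OF w T q]
  have per: "u T = u 0 \<and> v T = v 0 \<longleftrightarrow> m11 * u 0 + m12 * (v 0 / w) = u 0 \<and> m21 * u 0 + m22 * (v 0 / w) = v 0 / w"
    if "sol q u v" for u v
    using M[OF that] w by auto
  have ext: "(\<exists>\<alpha>. turn w T q \<alpha> = 2 * pi * of_int k \<and> (\<exists>\<sigma>. (\<sigma> = 1 \<or> \<sigma> = -1) \<and> (\<forall>\<theta>. \<sigma> * (turn w T q \<theta> - 2 * pi * of_int k) \<le> 0))) \<longleftrightarrow>
    turn_max w T q = 2 * pi * of_int k \<or> turn_min w T q = 2 * pi * of_int k" (is "?L \<longleftrightarrow> ?R") for k :: int
  proof
    assume ?L
    then obtain \<alpha> \<sigma> where a: "turn w T q \<alpha> = 2 * pi * of_int k" "\<sigma> = 1 \<or> \<sigma> = -1"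
      "\<And>\<theta>. \<sigma> * (turn w T q \<theta> - 2 * pi * of_int k) \<le> 0" by blast
    obtain b c where bc: "turn w T q b = turn_max w T q" "turn w T q c = turn_min w T q" using mx(2) mn(2) by blast
    show ?R using a(2)
    proof
      assume "\<sigma> = 1" then show ?thesis using a(1) a(3)[of b] mx(1)[of \<alpha>] bc by auto
    next
      assume "\<sigma> = -1" then show ?thesis using a(1) a(3)[of c] mn(1)[of \<alpha>] bc by auto
    qed
  next
    assume ?R
    then show ?L
    proof
      assume *: "turn_max w T q = 2 * pi * of_int k"
      then have "\<forall>\<theta>. 1 * (turn w T q \<theta> - 2 * pi * of_int k) \<le> 0" using mx(1) by simp
      then show ?L using mx(2) * by metis
    next
      assume *: "turn_min w T q = 2 * pi * of_int k"
      then have "\<forall>\<theta>. -1 * (turn w T q \<theta> - 2 * pi * of_int k) \<le> 0" using mn(1) by simp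
      then show ?L using mn(2) * by metis
    qed
  qed
  show "?A \<longleftrightarrow> ?B"
  proof
    assume ?A
    then obtain k \<alpha> \<sigma> where a: "\<phi> \<alpha> - \<alpha> = 2 * pi * of_int k" "\<sigma> = 1 \<or> \<sigma> = -1"
      "\<And>\<theta>. \<sigma> * (\<phi> \<theta> - \<theta> - 2 * pi * of_int k) \<le> 0" unfolding ext[symmetric] turn by blast
    note fx = planar_extremum_fixed[OF planar a]
    obtain u v where uv: "sol q u v" "u 0 = sin \<alpha>" "v 0 = w * cos \<alpha>" using sol_exists[OF q] by metis
    have "u T = u 0 \<and> v T = v 0" unfolding per[OF uv(1)] using fx uv w by simp
    moreover have "u 0 \<noteq> 0 \<or> v 0 \<noteq> 0" using uv w sin_zero_abs_cos_one[of \<alpha>] by auto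
    ultimately show ?B using uv(1) by blast
  next
    assume ?B
    then obtain u v where uv: "sol q u v" "u T = u 0" "v T = v 0" "u 0 \<noteq> 0 \<or> v 0 \<noteq> 0" by blast
    have "m11 * u 0 + m12 * (v 0 / w) = u 0" "m21 * u 0 + m22 * (v 0 / w) = v 0 / w" "u 0 \<noteq> 0 \<or> v 0 / w \<noteq> 0"
      using per[OF uv(1)] uv w by auto
    from planar_fixed_extremum[OF planar this]
    show ?A unfolding ext[symmetric] turn by metis
  qed
  have "?C \<longleftrightarrow> (\<exists>k::int. \<forall>\<theta>. \<phi> \<theta> - \<theta> = 2 * pi * of_int k)"
  proof
    assume ?C
    then obtain k j :: int where kj: "turn_max w T q = 2 * pi * of_int k" "turn_min w T q = 2 * pi * of_int j" by blast
    \<comment> \<open>Two multiples of 2 \<pi> that differ by less than \<pi> coincide, so the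
      turning is constant.\<close>
    have "2 * pi * of_int k < 2 * pi * of_int j + pi" using turn_max_less_min[OF w T q] kj by simp
    then have "pi * (2 * of_int k) < pi * (2 * of_int j + 1)" by (simp add: algebra_simps)
    then have "k \<le> j" by (simp add: mult_less_cancel_left_pos)
    moreover have "j \<le> k" using turn_min_le_max[OF w T q] kj by simp
    ultimately have "turn w T q \<theta> = 2 * pi * of_int k" for \<theta> using mx(1)[of \<theta>] mn(1)[of \<theta>] kj by auto
    then show "\<exists>k::int. \<forall>\<theta>. \<phi> \<theta> - \<theta> = 2 * pi * of_int k" unfolding turn by blast
  next
    assume "\<exists>k::int. \<forall>\<theta>. \<phi> \<theta> - \<theta> = 2 * pi * of_int k"
    then show ?C using mx(2) mn(2) unfolding turn by metis
  qed
  also have "\<dots> \<longleftrightarrow> m11 = 1 \<and> m12 = 0 \<and> m21 = 0 \<and> m22 = 1"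
    using planar_identity_iff[OF planar] by blast
  also have "\<dots> \<longleftrightarrow> ?D"
  proof
    assume "m11 = 1 \<and> m12 = 0 \<and> m21 = 0 \<and> m22 = 1"
    then show ?D using per by simp
  next
    assume D: ?D
    obtain u1 v1 where 1: "sol q u1 v1" "u1 0 = 1" "v1 0 = 0" using sol_exists[OF q] by metis
    obtain u2 v2 where 2: "sol q u2 v2" "u2 0 = 0" "v2 0 = w" using sol_exists[OF q] by metis
    have "u1 T = u1 0 \<and> v1 T = v1 0" "u2 T = u2 0 \<and> v2 T = v2 0" using D 1(1) 2(1) by blast+
    then show "m11 = 1 \<and> m12 = 0 \<and> m21 = 0 \<and> m22 = 1"
      unfolding per[OF 1(1)] per[OF 2(1)] using 1 2 w by simp
  qed
  finally show "?C \<longleftrightarrow> ?D" .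
qed

end

section \<open>From the boundary value problem to solutions on the line and to
  multiplicities\<close>

lemma locint_cut:
  assumes "set_integrable lebesgue {a..b} f"
  shows "locint (\<lambda>t. if t \<in> {a..b} then f t else 0)"
  unfolding locint_def
proof (intro allI)
  fix s t :: real
  have "(\<lambda>t. if t \<in> {a..b} then f t else 0) absolutely_integrable_on UNIV"
    using assms by (simp only: absolutely_integrable_restrict_UNIV)
  then show "(\<lambda>t. if t \<in> {a..b} then f t else 0) absolutely_integrable_on {s..t}"
    by (rule absolutely_integrable_on_subinterval) auto
qed

text \<open>The given solution lives on \<open>[0, T]\<close> and satisfies the equation almost
  everywhere. It is extended by integrating its second derivative cut off to \<open>0\<close>, and
  the energy lemma identifies it on \<open>[0, T]\<close> with the solution on the line that has the
  same initial data.\<close>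

lemma periodic_solution_global:
  assumes T: "T > 0" and q: "locint q" and ps: "periodic_solution T q u u'"
  obtains U V where "sol q U V" "\<And>t. t \<in> {0..T} \<Longrightarrow> U t = u t" "\<And>t. t \<in> {0..T} \<Longrightarrow> V t = u' t"
proof -
  obtain u'' where W: "W21_derivs T u u' u''"
    and eq: "AE t in lebesgue. t \<in> {0<..<T} \<longrightarrow> u'' t + q t * u t = 0"
    using ps by (auto simp: periodic_solution_def)
  have ui: "set_integrable lebesgue {0..T} u''"
    and ud: "\<And>t. t \<in> {0..T} \<Longrightarrow> (u has_real_derivative u' t) (at t within {0..T})"
    and ul: "\<And>t. t \<in> {0..T} \<Longrightarrow> u' t = u' 0 + (LINT s:{0..t}|lebesgue. u'' s)"
    using W unfolding W21_derivs_def by blast+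
  define f where "f = (\<lambda>t. if t \<in> {0..T} then u'' t else 0)"
  have lf: "locint f" unfolding f_def by (rule locint_cut[OF ui])
  obtain F where F: "ac F f" "F 0 = 0" using ac_primitive[OF lf] by blast
  define V0 where "V0 = (\<lambda>t. u' 0 + F t)"
  have V0: "ac V0 f" unfolding V0_def using ac_add[OF ac_const F(1)] by simp
  have V0_eq: "V0 t = u' t" if t: "t \<in> {0..T}" for t
  proof -
    have "set_integrable lebesgue {0..t} u''" using ui t by (auto intro: absolutely_integrable_on_subinterval)
    then have "(LINT s:{0..t}|lebesgue. u'' s) = integral {0..t} u''" by (rule set_lebesgue_integral_eq_integral)
    also have "\<dots> = integral {0..t} f" using t by (intro integral_cong) (auto simp: f_def)
    also have "\<dots> = F t" using ac_int[OF F(1), of 0 t] F(2) t by simp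
    finally show ?thesis using ul[OF t] by (simp add: V0_def)
  qed
  obtain G where G: "ac G V0" "G 0 = 0" using ac_primitive[OF locint_cont[OF ac_cont[OF V0]]] by blast
  define U0 where "U0 = (\<lambda>t. u 0 + G t)"
  have U0: "ac U0 V0" unfolding U0_def using ac_add[OF ac_const G(1)] by simp
  have U0_eq: "U0 t = u t" if t: "t \<in> {0..T}" for t
  proof -
    have "(u has_real_derivative u' x) (at x within {0..t})" if "x \<in> {0..t}" for x
      by (rule DERIV_subset[OF ud]) (use t that in auto)
    then have "(u' has_integral u t - u 0) {0..t}"
      using t by (intro fundamental_theorem_of_calculus)
        (auto simp flip: has_real_derivative_iff_has_vector_derivative)
    then have "u t - u 0 = integral {0..t} u'" by (simp add: integral_unique)
    also have "\<dots> = integral {0..t} V0" using t V0_eq by (intro integral_cong) auto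
    also have "\<dots> = G t" using ac_int[OF G(1), of 0 t] G(2) t by simp
    finally show ?thesis by (simp add: U0_def)
  qed
  obtain U V where UV: "sol q U V" "U 0 = u 0" "V 0 = u' 0" using sol_exists[OF q] by metis
  \<comment> \<open>Passing from the open to the closed interval costs two points, a null
    set.\<close>
  have "AE x in lebesgue. x \<noteq> 0" "AE x in lebesgue. x \<noteq> T" by (auto simp: AE_lebesgue_iff)
  with eq have ae: "AE x in lebesgue. x \<in> {0..T} \<longrightarrow> - q x * U x - f x = - q x * (U x - U0 x)"
    by eventually_elim (auto simp: f_def U0_eq algebra_simps)
  have "U t - U0 t = 0 \<and> V t - V0 t = 0" if "t \<in> {0..T}" for t
    by (rule ac_energy_zero_on[OF ac_diff ac_diff q ae, of V V0 0])
      (use UV U0 V0 U0_eq[of 0] V0_eq[of 0] T that in \<open>auto simp: sol_def\<close>)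
  then show thesis using that[OF UV(1)] U0_eq V0_eq by simp
qed

lemma periodic_solution_of_sol:
  assumes T: "T > 0" and s: "sol q U V" and per: "U T = U 0" "V T = V 0"
    and eq: "\<And>t. t \<in> {0..T} \<Longrightarrow> u t = U t" "\<And>t. t \<in> {0..T} \<Longrightarrow> u' t = V t"
  shows "periodic_solution T q u u'"
proof -
  have U: "ac U V" and V: "ac V (\<lambda>t. - q t * U t)" using s by (auto simp: sol_def)
  have "(u has_real_derivative u' t) (at t within {0..T})" if t: "t \<in> {0..T}" for t
  proof -
    have "(U has_real_derivative u' t) (at t within {0..T})"
      using ac_deriv[OF U ac_cont[OF V], of t] eq(2)[OF t] by (auto intro: has_field_derivative_at_within)
    then show ?thesis
      by (rule has_field_derivative_transform_within[where d = 1]) (use t eq in auto)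
  qed
  moreover have ai: "set_integrable lebesgue {0..t} (\<lambda>t. - q t * U t)" for t
    using ac_locint[OF V] by (simp add: locint_def)
  moreover have "u' t = u' 0 + (LINT s:{0..t}|lebesgue. - q s * U s)" if "t \<in> {0..T}" for t
    using that set_lebesgue_integral_eq_integral(2)[OF ai[of t]] ac_int[OF V, of 0 t] eq T by simp
  ultimately have W: "W21_derivs T u u' (\<lambda>t. - q t * U t)" unfolding W21_derivs_def by blast
  have ae: "AE t in lebesgue. t \<in> {0<..<T} \<longrightarrow> - q t * U t + q t * u t = 0"
    by (rule AE_I2) (simp add: eq)
  show ?thesis unfolding periodic_solution_def
    using W ae eq(1)[of 0] eq(1)[of T] eq(2)[of 0] eq(2)[of T] per T
    by (intro conjI exI[of _ "\<lambda>t. - q t * U t"]) simp_all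
qed

text \<open>A nontrivial solution has only finitely many zeros in a period. Restriction to
  \<open>[0, T]\<close> therefore loses nothing, and dimensions can be counted on initial
  data.\<close>

lemma sol_zero_on_interval:
  assumes T: "T > 0" and q: "locint q" and s: "sol q u v" and z: "\<And>t. t \<in> {0..T} \<Longrightarrow> u t = 0"
  shows "u x = 0 \<and> v x = 0"
proof (rule ccontr)
  assume nz: "\<not> ?thesis"
  have "finite {t \<in> {0..T}. u t = 0}"
  proof (rule finite_zeros)
    show "(u has_real_derivative v t) (at t)" for t
      using s unfolding sol_def by (intro ac_deriv[OF _ ac_cont]) auto
    show "v t \<noteq> 0" if "u t = 0" for t using sol_zero[OF q s that] nz by blast
  qed
  moreover have "{t \<in> {0..T}. u t = 0} = {0..T}" using z by auto
  moreover have "infinite {0..T}" using T by (rule infinite_Icc)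
  ultimately show False by argo
qed

definition cut :: "real \<Rightarrow> (real \<Rightarrow> real) \<Rightarrow> real \<Rightarrow> real" where
  "cut T f = (\<lambda>t. if t \<in> {0..T} then f t else 0)"

lemma cut_lincomb: "cut T (\<lambda>t. c * f t + d * g t) = fun_scale c (cut T f) + fun_scale d (cut T g)"
  by (auto simp: cut_def fun_scale_def fun_eq_iff)

lemma eigenspace_eq:
  assumes T: "T > 0" and q: "locint (\<lambda>t. \<mu> + a t)"
  shows "eigenspace T a \<mu> = {cut T U | U. \<exists>V. sol (\<lambda>t. \<mu> + a t) U V \<and> U T = U 0 \<and> V T = V 0}"
proof (intro equalityI subsetI)
  fix u assume "u \<in> eigenspace T a \<mu>"
  then obtain u' where u: "periodic_solution T (\<lambda>t. \<mu> + a t) u u'" "\<And>t. t \<notin> {0..T} \<Longrightarrow> u t = 0"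
    by (auto simp: eigenspace_def)
  obtain U V where UV: "sol (\<lambda>t. \<mu> + a t) U V" "\<And>t. t \<in> {0..T} \<Longrightarrow> U t = u t" "\<And>t. t \<in> {0..T} \<Longrightarrow> V t = u' t"
    using periodic_solution_global[OF T q u(1)] by metis
  have "u = cut T U" using UV(2) u(2) by (auto simp: cut_def fun_eq_iff)
  moreover have "U T = U 0 \<and> V T = V 0" using u(1) UV(2,3) T by (simp add: periodic_solution_def)
  ultimately show "u \<in> {cut T U | U. \<exists>V. sol (\<lambda>t. \<mu> + a t) U V \<and> U T = U 0 \<and> V T = V 0}" using UV(1) by blast
next
  fix u assume "u \<in> {cut T U | U. \<exists>V. sol (\<lambda>t. \<mu> + a t) U V \<and> U T = U 0 \<and> V T = V 0}"
  then obtain U V where UV: "u = cut T U" "sol (\<lambda>t. \<mu> + a t) U V" "U T = U 0" "V T = V 0" by blast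
  have "periodic_solution T (\<lambda>t. \<mu> + a t) u V"
    by (rule periodic_solution_of_sol[OF T UV(2-4)]) (auto simp: UV(1) cut_def)
  then show "u \<in> eigenspace T a \<mu>" using UV(1) by (auto simp: eigenspace_def cut_def)
qed

text \<open>Solutions correspond to initial data in the plane, and the periodic ones to a subspace
  of it; each case exhibits a basis of that subspace.\<close>

lemma multiplicity_eig_cases:
  assumes T: "T > 0" and q: "locint (\<lambda>t. \<mu> + a t)"
  defines "per \<equiv> \<lambda>u v. sol (\<lambda>t. \<mu> + a t) u v \<and> u T = u 0 \<and> v T = v 0"
  shows "\<not> (\<exists>u v. per u v \<and> (u 0 \<noteq> 0 \<or> v 0 \<noteq> 0)) \<Longrightarrow> multiplicity_eig T a \<mu> = 0"
    and "\<exists>u v. per u v \<and> (u 0 \<noteq> 0 \<or> v 0 \<noteq> 0) \<Longrightarrow> \<not> (\<forall>u v. sol (\<lambda>t. \<mu> + a t) u v \<longrightarrow> u T = u 0 \<and> v T = v 0)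
      \<Longrightarrow> multiplicity_eig T a \<mu> = 1"
    and "(\<forall>u v. sol (\<lambda>t. \<mu> + a t) u v \<longrightarrow> u T = u 0 \<and> v T = v 0) \<Longrightarrow> multiplicity_eig T a \<mu> = 2"
proof -
  interpret vector_space fun_scale by (rule vector_space_fun_scale)
  let ?q = "\<lambda>t. \<mu> + a t"
  have E: "eigenspace T a \<mu> = {cut T U | U. \<exists>V. per U V}"
    unfolding per_def by (rule eigenspace_eq[OF T q])
  have cut0: "u 0 = 0 \<and> v 0 = 0" if "sol ?q u v" "cut T u = 0" for u v
    by (rule sol_zero_on_interval[OF T q that(1)]) (use that(2) in \<open>auto simp: cut_def fun_eq_iff split: if_splits\<close>)
  have cutu: "cut T u = cut T (\<lambda>t. c * u1 t + d * u2 t)" if "sol ?q u v" "sol ?q u1 v1" "sol ?q u2 v2"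
    "u 0 = c * u1 0 + d * u2 0" "v 0 = c * v1 0 + d * v2 0" for u v u1 v1 u2 v2 c d
    using sol_unique[OF q that(1) sol_lincomb[OF that(2,3)] that(4,5)] by (auto simp: cut_def)
  have dim: "multiplicity_eig T a \<mu> = card B" if "B \<subseteq> eigenspace T a \<mu>" "eigenspace T a \<mu> \<subseteq> span B" "independent B" for B
    unfolding multiplicity_eig_def by (rule dim_unique[OF that]) simp
  {
    assume no: "\<not> (\<exists>u v. per u v \<and> (u 0 \<noteq> 0 \<or> v 0 \<noteq> 0))"
    have "eigenspace T a \<mu> \<subseteq> span {}"
    proof
      fix f assume "f \<in> eigenspace T a \<mu>"
      then obtain u v where u: "f = cut T u" "per u v" unfolding E by blast
      then have "u 0 = 0" "v 0 = 0" "sol ?q u v" using no by (auto simp: per_def)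
      then have "u t = 0" for t using sol_zero(1)[OF q, of u v 0 t] by blast
      then show "f \<in> span {}" by (auto simp: u(1) cut_def fun_eq_iff)
    qed
    then show "multiplicity_eig T a \<mu> = 0" using dim[of "{}"] by (simp add: independent_empty)
  next
    assume "\<exists>u v. per u v \<and> (u 0 \<noteq> 0 \<or> v 0 \<noteq> 0)" and nall: "\<not> (\<forall>u v. sol ?q u v \<longrightarrow> u T = u 0 \<and> v T = v 0)"
    then obtain U V where UV: "per U V" "U 0 \<noteq> 0 \<or> V 0 \<noteq> 0" by blast
    have s: "sol ?q U V" using UV by (simp add: per_def)
    have nz: "cut T U \<noteq> 0" using cut0[OF s] UV(2) by blast
    have "eigenspace T a \<mu> \<subseteq> span {cut T U}"
    proof
      fix f assume "f \<in> eigenspace T a \<mu>"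
      then obtain u v where u: "f = cut T u" "per u v" unfolding E by blast
      have su: "sol ?q u v" using u by (simp add: per_def)
      \<comment> \<open>If the initial data were independent, Cramer's rule would write every
        solution as a combination of two periodic ones.\<close>
      have det: "u 0 * V 0 - v 0 * U 0 = 0"
      proof (rule ccontr)
        assume d: "u 0 * V 0 - v 0 * U 0 \<noteq> 0"
        define D where "D = u 0 * V 0 - v 0 * U 0"
        have "x T = x 0 \<and> y T = y 0" if xy: "sol ?q x y" for x y
        proof -
          define c where "c = (x 0 * V 0 - y 0 * U 0) / D"
          define e where "e = (u 0 * y 0 - v 0 * x 0) / D"
          have D: "D \<noteq> 0" using d by (simp add: D_def)
          have "c * u 0 + e * U 0 = x 0 * (D / D)" "c * v 0 + e * V 0 = y 0 * (D / D)"
            unfolding c_def e_def times_divide_eq_left times_divide_eq_right add_divide_distrib[symmetric]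
            by (simp_all add: D_def algebra_simps)
          then have ce: "x 0 = c * u 0 + e * U 0" "y 0 = c * v 0 + e * V 0" using D by simp_all
          show ?thesis using sol_unique[OF q xy sol_lincomb[OF su s] ce, of T] ce u(2) UV(1) by (simp add: per_def)
        qed
        then show False using nall by blast
      qed
      obtain k where k: "u 0 = k * U 0" "v 0 = k * V 0"
      proof (cases "U 0 = 0")
        case True
        then show ?thesis using that[of "v 0 / V 0"] det UV(2) by auto
      next
        case False
        then show ?thesis using that[of "u 0 / U 0"] det by (simp add: field_simps)
      qed
      have "f = cut T (\<lambda>t. k * U t + 0 * U t)" unfolding u(1)
        by (rule cutu[OF su s s]) (use k in auto)
      then have "f = fun_scale k (cut T U)" by (simp add: cut_def fun_scale_def fun_eq_iff)
      then show "f \<in> span {cut T U}" by (simp add: span_scale span_base)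
    qed
    moreover have "{cut T U} \<subseteq> eigenspace T a \<mu>" using UV(1) unfolding E by blast
    moreover have "independent {cut T U}" using nz by simp
    ultimately show "multiplicity_eig T a \<mu> = 1" using dim[of "{cut T U}"] by simp
  next
    assume all: "\<forall>u v. sol ?q u v \<longrightarrow> u T = u 0 \<and> v T = v 0"
    obtain u1 v1 where 1: "sol ?q u1 v1" "u1 0 = 1" "v1 0 = 0" using sol_exists[OF q] by metis
    obtain u2 v2 where 2: "sol ?q u2 v2" "u2 0 = 0" "v2 0 = 1" using sol_exists[OF q] by metis
    let ?B = "{cut T u1, cut T u2}"
    have "eigenspace T a \<mu> \<subseteq> span ?B"
    proof
      fix f assume "f \<in> eigenspace T a \<mu>"
      then obtain u v where u: "f = cut T u" "sol ?q u v" unfolding E per_def by blast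
      have "f = cut T (\<lambda>t. u 0 * u1 t + v 0 * u2 t)" unfolding u(1)
        by (rule cutu[OF u(2) 1(1) 2(1)]) (use 1 2 in auto)
      then show "f \<in> span ?B" unfolding cut_lincomb by (auto intro: span_add span_scale span_base)
    qed
    moreover have "?B \<subseteq> eigenspace T a \<mu>" using all 1 2 unfolding E per_def by blast
    moreover have n1: "cut T u1 \<noteq> fun_scale k (cut T u2)" for k
    proof
      assume "cut T u1 = fun_scale k (cut T u2)"
      then have "cut T (\<lambda>t. 1 * u1 t + (- k) * u2 t) = 0"
        by (auto simp: cut_def fun_scale_def fun_eq_iff split: if_splits)
      from cut0[OF sol_lincomb[OF 1(1) 2(1)] this] show False using 1 2 by simp
    qed
    moreover have "cut T u2 \<noteq> 0" using cut0[OF 2(1)] 2 by auto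
    ultimately have "independent ?B" "cut T u1 \<noteq> cut T u2"
      using n1[of 1] by (auto simp: independent_insert span_singleton fun_scale_def)
    then show "multiplicity_eig T a \<mu> = 2"
      using dim[of ?B] \<open>eigenspace T a \<mu> \<subseteq> span ?B\<close> \<open>?B \<subseteq> eigenspace T a \<mu>\<close> by simp
  }
qed

lemma multiplicity_eig_turn:
  assumes w: "w > 0" and T: "T > 0" and a: "locint a"
  shows "multiplicity_eig T a \<mu> = (if \<exists>k::int. turn_max w T (\<lambda>t. \<mu> + a t) = 2 * pi * of_int k then 1 else 0)
    + (if \<exists>k::int. turn_min w T (\<lambda>t. \<mu> + a t) = 2 * pi * of_int k then 1 else 0)"
proof -
  have q: "locint (\<lambda>t. \<mu> + a t)" by (intro locint_intros a)
  let ?q = "\<lambda>t. \<mu> + a t"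
  let ?A = "\<exists>k::int. turn_max w T ?q = 2 * pi * of_int k" and ?B = "\<exists>k::int. turn_min w T ?q = 2 * pi * of_int k"
  have 1: "(\<exists>u v. (sol ?q u v \<and> u T = u 0 \<and> v T = v 0) \<and> (u 0 \<noteq> 0 \<or> v 0 \<noteq> 0)) \<longleftrightarrow> ?A \<or> ?B"
    using turn_extremum_iff[OF w T q] by blast
  have 2: "(\<forall>u v. sol ?q u v \<longrightarrow> u T = u 0 \<and> v T = v 0) \<longleftrightarrow> ?A \<and> ?B"
    using turn_extrema_iff[OF w T q] by blast
  note m = multiplicity_eig_cases[OF T q, unfolded 1 2]
  show ?thesis
  proof (cases ?A)
    case True
    then show ?thesis using m(2,3) by (cases ?B) (simp_all only: if_True if_False, simp_all)
  next
    case False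
    then show ?thesis using m(1,2) by (cases ?B) (simp_all only: if_True if_False, simp_all)
  qed
qed

section \<open>The sequence of eigenvalues\<close>

text \<open>At the first index \<open>n\<close> of disagreement, say \<open>L n < M n\<close>,
  monotonicity confines the places where \<open>M\<close> equals \<open>L n\<close> to indices below
  \<open>n\<close>; there \<open>L\<close> agrees with \<open>M\<close>, and \<open>L\<close> takes
  the value once more at \<open>n\<close>. The counts differ.\<close>

lemma mono_enumeration_unique:
  fixes L M :: "nat \<Rightarrow> real"
  assumes "mono L" "mono M" and fin: "\<And>x. finite {k. L k = x}" "\<And>x. finite {k. M k = x}"
    and card: "\<And>x. card {k. L k = x} = card {k. M k = x}"
  shows "L = M"
proof -
  have less: False if LM: "mono L" "mono M" and fin: "finite {k. L k = L n}" "finite {k. M k = L n}"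
    and card: "card {k. L k = L n} = card {k. M k = L n}"
    and eq: "\<And>k. k < n \<Longrightarrow> L k = M k" and lt: "L n < M n" for L M :: "nat \<Rightarrow> real" and n
  proof -
    have "{k. M k = L n} \<subset> {k. L k = L n}"
    proof (rule psubsetI)
      show "{k. M k = L n} \<subseteq> {k. L k = L n}"
      proof
        fix k assume "k \<in> {k. M k = L n}"
        then have k: "M k = L n" by simp
        then have "k < n" using LM(2) lt by (metis leI monoD not_less)
        then show "k \<in> {k. L k = L n}" using eq k by simp
      qed
      show "{k. M k = L n} \<noteq> {k. L k = L n}" using lt by (metis (mono_tags) mem_Collect_eq less_irrefl)
    qed
    then have "card {k. M k = L n} < card {k. L k = L n}" by (rule psubset_card_mono[OF fin(1)])
    then show False unfolding card by blast
  qed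
  have "L n = M n" for n
  proof (induction n rule: less_induct)
    case IH: (less n)
    have "\<not> L n < M n" using less[OF assms(1,2) fin(1,2) card] IH by blast
    moreover have "\<not> M n < L n" using less[OF assms(2,1) fin(2,1) card[symmetric]] IH by metis
    ultimately show ?case by simp
  qed
  then show ?thesis by auto
qed

lemma not_negligible_interval: "T > 0 \<Longrightarrow> \<not> negligible {0..T::real}"
  using negligible_interval(1)[of 0 T] by (simp add: box_real)

text \<open>An integrable potential may be unbounded above, and then no shift makes it negative; its
  part above a high level is small in the mean, which suffices for the turning.\<close>

lemma truncation_small:
  assumes a: "locint a" and e: "e > 0"
  obtains N :: nat where "locint (\<lambda>x. max (a x - real N) 0)" "integral {0..T} (\<lambda>x. max (a x - real N) 0) < e"
proof -
  have li: "locint (\<lambda>x. max (a x - real N) 0)" for N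
  proof -
    have "(\<lambda>x. max (a x - real N) 0) = (\<lambda>x. (\<bar>a x - real N\<bar> + (a x - real N)) / 2)"
      by (rule ext) (simp add: max_def abs_if)
    then show ?thesis by (simp only:) (intro locint_intros a)
  qed
  have "(\<lambda>N. integral {0..T} (\<lambda>x. max (a x - real N) 0)) \<longlonglongrightarrow> integral {0..T} (\<lambda>x. 0)"
  proof (rule dominated_convergence(2)[where h = "\<lambda>x. \<bar>a x\<bar>"])
    show "(\<lambda>x. max (a x - real N) 0) integrable_on {0..T}" for N by (rule locint_integrable[OF li])
    show "(\<lambda>x. \<bar>a x\<bar>) integrable_on {0..T}" by (intro locint_integrable locint_intros a)
    show "norm (max (a x - real N) 0) \<le> \<bar>a x\<bar>" for N x by auto
    show "(\<lambda>N. max (a x - real N) 0) \<longlonglongrightarrow> 0" for x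
    proof (rule tendsto_eventually)
      obtain N0 :: nat where "a x \<le> real N0" using real_arch_simple by blast
      then show "\<forall>\<^sub>F N in sequentially. max (a x - real N) 0 = 0"
        by (intro eventually_sequentiallyI[of N0]) auto
    qed
  qed
  then have "\<forall>\<^sub>F N in sequentially. integral {0..T} (\<lambda>x. max (a x - real N) 0) < e"
    using e by (intro order_tendstoD) auto
  then show thesis using that li by (auto simp: eventually_sequentially)
qed

text \<open>The constant solution has the constant angle \<open>pi / 2\<close>, hence turning
  \<open>0\<close>; the width bound controls all other angles.\<close>

lemma turn_zero_potential:
  assumes w: "w > 0" and T: "T > 0"
  shows "turn_max w T (\<lambda>_. 0) < pi" "turn_min w T (\<lambda>_. 0) \<le> 0"
proof -
  have "is_prufer w (\<lambda>_. 0) (\<lambda>_. pi / 2)"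
    using ac_const[of "pi / 2"] by (simp add: is_prufer_def)
  from prufer_eqI[OF w _ this] have 0: "turn w T (\<lambda>_. 0) (pi / 2) = 0" by (simp add: turn_def)
  show "turn_min w T (\<lambda>_. 0) \<le> 0" using turn_min(1)[OF w T, of "\<lambda>_. 0" "pi / 2"] 0 by simp
  obtain \<theta> where "turn w T (\<lambda>_. 0) \<theta> = turn_max w T (\<lambda>_. 0)" using turn_max(2)[OF w T, of "\<lambda>_. 0"] by auto
  then show "turn_max w T (\<lambda>_. 0) < pi"
    using turn_width[OF w T, of "\<lambda>_. 0" \<theta> "pi / 2"] 0 by simp
qed

lemma sol_const:
  assumes "\<kappa> \<noteq> 0"
  shows "sol (\<lambda>_. \<kappa>\<^sup>2) (\<lambda>t. A * cos (\<kappa> * (t - s)) + B / \<kappa> * sin (\<kappa> * (t - s)))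
    (\<lambda>t. B * cos (\<kappa> * (t - s)) - A * \<kappa> * sin (\<kappa> * (t - s)))"
  unfolding sol_def
proof
  show "ac (\<lambda>t. A * cos (\<kappa> * (t - s)) + B / \<kappa> * sin (\<kappa> * (t - s))) (\<lambda>t. B * cos (\<kappa> * (t - s)) - A * \<kappa> * sin (\<kappa> * (t - s)))"
    by (rule deriv_ac) (use assms in \<open>auto intro!: derivative_eq_intros continuous_intros simp: field_simps\<close>)
  show "ac (\<lambda>t. B * cos (\<kappa> * (t - s)) - A * \<kappa> * sin (\<kappa> * (t - s))) (\<lambda>t. - \<kappa>\<^sup>2 * (A * cos (\<kappa> * (t - s)) + B / \<kappa> * sin (\<kappa> * (t - s))))"
    by (rule deriv_ac) (use assms in \<open>auto intro!: derivative_eq_intros continuous_intros simp: field_simps power2_eq_square\<close>)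
qed

text \<open>After time \<open>pi / \<kappa>\<close> every solution of the constant equation has
  changed sign, so the angle has gained an odd multiple of \<pi>; since the angle never decreases,
  this multiple is positive.\<close>

lemma prufer_const_half_period:
  assumes w: "w > 0" and k: "\<kappa> > 0"
  shows "prufer w (\<lambda>_. \<kappa>\<^sup>2) \<theta> t + pi \<le> prufer w (\<lambda>_. \<kappa>\<^sup>2) \<theta> (t + pi / \<kappa>)"
proof -
  let ?q = "\<lambda>_. \<kappa>\<^sup>2 :: real" and ?h = "t + pi / \<kappa>"
  let ?\<Theta> = "prufer w ?q \<theta>"
  have q: "locint ?q" by simp
  obtain r :: "real \<Rightarrow> real" where r: "r 0 = 1" "\<And>t. r t > 0"
    and s: "sol ?q (\<lambda>t. r t * sin (?\<Theta> t)) (\<lambda>t. w * (r t * cos (?\<Theta> t)))"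
    using prufer_sol[OF w q, of \<theta>] by blast
  have "\<kappa> * (?h - t) = pi" using k by simp
  then have "r ?h * sin (?\<Theta> ?h) = - (r t * sin (?\<Theta> t))" "w * (r ?h * cos (?\<Theta> ?h)) = w * (- (r t * cos (?\<Theta> t)))"
    using sol_unique[OF q s sol_const[of \<kappa> "r t * sin (?\<Theta> t)" t "w * (r t * cos (?\<Theta> t))"], of t ?h] k w
    by auto
  then have eq: "r ?h * sin (?\<Theta> ?h) = - (r t * sin (?\<Theta> t))" "r ?h * cos (?\<Theta> ?h) = - (r t * cos (?\<Theta> t))"
    using mult_left_cancel[of w "r ?h * cos (?\<Theta> ?h)" "- (r t * cos (?\<Theta> t))"] w by blast+
  have "(r ?h)\<^sup>2 * ((sin (?\<Theta> ?h))\<^sup>2 + (cos (?\<Theta> ?h))\<^sup>2) = (r ?h * sin (?\<Theta> ?h))\<^sup>2 + (r ?h * cos (?\<Theta> ?h))\<^sup>2"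
    by (simp only: power_mult_distrib distrib_left)
  also have "\<dots> = (r t)\<^sup>2 * ((sin (?\<Theta> t))\<^sup>2 + (cos (?\<Theta> t))\<^sup>2)"
    unfolding eq by (simp only: power_mult_distrib distrib_left power2_minus)
  finally have "r ?h = r t" using r(2)[of t] r(2)[of ?h] by simp
  then have "r t * sin (?\<Theta> ?h) = r t * (- sin (?\<Theta> t))" "r t * cos (?\<Theta> ?h) = r t * (- cos (?\<Theta> t))"
    using eq by simp_all
  moreover have "r t \<noteq> 0" using r(2)[of t] by simp
  ultimately have "sin (?\<Theta> ?h) = - sin (?\<Theta> t)" "cos (?\<Theta> ?h) = - cos (?\<Theta> t)"
    using mult_left_cancel by blast+
  then have "sin (?\<Theta> ?h) = sin (?\<Theta> t + pi) \<and> cos (?\<Theta> ?h) = cos (?\<Theta> t + pi)" by simp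
  then obtain j :: int where j: "?\<Theta> ?h = ?\<Theta> t + pi + 2 * pi * of_int j" unfolding sin_cos_eq_iff_int by auto
  have "?\<Theta> t \<le> ?\<Theta> ?h"
    using prufer(1)[OF w q, of \<theta>] unfolding is_prufer_def
    by (rule ac_mono) (use w k in auto)
  then have "0 \<le> pi * (1 + 2 * of_int j)" using j by (simp add: algebra_simps)
  then have "0 \<le> 1 + 2 * real_of_int j" unfolding zero_le_mult_iff using pi_gt_zero by linarith
  then have "j \<ge> 0" by linarith
  then show ?thesis using j by simp
qed

lemma turn_const_ge:
  assumes w: "w > 0" and T: "T > 0" and k: "k > 0"
  shows "2 * pi * real k \<le> turn_min w T (\<lambda>_. (2 * pi * real k / T)\<^sup>2)"
proof -
  define \<kappa> where "\<kappa> = 2 * pi * real k / T"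
  have \<kappa>: "\<kappa> > 0" using T k by (simp add: \<kappa>_def)
  have "\<theta> + real m * pi \<le> prufer w (\<lambda>_. \<kappa>\<^sup>2) \<theta> (real m * (pi / \<kappa>))" for m \<theta>
  proof (induction m)
    case 0 show ?case by (simp add: prufer(2)[OF w])
  next
    case (Suc m)
    then show ?case using prufer_const_half_period[OF w \<kappa>, of \<theta> "real m * (pi / \<kappa>)"] by (simp add: algebra_simps)
  qed
  from this[of _ "2 * k"] have "\<theta> + real (2 * k) * pi \<le> prufer w (\<lambda>_. \<kappa>\<^sup>2) \<theta> T" for \<theta>
    using T k by (simp add: \<kappa>_def)
  then have "2 * pi * real k \<le> turn w T (\<lambda>_. \<kappa>\<^sup>2) \<theta>" for \<theta> 
    unfolding turn_def by (simp add: algebra_simps)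
  then show ?thesis using turn_min(2)[OF w T, of "\<lambda>_. \<kappa>\<^sup>2"] unfolding \<kappa>_def by (metis locint_const)
qed

section \<open>Eigenvalues as critical shifts of the potential\<close>

context
  fixes w T :: real and a :: "real \<Rightarrow> real"
  assumes w: "w > 0" and T: "T > 0" and a: "locint a"
    and nonneg: "AE x in lebesgue. x \<in> {0..T} \<longrightarrow> 0 \<le> a x"
begin

lemma locint_shift: "locint (\<lambda>t. \<nu> + a t)"
  by (intro locint_intros a)

lemma turn_shift_strict:
  assumes "\<nu> < \<mu>"
  shows "turn_max w T (\<lambda>t. \<nu> + a t) < turn_max w T (\<lambda>t. \<mu> + a t)" "turn_min w T (\<lambda>t. \<nu> + a t) < turn_min w T (\<lambda>t. \<mu> + a t)"
proof -
  have e: "{x \<in> {0..T}. \<nu> + a x < \<mu> + a x} = {0..T}" using assms by auto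
  have "AE x in lebesgue. x \<in> {0..T} \<longrightarrow> \<nu> + a x \<le> \<mu> + a x" using assms by (intro AE_I2) simp
  note m = turn_extrema_mono(3,4)[OF w T locint_shift locint_shift this, unfolded e]
  show "turn_max w T (\<lambda>t. \<nu> + a t) < turn_max w T (\<lambda>t. \<mu> + a t)" "turn_min w T (\<lambda>t. \<nu> + a t) < turn_min w T (\<lambda>t. \<mu> + a t)"
    by (rule m, rule not_negligible_interval[OF T])+
qed

lemma turn_shift_cont:
  "continuous_on UNIV (\<lambda>\<nu>. turn_max w T (\<lambda>t. \<nu> + a t))" "continuous_on UNIV (\<lambda>\<nu>. turn_min w T (\<lambda>t. \<nu> + a t))"
proof -
  have i: "integral {0..T} (\<lambda>x. \<bar>\<mu> + a x - (\<nu> + a x)\<bar> / w) = \<bar>\<mu> - \<nu>\<bar> / w * T" for \<nu> \<mu>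
    using T by simp
  note l = turn_extrema_lipschitz[OF w T locint_shift locint_shift, unfolded i]
  have eq: "C * (\<bar>\<mu> - \<nu>\<bar> / w * T) = C / w * T * \<bar>\<mu> - \<nu>\<bar>" for C \<mu> \<nu> by simp
  show "continuous_on UNIV (\<lambda>\<nu>. turn_max w T (\<lambda>t. \<nu> + a t))" "continuous_on UNIV (\<lambda>\<nu>. turn_min w T (\<lambda>t. \<nu> + a t))"
    by (rule continuous_on_local_lipschitz, rule l[unfolded eq])+
qed

text \<open>The potential \<open>- w^2\<close> stays strictly below the critical values. Adding the
  small tail of \<open>a\<close> above level \<open>N\<close> does not use up this room, and
  \<open>- w^2 - N + a\<close> lies below that sum.\<close>

lemma turn_shift_low: "\<exists>\<nu>. turn_max w T (\<lambda>t. \<nu> + a t) < 2 * pi \<and> turn_min w T (\<lambda>t. \<nu> + a t) < 0"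
proof -
  let ?q0 = "\<lambda>_. - (w\<^sup>2) :: real"
  have q0: "locint ?q0" by simp
  have "{x \<in> {0..T}. - (w\<^sup>2) < (0::real)} = {0..T}" using w by auto
  then have "turn_min w T ?q0 < turn_min w T (\<lambda>_. 0)" "turn_max w T ?q0 < turn_max w T (\<lambda>_. 0)"
    using turn_extrema_mono(3,4)[OF w T q0 locint_const, of 0] not_negligible_interval[OF T] by auto
  then have mn: "turn_min w T ?q0 < 0" and mx: "turn_max w T ?q0 < pi"
    using turn_zero_potential[OF w T] by auto
  define K where "K = exp (2 * integral {0..T} (\<lambda>x. \<bar>- (w\<^sup>2) / w - w\<bar>))"
  have K: "K > 0" by (simp add: K_def)
  \<comment> \<open>Makes \<open>K * (e / w)\<close> equal to the room left, which reaches at most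
    to \<open>0\<close> for the minimum and to \<open>2 * pi\<close> for the maximum.\<close>
  define e where "e = min pi (- turn_min w T ?q0) * w / K"
  have "e > 0" using mn w K by (simp add: e_def)
  then obtain N :: nat where N: "locint (\<lambda>x. max (a x - real N) 0)" "integral {0..T} (\<lambda>x. max (a x - real N) 0) < e"
    using truncation_small[OF a] by metis
  let ?p = "\<lambda>x. max (a x - real N) 0" and ?q1 = "\<lambda>x. - (w\<^sup>2) + max (a x - real N) 0"
  have q1: "locint ?q1" by (intro locint_add N locint_const)
  have "integral {0..T} (\<lambda>x. \<bar>?q1 x - ?q0 x\<bar> / w) = integral {0..T} ?p / w"
    by (simp add: abs_of_nonneg)
  then have "\<bar>turn_max w T ?q1 - turn_max w T ?q0\<bar> \<le> K * (integral {0..T} ?p / w)"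
    "\<bar>turn_min w T ?q1 - turn_min w T ?q0\<bar> \<le> K * (integral {0..T} ?p / w)"
    using turn_extrema_lipschitz[OF w T q0 q1] unfolding K_def by simp_all
  moreover have "K * (integral {0..T} ?p / w) < K * (e / w)"
    using K w N(2) by (intro mult_strict_left_mono divide_strict_right_mono)
  moreover have "K * (e / w) = min pi (- turn_min w T ?q0)" using K w by (simp add: e_def)
  ultimately have 1: "turn_max w T ?q1 < 2 * pi" "turn_min w T ?q1 < 0" using mx by auto
  have "AE x in lebesgue. x \<in> {0..T} \<longrightarrow> (- (w\<^sup>2) - real N) + a x \<le> ?q1 x" by (rule AE_I2) auto
  from turn_extrema_mono(1,2)[OF w T locint_shift q1 this] 1 show ?thesis
    by (intro exI[of _ "- (w\<^sup>2) - real N"]) auto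
qed

lemma turn_shift_high: "\<exists>\<nu>. 2 * pi * real k \<le> turn_min w T (\<lambda>t. \<nu> + a t)"
proof -
  \<comment> \<open>\<open>Suc k\<close> because the comparison with a constant requires a positive
    index.\<close>
  let ?\<nu> = "(2 * pi * real (Suc k) / T)\<^sup>2"
  have "AE x in lebesgue. x \<in> {0..T} \<longrightarrow> ?\<nu> \<le> ?\<nu> + a x" by (rule eventually_mono[OF nonneg]) auto
  from turn_extrema_mono(2)[OF w T locint_const locint_shift this] turn_const_ge[OF w T, of "Suc k"]
  have "2 * pi * real (Suc k) \<le> turn_min w T (\<lambda>t. ?\<nu> + a t)" by simp
  moreover have "2 * pi * real k \<le> 2 * pi * real (Suc k)" by simp
  ultimately show ?thesis by (intro exI[of _ ?\<nu>]) linarith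
qed

lemma turn_shift_max_eq: "\<exists>\<nu>. turn_max w T (\<lambda>t. \<nu> + a t) = 2 * pi * (real k + 1)"
proof -
  obtain l h where lh: "turn_max w T (\<lambda>t. l + a t) < 2 * pi" "2 * pi * real (Suc k) \<le> turn_min w T (\<lambda>t. h + a t)"
    using turn_shift_low turn_shift_high[of "Suc k"] by metis
  have h: "2 * pi * (real k + 1) \<le> turn_max w T (\<lambda>t. h + a t)"
    using lh(2) turn_min_le_max[OF w T locint_shift, of h] by (simp add: algebra_simps)
  have "2 * pi * 1 \<le> 2 * pi * (real k + 1)" by (intro mult_left_mono) auto
  then have l: "turn_max w T (\<lambda>t. l + a t) < 2 * pi * (real k + 1)" using lh(1) by linarith
  then have "turn_max w T (\<lambda>t. l + a t) < turn_max w T (\<lambda>t. h + a t)" using h by linarith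
  then have "l \<le> h" using turn_shift_strict(1)[of h l] by (cases "l \<le> h") auto
  then show ?thesis
    using IVT'[of "\<lambda>\<nu>. turn_max w T (\<lambda>t. \<nu> + a t)" l "2 * pi * (real k + 1)" h] l h continuous_on_subset[OF turn_shift_cont(1)] by auto
qed

lemma turn_shift_min_eq: "\<exists>\<nu>. turn_min w T (\<lambda>t. \<nu> + a t) = 2 * pi * real k"
proof -
  obtain l h where lh: "turn_min w T (\<lambda>t. l + a t) < 0" "2 * pi * real k \<le> turn_min w T (\<lambda>t. h + a t)"
    using turn_shift_low turn_shift_high[of k] by metis
  have 0: "0 \<le> 2 * pi * real k" by simp
  then have "turn_min w T (\<lambda>t. l + a t) < turn_min w T (\<lambda>t. h + a t)" using lh by linarith
  then have "l \<le> h" using turn_shift_strict(2)[of h l] by (cases "l \<le> h") auto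
  then show ?thesis
    using IVT'[of "\<lambda>\<nu>. turn_min w T (\<lambda>t. \<nu> + a t)" l "2 * pi * real k" h] lh 0 continuous_on_subset[OF turn_shift_cont(2)] by auto
qed

text \<open>The minimal turning passes \<open>2 k \<pi>\<close> once for each
  \<open>k \<ge> 0\<close>, the maximal turning once for each \<open>k \<ge> 1\<close>. Listed
  alternately, these shifts form a monotone sequence whose fibres have the cardinality of the
  multiplicities, so it is the one that \<open>eig\<close> selects.\<close>

lemma eig_turn:
  "turn_min w T (\<lambda>t. eig T a (2 * k) + a t) = 2 * pi * real k"
  "turn_max w T (\<lambda>t. eig T a (2 * k + 1) + a t) = 2 * pi * (real k + 1)"
proof -
  let ?hi = "\<lambda>\<nu>. turn_max w T (\<lambda>t. \<nu> + a t)" and ?lo = "\<lambda>\<nu>. turn_min w T (\<lambda>t. \<nu> + a t)"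
  obtain A where A: "\<And>k. ?hi (A k) = 2 * pi * (real k + 1)" using turn_shift_max_eq by metis
  obtain B where B: "\<And>k. ?lo (B k) = 2 * pi * real k" using turn_shift_min_eq by metis
  define L where "L = (\<lambda>j. if even j then B (j div 2) else A (j div 2))"
  have hi_inj: "?hi x = ?hi y \<longleftrightarrow> x = y" for x y using turn_shift_strict(1)[of x y] turn_shift_strict(1)[of y x] by (cases x y rule: linorder_cases) auto
  have lo_inj: "?lo x = ?lo y \<longleftrightarrow> x = y" for x y using turn_shift_strict(2)[of x y] turn_shift_strict(2)[of y x] by (cases x y rule: linorder_cases) auto
  \<comment> \<open>This half of the interlacing uses that the minimum is below the maximum, the
    other half that the maximum stays within \<pi> of the minimum.\<close>
  have AB: "A k \<le> B (Suc k)" for k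
  proof (rule ccontr)
    assume "\<not> A k \<le> B (Suc k)"
    then have "?hi (B (Suc k)) < ?hi (A k)" by (intro turn_shift_strict) auto
    then show False using A[of k] B[of "Suc k"] turn_min_le_max[OF w T locint_shift, of "B (Suc k)"] by (simp add: algebra_simps)
  qed
  have BA: "B k \<le> A k" for k
  proof (rule ccontr)
    assume "\<not> B k \<le> A k"
    then have "?hi (A k) < ?hi (B k)" by (intro turn_shift_strict) auto
    then show False using A[of k] B[of k] turn_max_less_min[OF w T locint_shift, of "B k"] pi_gt_zero by (simp add: algebra_simps)
  qed
  have "L j \<le> L (Suc j)" for j
  proof (cases "even j")
    case True then show ?thesis using BA by (simp add: L_def)
  next
    case False
    then obtain m where "j = 2 * m + 1" by (auto elim: oddE)
    then show ?thesis using AB[of m] by (simp add: L_def)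
  qed
  then have mono: "mono L" by (simp add: incseq_Suc_iff)
  \<comment> \<open>Strict monotonicity in the shift leaves at most one even and one odd index over
    each \<mu>, one for each summand of the multiplicity. Maximum \<open>2 j \<pi>\<close> belongs
    to index \<open>2 * (j - 1) + 1\<close>, as its count starts at \<open>j = 1\<close>.\<close>
  have fib: "{k. L k = \<mu>} = (if \<exists>k::int. ?lo \<mu> = 2 * pi * of_int k then {2 * nat (THE k. ?lo \<mu> = 2 * pi * of_int k)} else {}) \<union>
     (if \<exists>k::int. ?hi \<mu> = 2 * pi * of_int k then {2 * nat ((THE k. ?hi \<mu> = 2 * pi * of_int k) - 1) + 1} else {})" for \<mu>
  proof -
    have the: "(THE k. x = 2 * pi * of_int k) = j" if "x = 2 * pi * of_int j" for x :: real and j :: int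
      using that by (intro the_equality) auto
    \<comment> \<open>Positivity rules out \<open>j \<le> 0\<close> for the maximum, and the width
      bound then rules out \<open>j < 0\<close> for the minimum; otherwise \<open>nat\<close> would
      send several values to the same index.\<close>
    have hi_pos: "?hi \<mu> > 0"
      using turn_0_pos[OF w T locint_shift] turn_max(1)[OF w T locint_shift] less_le_trans by blast
    have lo_gt: "?lo \<mu> > - pi" using hi_pos turn_max_less_min[OF w T locint_shift, of \<mu>] by simp
    have even: "{k. L k = \<mu>} \<inter> {k. even k} = (if \<exists>k::int. ?lo \<mu> = 2 * pi * of_int k then {2 * nat (THE k. ?lo \<mu> = 2 * pi * of_int k)} else {})"
    proof (cases "\<exists>k::int. ?lo \<mu> = 2 * pi * of_int k")
      case True
      then obtain j :: int where j: "?lo \<mu> = 2 * pi * of_int j" by blast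
      have "pi * (2 * of_int j + 1) > 0" using lo_gt j by (simp add: algebra_simps)
      then have "2 * real_of_int j + 1 > 0" by (simp add: zero_less_mult_iff)
      then have "j \<ge> 0" by linarith
      then have jn: "of_int j = real (nat j)" by simp
      have "L k = \<mu> \<longleftrightarrow> k = 2 * nat j" if "even k" for k
      proof -
        have "L k = \<mu> \<longleftrightarrow> ?lo (B (k div 2)) = ?lo \<mu>" using that by (simp add: L_def lo_inj)
        also have "\<dots> \<longleftrightarrow> k div 2 = nat j" unfolding B j jn by simp
        finally show ?thesis using that by auto
      qed
      then show ?thesis using True the[OF j] by auto
    next
      case False
      have "?lo (L k) = 2 * pi * of_int (int (k div 2))" if "even k" for k using that B by (simp add: L_def)
      then have "L k \<noteq> \<mu>" if "even k" for k using that False by metis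
      then show ?thesis using False by auto
    qed
    have odd: "{k. L k = \<mu>} \<inter> {k. odd k} = (if \<exists>k::int. ?hi \<mu> = 2 * pi * of_int k then {2 * nat ((THE k. ?hi \<mu> = 2 * pi * of_int k) - 1) + 1} else {})"
    proof (cases "\<exists>k::int. ?hi \<mu> = 2 * pi * of_int k")
      case True
      then obtain j :: int where j: "?hi \<mu> = 2 * pi * of_int j" by blast
      have "j > 0" using hi_pos j by (simp add: zero_less_mult_iff)
      then have jn: "of_int j = real (nat (j - 1)) + 1" by simp
      have "L k = \<mu> \<longleftrightarrow> k = 2 * nat (j - 1) + 1" if "odd k" for k
      proof -
        have "L k = \<mu> \<longleftrightarrow> ?hi (A (k div 2)) = ?hi \<mu>" using that by (simp add: L_def hi_inj)
        also have "\<dots> \<longleftrightarrow> k div 2 = nat (j - 1)" unfolding A j jn by simp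
        finally show ?thesis using that by (auto elim: oddE)
      qed
      then show ?thesis using True the[OF j] by auto
    next
      case False
      have "?hi (L k) = 2 * pi * of_int (int (k div 2) + 1)" if "odd k" for k using that A by (simp add: L_def)
      then have "L k \<noteq> \<mu>" if "odd k" for k using that False by metis
      then show ?thesis using False by auto
    qed
    have "{k. L k = \<mu>} = {k. L k = \<mu>} \<inter> {k. even k} \<union> {k. L k = \<mu>} \<inter> {k. odd k}" by blast
    then show ?thesis unfolding even odd .
  qed
  have spec: "finite {k. L k = \<mu>} \<and> card {k. L k = \<mu>} = multiplicity_eig T a \<mu>" for \<mu>
  proof -
    have "2 * i \<noteq> 2 * j + 1" "2 * j + 1 \<noteq> 2 * i" for i j :: nat by presburger+
    then show ?thesis unfolding fib multiplicity_eig_turn[OF w T a] by (auto simp: card_insert_if)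
  qed
  have "eig T a = L"
    unfolding eig_def
  proof (rule the_equality)
    show "mono L \<and> (\<forall>\<mu>. finite {k. L k = \<mu>} \<and> card {k. L k = \<mu>} = multiplicity_eig T a \<mu>)"
      using mono spec by blast
    fix M :: "nat \<Rightarrow> real" assume "mono M \<and> (\<forall>\<mu>. finite {k. M k = \<mu>} \<and> card {k. M k = \<mu>} = multiplicity_eig T a \<mu>)"
    then show "M = L" using mono spec by (intro mono_enumeration_unique) auto
  qed
  then show "turn_min w T (\<lambda>t. eig T a (2 * k) + a t) = 2 * pi * real k"
    "turn_max w T (\<lambda>t. eig T a (2 * k + 1) + a t) = 2 * pi * (real k + 1)"
    using A B by (simp_all add: L_def)
qed

text \<open>By strict monotonicity in the shift, the sign of the critical shift is decided by where
  the unshifted potential stands relative to the critical value.\<close>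

lemma eig_neg_iff: "eig T a (2 * k) < 0 \<longleftrightarrow> 2 * pi * real k < turn_min w T a"
  using turn_shift_strict(2)[of "eig T a (2 * k)" 0] turn_shift_strict(2)[of 0 "eig T a (2 * k)"]
  unfolding eig_turn by (cases "eig T a (2 * k)" "0::real" rule: linorder_cases) (auto simp: eig_turn(1)[of k, symmetric])

lemma eig_pos_iff: "0 < eig T a (2 * k + 1) \<longleftrightarrow> turn_max w T a < 2 * pi * (real k + 1)"
  using turn_shift_strict(1)[of "eig T a (2 * k + 1)" 0] turn_shift_strict(1)[of 0 "eig T a (2 * k + 1)"]
  unfolding eig_turn by (cases "eig T a (2 * k + 1)" "0::real" rule: linorder_cases) (auto simp: eig_turn(2)[of k, symmetric])

end

lemma prufer_const:
  assumes w: "w > 0" shows "prufer w (\<lambda>_. w\<^sup>2) \<theta> t = \<theta> + w * t"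
proof -
  have "is_prufer w (\<lambda>_. w\<^sup>2) (\<lambda>t. \<theta> + w * t)"
  proof -
    have "ac (\<lambda>t. \<theta> + w * t) (\<lambda>t. 0 + w * 1)" by (intro ac_add ac_const ac_cmul ac_ident)
    then show ?thesis unfolding is_prufer_def
    proof (rule ac_cong)
      fix t
      have "w * (cos (\<theta> + w * t))\<^sup>2 + w * (sin (\<theta> + w * t))\<^sup>2 = w * ((sin (\<theta> + w * t))\<^sup>2 + (cos (\<theta> + w * t))\<^sup>2)"
        by (simp only: distrib_left add.commute)
      moreover have "w\<^sup>2 / w = w" using w by (simp add: power2_eq_square)
      ultimately show "0 + w * 1 = w * (cos (\<theta> + w * t))\<^sup>2 + w\<^sup>2 / w * (sin (\<theta> + w * t))\<^sup>2"
        by simp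
    qed simp
  qed
  from prufer_eqI[OF w _ this] show ?thesis by simp
qed

text \<open>Under the potential \<open>w\<^sup>2\<close> every angle turns by exactly
  \<open>w * T = 2 n \<pi>\<close>, so the shift of the zero potential by \<open>w\<^sup>2\<close>
  is critical for the maximum.\<close>

lemma eig0_eq:
  assumes T: "T > 0" and n: "n \<ge> 1"
  shows "eig0 T (2 * n - 1) = (2 * pi * real n / T)\<^sup>2"
proof -
  define w where "w = 2 * pi * real n / T"
  have w: "w > 0" using assms by (simp add: w_def)
  have turn: "turn w T (\<lambda>_. w\<^sup>2) \<theta> = 2 * pi * real n" for \<theta>
    using T by (simp add: turn_def prufer_const[OF w]) (simp add: w_def)
  then have "turn_max w T (\<lambda>_. w\<^sup>2) = 2 * pi * real n" using turn_max(2)[OF w T, of "\<lambda>_. w\<^sup>2"] by auto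
  moreover obtain k where k: "n = Suc k" using n by (cases n) auto
  moreover have z: "locint (\<lambda>_. 0)" "AE x in lebesgue. x \<in> {0..T} \<longrightarrow> (0::real) \<le> 0" by auto
  ultimately have "turn_max w T (\<lambda>t. eig T (\<lambda>_. 0) (2 * k + 1) + 0) = turn_max w T (\<lambda>t. w\<^sup>2 + 0)"
    using eig_turn(2)[OF w T z, of k] by simp
  then have "eig T (\<lambda>_. 0) (2 * k + 1) = w\<^sup>2"
    using turn_shift_strict(1)[OF w T z, of "eig T (\<lambda>_. 0) (2 * k + 1)" "w\<^sup>2"]
      turn_shift_strict(1)[OF w T z, of "w\<^sup>2" "eig T (\<lambda>_. 0) (2 * k + 1)"]
    by (cases "eig T (\<lambda>_. 0) (2 * k + 1)" "w\<^sup>2" rule: linorder_cases) auto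
  then show ?thesis using k by (simp add: eig0_def w_def)
qed

section \<open>Zeros and quarter waves\<close>

lemma strict_mono_image_eq:
  fixes f g :: "nat \<Rightarrow> real"
  assumes "\<And>i j. i < j \<Longrightarrow> j < N \<Longrightarrow> f i < f j" "\<And>i j. i < j \<Longrightarrow> j < N \<Longrightarrow> g i < g j"
    and "f ` {..<N} = g ` {..<N}" and "k < N"
  shows "f k = g k"
proof -
  have "map f [0..<N] = map g [0..<N]"
  proof (rule sorted_distinct_set_unique)
    show "sorted (map f [0..<N])" "sorted (map g [0..<N])"
      using assms(1,2) by (auto simp: sorted_iff_nth_mono_less less_imp_le)
    have "inj_on h {0..<N}" if "\<And>i j. i < j \<Longrightarrow> j < N \<Longrightarrow> h i < h j" for h :: "nat \<Rightarrow> real"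
    proof (rule linorder_inj_onI')
      fix i j assume "i < j" "j \<in> {0..<N}"
      then have "h i < h j" using that by simp
      then show "h i \<noteq> h j" by simp
    qed
    from this[of f] this[of g] have "inj_on f {0..<N}" "inj_on g {0..<N}" using assms(1,2) by blast+
    then show "distinct (map f [0..<N])" "distinct (map g [0..<N])"
      by (auto simp: distinct_map)
    show "set (map f [0..<N]) = set (map g [0..<N])" using assms(3) by (simp add: lessThan_atLeast0)
  qed
  then show ?thesis using assms(4) by (simp add: map_eq_conv)
qed

text \<open>An increasing listing of a finite set is determined by the set, so statements about all
  listings may be checked on one that is constructed from the angle.\<close>

lemma zero_listing_unique:
  assumes "zero_listing T u v m t" "zero_listing T u v m' t'"
  shows "m = m'" "\<And>i. i \<le> 2 * m \<Longrightarrow> t i = t' i"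
proof -
  have card: "card {s \<in> {0..T}. u s = 0} = Suc k" if "zero_listing T u v k s" for k s
  proof -
    have "inj_on (\<lambda>i. s (2 * i)) {..k}"
      using that unfolding zero_listing_def by (intro linorder_inj_onI') fastforce
    then show ?thesis using that by (simp add: zero_listing_def card_image)
  qed
  show mm: "m = m'" using card[OF assms(1)] card[OF assms(2)] by simp
  note 1 = assms(1)[unfolded zero_listing_def] and 2 = assms(2)[folded mm, unfolded zero_listing_def]
  have even: "t (2 * i) = t' (2 * i)" if "i \<le> m" for i
    by (rule strict_mono_image_eq[of "Suc m" "\<lambda>i. t (2 * i)" "\<lambda>i. t' (2 * i)"])
      (use 1 2 that in \<open>auto simp: lessThan_Suc_atMost\<close>)
  have odd: "t (2 * i + 1) = t' (2 * i + 1)" if "i < m" for i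
    by (rule strict_mono_image_eq[of m "\<lambda>i. t (2 * i + 1)" "\<lambda>i. t' (2 * i + 1)"])
      (use 1 2 that in auto)
  show "t i = t' i" if "i \<le> 2 * m" for i
  proof (cases "even i")
    case True
    then show ?thesis using even[of "i div 2"] that by auto
  next
    case False
    then obtain j where "i = 2 * j + 1" by (auto elim: oddE)
    then show ?thesis using odd[of j] that by auto
  qed
qed

text \<open>A single increasing function meets the even multiples of \<open>pi / 2\<close> at the
  zeros of \<open>u\<close> and the odd ones at the zeros of \<open>v\<close>, so interlacing comes
  for free. The factor \<open>r\<close> may be negative, which covers both signs of the initial
  slope.\<close>

lemma zero_listing_of_angle:
  assumes T: "T > 0" and cont: "continuous_on UNIV \<Phi>"
    and mono: "\<And>s t. 0 \<le> s \<Longrightarrow> s < t \<Longrightarrow> t \<le> T \<Longrightarrow> \<Phi> s < \<Phi> t"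
    and ends: "\<Phi> 0 = 0" "\<Phi> T = real m * pi"
    and u: "\<And>t. u t = r t * sin (\<Phi> t)" and v: "\<And>t. v t = r t * (c * cos (\<Phi> t))"
    and r: "\<And>t. r t \<noteq> 0" and c: "c \<noteq> 0"
  obtains t where "zero_listing T u v m t" "\<And>i. i \<le> 2 * m \<Longrightarrow> t i \<in> {0..T}"
    "\<And>i. i \<le> 2 * m \<Longrightarrow> \<Phi> (t i) = real i * (pi / 2)"
proof -
  have ex: "\<exists>s\<in>{0..T}. \<Phi> s = real i * (pi / 2)" if "i \<le> 2 * m" for i
  proof -
    have "real i * (pi / 2) \<le> real (2 * m) * (pi / 2)" using that by (intro mult_right_mono) auto
    then have "\<Phi> 0 \<le> real i * (pi / 2)" "real i * (pi / 2) \<le> \<Phi> T" by (simp_all add: ends)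
    from IVT'[of \<Phi> 0 "real i * (pi / 2)" T, OF this] T continuous_on_subset[OF cont, of "{0..T}"] show ?thesis by auto
  qed
  define t where "t = (\<lambda>i. SOME s. s \<in> {0..T} \<and> \<Phi> s = real i * (pi / 2))"
  have "t i \<in> {0..T} \<and> \<Phi> (t i) = real i * (pi / 2)" if "i \<le> 2 * m" for i
    unfolding t_def by (rule someI_ex) (use ex[OF that] in blast)
  then have t: "t i \<in> {0..T}" "\<Phi> (t i) = real i * (pi / 2)" if "i \<le> 2 * m" for i
    using that by blast+
  have inj: "x = y" if "x \<in> {0..T}" "y \<in> {0..T}" "\<Phi> x = \<Phi> y" for x y
    using mono[of x y] mono[of y x] that by (cases x y rule: linorder_cases) auto
  have less: "x < y" if "x \<in> {0..T}" "y \<in> {0..T}" "\<Phi> x < \<Phi> y" for x y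
    using mono[of y x] that by (cases x y rule: linorder_cases) auto
  have t_less: "t i < t j" if "i < j" "j \<le> 2 * m" for i j
  proof (rule less)
    have i: "i \<le> 2 * m" using that by simp
    show "t i \<in> {0..T}" "t j \<in> {0..T}" using t(1) i that(2) by blast+
    show "\<Phi> (t i) < \<Phi> (t j)" unfolding t(2)[OF i] t(2)[OF that(2)] using that(1) by simp
  qed
  have range: "0 \<le> \<Phi> s \<and> \<Phi> s \<le> real m * pi" if "s \<in> {0..T}" for s
    using mono[of 0 s] mono[of s T] ends that by (cases "s = 0"; cases "s = T") auto
  have range': "0 < \<Phi> s \<and> \<Phi> s < real m * pi" if "s \<in> {0<..<T}" for s
    using mono[of 0 s] mono[of s T] ends that by auto
  have t_ends: "t 0 = 0" "t (2 * m) = T"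
    using inj[of "t 0" 0] inj[of "t (2 * m)" T] t[of 0] t[of "2 * m"] T by (simp_all add: ends)
  have "zero_listing T u v m t"
    unfolding zero_listing_def
  proof (intro conjI)
    show "t 0 = 0" "t (2 * m) = T" by (rule t_ends)+
    show "\<forall>i j. i < j \<and> j \<le> m \<longrightarrow> t (2 * i) < t (2 * j)" "\<forall>i j. i < j \<and> j < m \<longrightarrow> t (2 * i + 1) < t (2 * j + 1)"
      using t_less by auto
    show "{s \<in> {0..T}. u s = 0} = (\<lambda>i. t (2 * i)) ` {..m}"
    proof (intro equalityI subsetI)
      fix s assume "s \<in> {s \<in> {0..T}. u s = 0}"
      then have "s \<in> {0..T}" "r s * sin (\<Phi> s) = 0" unfolding u by blast+
      then have s: "s \<in> {0..T}" "sin (\<Phi> s) = 0" using r[of s] by simp_all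
      then obtain i :: int where i: "\<Phi> s = of_int i * pi" by (auto simp: sin_zero_iff_int2)
      have "0 \<le> of_int i * pi" "of_int i * pi \<le> of_int (int m) * pi" using range[OF s(1)] i by auto
      moreover have "\<not> pi \<le> 0" using pi_gt_zero by linarith
      ultimately have "0 \<le> i" "i \<le> int m" by (simp_all add: zero_le_mult_iff mult_le_cancel_right)
      then have k: "2 * nat i \<le> 2 * m" by simp
      have "\<Phi> s = \<Phi> (t (2 * nat i))" unfolding t(2)[OF k] using i \<open>0 \<le> i\<close> by simp
      then have "s = t (2 * nat i)" using inj[OF s(1) t(1)[OF k]] by simp
      then show "s \<in> (\<lambda>i. t (2 * i)) ` {..m}" using k by (intro image_eqI) auto
    next
      fix s assume "s \<in> (\<lambda>i. t (2 * i)) ` {..m}"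
      then obtain i where i: "i \<le> m" "s = t (2 * i)" by auto
      then have k: "2 * i \<le> 2 * m" by simp
      have "\<Phi> s = real i * pi" unfolding i(2) t(2)[OF k] by simp
      then have "u s = 0" unfolding u by simp
      then show "s \<in> {s \<in> {0..T}. u s = 0}" using t(1)[OF k] i(2) by simp
    qed
    show "{s \<in> {0<..<T}. v s = 0} = (\<lambda>i. t (2 * i + 1)) ` {..<m}"
    proof (intro equalityI subsetI)
      fix s assume "s \<in> {s \<in> {0<..<T}. v s = 0}"
      then have "s \<in> {0<..<T}" "r s * (c * cos (\<Phi> s)) = 0" unfolding v by blast+
      then have s: "s \<in> {0<..<T}" "cos (\<Phi> s) = 0" using r[of s] c by simp_all
      then obtain i :: int where i: "odd i" "\<Phi> s = of_int i * (pi / 2)" by (auto simp: cos_zero_iff_int)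
      have "0 < of_int i * (pi / 2)" "of_int i * (pi / 2) < of_int (2 * int m) * (pi / 2)" using range'[OF s(1)] i by auto
      then have "0 < real_of_int i" "real_of_int i < of_int (2 * int m)"
        using zero_less_mult_pos2[of "of_int i" "pi / 2"] mult_less_cancel_right_pos[of "pi / 2"] pi_half_gt_zero by blast+
      then have i': "0 < i" "i < 2 * int m" unfolding of_int_less_iff of_int_0_less_iff by blast+
      from i(1) obtain j' where "i = 2 * j' + 1" by (rule oddE)
      then obtain j where j: "i = 2 * int j + 1" "j < m" using i' by (cases j') auto
      have k: "2 * j + 1 \<le> 2 * m" using j(2) by simp
      have "\<Phi> s = \<Phi> (t (2 * j + 1))" unfolding t(2)[OF k] using i(2) j(1) by simp
      then have "s = t (2 * j + 1)" using inj[OF _ t(1)[OF k], of s] s(1) by simp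
      then show "s \<in> (\<lambda>i. t (2 * i + 1)) ` {..<m}" using j by auto
    next
      fix s assume "s \<in> (\<lambda>i. t (2 * i + 1)) ` {..<m}"
      then obtain i where i: "i < m" "s = t (2 * i + 1)" by auto
      then have k: "2 * i + 1 \<le> 2 * m" by simp
      have "\<Phi> s = real i * pi + pi / 2" unfolding i(2) t(2)[OF k] by (simp add: algebra_simps add_divide_distrib)
      moreover have "cos (real i * pi + pi / 2) = 0" by (simp add: cos_add)
      moreover have "t 0 < s" "s < t (2 * m)" using t_less i by auto
      moreover note t_ends
      ultimately have "v s = 0" "0 < s" "s < T" unfolding v by auto
      then show "s \<in> {s \<in> {0<..<T}. v s = 0}" by simp
    qed
  qed
  then show thesis using that t by blast
qed

text \<open>Convexity of the cotangent on the first quadrant; the left side is its tangent at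
  \<open>c\<close>.\<close>

lemma cot_tangent:
  fixes x c :: real
  assumes x: "0 < x" "x \<le> pi / 2" and c: "0 < c" "c \<le> pi / 2"
  shows "cot c - (x - c) / (sin c)\<^sup>2 \<le> cot x"
proof -
  \<comment> \<open>The added linear term cancels the slope at \<open>c\<close>, so that
    \<open>c\<close> becomes the minimum point.\<close>
  define f where "f = (\<lambda>x. cot x + x / (sin c)\<^sup>2)"
  have sin_pos: "sin y > 0" if "0 < y" "y \<le> pi / 2" for y :: real
    using that by (intro sin_gt_zero) auto
  have d: "(f has_real_derivative (1 / (sin c)\<^sup>2 - 1 / (sin y)\<^sup>2)) (at y)" if "0 < y" "y \<le> pi / 2" for y
    unfolding f_def using sin_pos[OF that] sin_pos[OF c]
    by (auto intro!: derivative_eq_intros DERIV_cot simp: divide_inverse)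
  have "f c \<le> f x"
  proof (cases x c rule: linorder_cases)
    case less
    then obtain z where z: "x < z" "z < c" "f c - f x = (c - x) * (1 / (sin c)\<^sup>2 - 1 / (sin z)\<^sup>2)"
      using MVT2[of x c f "\<lambda>y. 1 / (sin c)\<^sup>2 - 1 / (sin y)\<^sup>2", OF _ d] x c by auto
    have sz: "0 < sin z" "sin z \<le> sin c" using z x c by (auto intro!: sin_pos sin_monotone_2pi_le)
    then have "(sin z)\<^sup>2 \<le> (sin c)\<^sup>2" by (intro power_mono) auto
    then have "1 / (sin c)\<^sup>2 \<le> 1 / (sin z)\<^sup>2" using sz by (intro divide_left_mono) auto
    then have "(c - x) * (1 / (sin c)\<^sup>2 - 1 / (sin z)\<^sup>2) \<le> 0" using less by (intro mult_nonneg_nonpos) auto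
    then show ?thesis using z(3) by simp
  next
    case greater
    then obtain z where z: "c < z" "z < x" "f x - f c = (x - c) * (1 / (sin c)\<^sup>2 - 1 / (sin z)\<^sup>2)"
      using MVT2[of c x f "\<lambda>y. 1 / (sin c)\<^sup>2 - 1 / (sin y)\<^sup>2", OF _ d] x c by auto
    have sz: "0 < sin c" "sin c \<le> sin z" using z x c by (auto intro!: sin_pos sin_monotone_2pi_le)
    then have "(sin c)\<^sup>2 \<le> (sin z)\<^sup>2" by (intro power_mono) auto
    then have "1 / (sin z)\<^sup>2 \<le> 1 / (sin c)\<^sup>2" using sz by (intro divide_left_mono) auto
    then have "(x - c) * (1 / (sin c)\<^sup>2 - 1 / (sin z)\<^sup>2) \<ge> 0" using greater by (intro mult_nonneg_nonneg) auto
    then show ?thesis using z(3) by simp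
  qed simp
  then show ?thesis by (simp add: f_def diff_divide_distrib)
qed

text \<open>
  The Wronskian of the solution with the sine of frequency \<open>w\<close> that vanishes at the same zero \<open>z\<close>
  turns the estimate into a pointwise comparison of integrands.
\<close>

lemma quarter_wave:
  assumes w: "w > 0" and s: "sol a U V" and pq: "p < q" "w * (q - p) \<le> pi / 2"
    and ze: "z = p \<and> e = q \<or> z = q \<and> e = p" and U: "U z = 0" "V e = 0" "U e \<noteq> 0"
    and max: "\<And>t. t \<in> {p..q} \<Longrightarrow> (U t)\<^sup>2 \<le> (U e)\<^sup>2"
    and ge: "AE x in lebesgue. x \<in> {p..q} \<longrightarrow> w\<^sup>2 \<le> a x" and B: "ac B (\<lambda>x. a x - w\<^sup>2)"
  shows "w * cot (w * (q - p)) \<le> B q - B p"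
    and "\<not> negligible {x \<in> {p..q}. w\<^sup>2 < a x} \<Longrightarrow> w * cot (w * (q - p)) < B q - B p"
proof -
  define S S' where "S = (\<lambda>t. sin (w * (t - z)))" and "S' = (\<lambda>t. w * cos (w * (t - z)))"
  define x where "x = w * (q - p)"
  have x: "0 < x" "x \<le> pi / 2" using pq w by (auto simp: x_def)
  have sx: "sin x > 0" using x by (intro sin_gt_zero) auto
  have S: "ac S S'" unfolding S_def S'_def
    by (rule deriv_ac) (auto intro!: derivative_eq_intros continuous_intros)
  have S': "ac S' (\<lambda>t. - (w\<^sup>2) * S t)" unfolding S_def S'_def
    by (rule deriv_ac) (auto intro!: derivative_eq_intros continuous_intros simp: power2_eq_square)
  have W: "ac (\<lambda>t. V t * S t - U t * S' t) (\<lambda>t. - ((a t - w\<^sup>2) * (U t * S t)))"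
    using ac_diff[OF ac_mult ac_mult, of V "\<lambda>t. - a t * U t" S S' U V S' "\<lambda>t. - (w\<^sup>2) * S t"] s S S'
    unfolding sol_def by (auto elim!: ac_cong simp: algebra_simps)
  have hB: "((\<lambda>x. a x - w\<^sup>2) has_integral (B q - B p)) {p..q}" using ac_has_int[OF B] pq by simp
  \<comment> \<open>Orients the comparison sine so that it is nonnegative on the piece, whichever
    end carries the zero of \<open>U\<close>.\<close>
  define \<sigma> :: real where "\<sigma> = (if z = p then 1 else - 1)"
  have Ss: "0 \<le> \<sigma> * S t" "\<sigma> * S t < sin x \<or> t = e" if "t \<in> {p..q}" for t
  proof -
    have st: "\<sigma> * S t = sin (w * \<bar>t - z\<bar>)"
    proof (cases "z = p")
      case True then show ?thesis using that by (simp add: \<sigma>_def S_def)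
    next
      case False
      then have "z = q" using ze by auto
      then have "w * (t - z) = - (w * \<bar>t - z\<bar>)" using that by (simp add: algebra_simps)
      then show ?thesis using False by (simp add: \<sigma>_def S_def)
    qed
    have le: "\<bar>t - z\<bar> \<le> q - p" "\<bar>t - z\<bar> = q - p \<longleftrightarrow> t = e" using that ze by auto
    then have le2: "w * \<bar>t - z\<bar> \<le> x" using w by (simp add: x_def)
    show "0 \<le> \<sigma> * S t" unfolding st using w le2 x by (intro sin_ge_zero) auto
    show "\<sigma> * S t < sin x \<or> t = e"
    proof (cases "t = e")
      case False
      then have "\<bar>t - z\<bar> < q - p" using le by linarith
      then have "w * \<bar>t - z\<bar> < x" using w by (simp add: x_def)
      moreover have "0 \<le> w * \<bar>t - z\<bar>" using w by simp
      ultimately show ?thesis unfolding st using x by (intro disjI1 sin_monotone_2pi) linarith+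
    qed simp
  qed
  \<comment> \<open>The boundary terms at \<open>z\<close> vanish with \<open>U\<close> and
    \<open>S\<close>; at \<open>e\<close>, where \<open>V\<close> vanishes, only
    \<open>U e * S' e\<close> remains. The factor \<open>U e\<close> makes the estimate independent
    of the sign of \<open>U\<close>.\<close>
  have "((\<lambda>t. (a t - w\<^sup>2) * (U e * U t * (\<sigma> * S t))) has_integral (U e)\<^sup>2 * (w * cos x)) {p..q}"
  proof -
    have h: "((\<lambda>t. - (\<sigma> * U e) * - ((a t - w\<^sup>2) * (U t * S t))) has_integral
      - (\<sigma> * U e) * ((V q * S q - U q * S' q) - (V p * S p - U p * S' p))) {p..q}"
      using ac_has_int[OF W, of p q] pq by (intro has_integral_mult_right) auto
    have "- (\<sigma> * U e) * ((V q * S q - U q * S' q) - (V p * S p - U p * S' p)) = (U e)\<^sup>2 * (w * cos x)"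
    proof (cases "z = p")
      case True
      then have "e = q" using ze pq by auto
      then show ?thesis using True U by (simp add: \<sigma>_def S_def S'_def x_def power2_eq_square)
    next
      case False
      then have *: "z = q" "e = p" using ze by auto
      have "cos (w * (p - q)) = cos (w * (q - p))" using cos_minus[of "w * (q - p)"] by (simp add: algebra_simps)
      then show ?thesis using False U * by (simp add: \<sigma>_def S_def S'_def x_def power2_eq_square)
    qed
    then show ?thesis using h by (simp add: mult_ac)
  qed
  moreover have "((\<lambda>t. (a t - w\<^sup>2) * ((U e)\<^sup>2 * sin x)) has_integral (B q - B p) * ((U e)\<^sup>2 * sin x)) {p..q}"
    by (intro has_integral_mult_left hB)
  \<comment> \<open>From \<open>|U t| \<le> |U e|\<close> and \<open>\<sigma> * S t < sin x\<close>.
    Equality is possible at \<open>e\<close> only, so an excess on a set of positive measure makes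
    the integrals differ.\<close>
  moreover have pw: "U e * U t * (\<sigma> * S t) < (U e)\<^sup>2 * sin x \<or> t = e" if t: "t \<in> {p..q}" for t
  proof (cases "t = e")
    case False
    have "\<bar>U e * U t\<bar> \<le> (U e)\<^sup>2"
      unfolding abs_mult power2_eq_square[of "U e"] abs_mult_self_eq[of "U e", symmetric]
      using max[OF t] by (intro mult_left_mono) (auto simp: abs_le_square_iff)
    then have "U e * U t * (\<sigma> * S t) \<le> (U e)\<^sup>2 * (\<sigma> * S t)" using Ss(1)[OF t] by (intro mult_right_mono) auto
    also have "\<dots> < (U e)\<^sup>2 * sin x" using Ss(2)[OF t] False U(3) by (intro mult_strict_left_mono) auto
    finally show ?thesis by simp
  qed simp
  have ae_e: "AE t in lebesgue. t \<noteq> e" by (auto simp: AE_lebesgue_iff)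
  from ge ae_e have le: "AE t in lebesgue. t \<in> {p..q} \<longrightarrow> (a t - w\<^sup>2) * (U e * U t * (\<sigma> * S t)) \<le> (a t - w\<^sup>2) * ((U e)\<^sup>2 * sin x)"
    by eventually_elim (use pw in \<open>auto intro!: mult_left_mono intro: less_imp_le\<close>)
  ultimately have I: "(U e)\<^sup>2 * (w * cos x) \<le> (B q - B p) * ((U e)\<^sup>2 * sin x)"
    by (intro has_integral_mono_AE[OF _ _ le])
  have Ue: "(U e)\<^sup>2 > 0" using U(3) by simp
  have cot: "w * cot x = (U e)\<^sup>2 * (w * cos x) / ((U e)\<^sup>2 * sin x)" using Ue by (simp add: cot_def)
  show "w * cot (w * (q - p)) \<le> B q - B p"
    unfolding x_def[symmetric] cot using I sx Ue by (simp add: pos_divide_le_eq)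
  assume neg: "\<not> negligible {x \<in> {p..q}. w\<^sup>2 < a x}"
  have "\<not> negligible {t \<in> {p..q}. (a t - w\<^sup>2) * (U e * U t * (\<sigma> * S t)) < (a t - w\<^sup>2) * ((U e)\<^sup>2 * sin x)}"
  proof
    assume "negligible {t \<in> {p..q}. (a t - w\<^sup>2) * (U e * U t * (\<sigma> * S t)) < (a t - w\<^sup>2) * ((U e)\<^sup>2 * sin x)}"
    then have "negligible ({t \<in> {p..q}. (a t - w\<^sup>2) * (U e * U t * (\<sigma> * S t)) < (a t - w\<^sup>2) * ((U e)\<^sup>2 * sin x)} \<union> {e})" by simp
    then have "negligible {x \<in> {p..q}. w\<^sup>2 < a x}"
      by (rule negligible_subset) (use pw in \<open>auto intro!: mult_strict_left_mono\<close>)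
    then show False using neg by blast
  qed
  with \<open>((\<lambda>t. (a t - w\<^sup>2) * (U e * U t * (\<sigma> * S t))) has_integral (U e)\<^sup>2 * (w * cos x)) {p..q}\<close>
    \<open>((\<lambda>t. (a t - w\<^sup>2) * ((U e)\<^sup>2 * sin x)) has_integral (B q - B p) * ((U e)\<^sup>2 * sin x)) {p..q}\<close>
  have "(U e)\<^sup>2 * (w * cos x) < (B q - B p) * ((U e)\<^sup>2 * sin x)"
    by (intro has_integral_mono_AE_strict[OF _ _ le])
  then show "w * cot (w * (q - p)) < B q - B p"
    unfolding x_def[symmetric] cot using sx Ue by (simp add: pos_divide_less_eq)
qed

lemma interval_subset_UN:
  fixes t :: "nat \<Rightarrow> real"
  shows "{t 0..t N} \<subseteq> (\<Union>i<N. {t i..t (Suc i)}) \<union> {t 0}"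
proof (induction N)
  case (Suc N)
  have "{t 0..t (Suc N)} \<subseteq> {t 0..t N} \<union> {t N..t (Suc N)}" by auto
  also have "\<dots> \<subseteq> (\<Union>i<Suc N. {t i..t (Suc i)}) \<union> {t 0}"
    using Suc by (auto simp: lessThan_Suc)
  finally show ?case .
qed auto

lemma sin_cos_multiple_half_pi:
  "even k \<Longrightarrow> sin (real k * (pi / 2)) = 0" "odd k \<Longrightarrow> cos (real k * (pi / 2)) = 0"
proof -
  show "sin (real k * (pi / 2)) = 0" if e: "even k"
  proof -
    obtain j where "k = 2 * j" using e by (rule evenE)
    then have "real k * (pi / 2) = real j * pi" by simp
    then show ?thesis by simp
  qed
  show "cos (real k * (pi / 2)) = 0" if e: "odd k"
  proof -
    obtain j where "k = 2 * j + 1" using e by (rule oddE)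
    then have "real k * (pi / 2) = real j * pi + pi / 2" by (simp add: algebra_simps add_divide_distrib)
    then show ?thesis by (simp only: cos_add) simp
  qed
qed

text \<open>The number \<open>n + 1\<close> arises here: the angle gains more than
  \<open>w * T = 2 n \<pi>\<close> by strict comparison, a multiple of \<pi> since
  \<open>U T = 0\<close>, and an even one since \<open>V T = V 0\<close>. The constant
  \<open>c\<close> is the phase of one of \<open>4 (n + 1)\<close> equal pieces of the
  period.\<close>

lemma sol_vanishing_at_ends:
  fixes T :: real and n :: nat
  assumes T: "T > 0" and n: "n \<ge> 1"
  defines "w \<equiv> 2 * pi * real n / T" and "c \<equiv> real n * pi / (2 * (real n + 1))"
  assumes a: "locint a" and ge: "AE x in lebesgue. x \<in> {0..T} \<longrightarrow> w\<^sup>2 \<le> a x"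
    and neg: "\<not> negligible {x \<in> {0..T}. w\<^sup>2 < a x}"
    and s: "sol a U V" and ends: "U 0 = 0" "U T = 0" "V T = V 0" "V 0 \<noteq> 0"
  shows "\<exists>m t. zero_listing T U V m t \<and> (\<forall>i<2 * m. t i < t (i + 1)) \<and>
    (\<forall>i<2 * m. t (i + 1) - t i \<le> T / (4 * real n)) \<and> (\<exists>i<2 * m. t (i + 1) - t i < T / (4 * real n)) \<and>
    even m \<and> m \<ge> 2 * (n + 1) \<and> 4 * (real n + 1) * w * cot c < integral {0..T} (\<lambda>x. a x - w\<^sup>2)"
proof -
  have w: "w > 0" using T n by (simp add: w_def)
  define \<Phi> where "\<Phi> = prufer w a 0"
  have \<Phi>: "is_prufer w a \<Phi>" "\<Phi> 0 = 0" unfolding \<Phi>_def using prufer[OF w a] by auto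
  \<comment> \<open>The initial angle is \<open>0\<close> or \<pi> by the sign of the slope.
    Shifting it to \<open>0\<close> moves that sign into the radius \<open>r\<close>.\<close>
  define j :: int where "j = (if V 0 > 0 then 0 else 1)"
  have "U 0 = \<bar>V 0\<bar> / w * sin (of_int j * pi)" "V 0 = w * (\<bar>V 0\<bar> / w * cos (of_int j * pi))" "\<bar>V 0\<bar> / w > 0"
    using ends w by (auto simp: j_def)
  then have "\<exists>\<Theta> r. is_prufer w a \<Theta> \<and> \<Theta> 0 = of_int j * pi \<and> (\<forall>t. r t > 0 \<and> U t = r t * sin (\<Theta> t) \<and> V t = w * (r t * cos (\<Theta> t)))"
    by (rule sol_prufer[OF w a s]) (intro exI conjI allI, auto)
  then obtain \<Theta> r0 where \<Theta>: "is_prufer w a \<Theta>" "\<Theta> 0 = of_int j * pi" and r0: "\<And>t. r0 t > 0"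
    and U0: "\<And>t. U t = r0 t * sin (\<Theta> t)" and V0: "\<And>t. V t = w * (r0 t * cos (\<Theta> t))"
    by blast
  have "\<Theta> t = \<Phi> t + of_int j * pi" for t
    using prufer_eqI[OF w a \<Theta>(1), of t] prufer_shift[OF w a, of 0 j t] \<Theta>(2) by (simp add: \<Phi>_def)
  moreover define \<sigma> :: real where "\<sigma> = (if j = 0 then 1 else -1)"
  moreover have "j = 0 \<or> j = 1" by (simp add: j_def)
  ultimately have sc: "sin (\<Theta> t) = \<sigma> * sin (\<Phi> t)" "cos (\<Theta> t) = \<sigma> * cos (\<Phi> t)" for t
    by auto
  define r where "r = (\<lambda>t. \<sigma> * r0 t)"
  have r: "r t \<noteq> 0" "r t * r T > 0" for t using r0[of t] r0[of T] by (auto simp: r_def \<sigma>_def)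
  have U: "U t = r t * sin (\<Phi> t)" and V: "V t = r t * (w * cos (\<Phi> t))" for t
    using U0[of t] V0[of t] unfolding sc r_def by (simp_all add: mult_ac)
  note ac\<Phi> = \<Phi>(1)[unfolded is_prufer_def]
  have growth: "w * (y - x) \<le> \<Phi> y - \<Phi> x" if "0 \<le> x" "x \<le> y" "y \<le> T" for x y
  proof -
    have d: "ac (\<lambda>t. \<Phi> t - w * t) (\<lambda>t. (w * (cos (\<Phi> t))\<^sup>2 + a t / w * (sin (\<Phi> t))\<^sup>2) - w * 1)"
      by (intro ac_diff ac\<Phi> ac_cmul ac_ident)
    have "(w * (cos (\<Phi> t))\<^sup>2 + a t / w * (sin (\<Phi> t))\<^sup>2) - w * 1 = (a t - w\<^sup>2) / w * (sin (\<Phi> t))\<^sup>2" for t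
      unfolding cos_squared_eq using w by (simp add: field_simps power2_eq_square)
    then have "AE t in lebesgue. t \<in> {x..y} \<longrightarrow> 0 \<le> (w * (cos (\<Phi> t))\<^sup>2 + a t / w * (sin (\<Phi> t))\<^sup>2) - w * 1"
      by (intro eventually_mono[OF ge]) (use that w in simp)
    from ac_mono[OF d that(2) this] show ?thesis by (simp add: algebra_simps)
  qed
  have mono: "\<Phi> x < \<Phi> y" if "0 \<le> x" "x < y" "y \<le> T" for x y
    using growth[of x y] that mult_pos_pos[OF w, of "y - x"] by simp
  have mono_le: "\<Phi> x \<le> \<Phi> y" if "0 \<le> x" "x \<le> y" "y \<le> T" for x y
    using mono[of x y] that by (cases "x = y") auto
  have \<Phi>T: "w * T < \<Phi> T"
    using prufer_mono(2)[OF w T locint_const a ge neg, of 0] by (simp add: prufer_const[OF w] \<Phi>_def)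
  have wT: "w * T = 2 * pi * real n" using T by (simp add: w_def)
  have "sin (\<Phi> T) = 0" using ends(2) r(1)[of T] by (simp add: U)
  then obtain i :: int where i: "\<Phi> T = of_int i * pi" by (auto simp: sin_zero_iff_int2)
  have "2 * pi * real n < of_int i * pi" using \<Phi>T wT i by simp
  then have "pi * of_int (2 * int n) < pi * of_int i" by (simp add: mult_ac)
  then have i2: "2 * int n < i" by (simp add: mult_less_cancel_left_pos)
  define m where "m = nat i"
  have m: "\<Phi> T = real m * pi" "2 * n < m" using i i2 by (auto simp: m_def)
  \<comment> \<open>\<open>r\<close> keeps its sign, so equal slopes at both ends force
    \<open>cos (\<Phi> T) > 0\<close>, that is, an even number of half turns.\<close>
  have "r T * (w * cos (\<Phi> T)) = r 0 * (w * cos (\<Phi> 0))" using ends(3) by (simp add: V)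
  then have "r T * cos (\<Phi> T) = r 0" using w \<Phi>(2) by simp
  then have "r T * r T * cos (\<Phi> T) > 0" using r(2)[of 0] by (simp add: mult_ac)
  then have "cos (\<Phi> T) > 0" using r(1)[of T] by (simp add: zero_less_mult_iff not_less)
  then have ev: "even m" unfolding m(1) cos_npi by (cases "even m") auto
  then have m2: "m \<ge> 2 * (n + 1)" using m(2) by presburger
  have "\<exists>t. zero_listing T U V m t \<and> (\<forall>i\<le>2 * m. t i \<in> {0..T} \<and> \<Phi> (t i) = real i * (pi / 2))"
    by (rule zero_listing_of_angle[OF T is_prufer_cont[OF \<Phi>(1)] _ \<Phi>(2) m(1) U V r(1)]) (use mono w in blast)+
  then obtain t where zl: "zero_listing T U V m t" and t: "\<And>i. i \<le> 2 * m \<Longrightarrow> t i \<in> {0..T}"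
    "\<And>i. i \<le> 2 * m \<Longrightarrow> \<Phi> (t i) = real i * (pi / 2)"
    by blast
  have t0: "t 0 = 0" and tm: "t (2 * m) = T" using zl by (auto simp: zero_listing_def)
  have tless: "t i < t (i + 1)" if "i < 2 * m" for i
  proof (rule ccontr)
    assume "\<not> t i < t (i + 1)"
    then have "\<Phi> (t (i + 1)) \<le> \<Phi> (t i)"
      using mono[of "t (i + 1)" "t i"] t(1)[of i] t(1)[of "i + 1"] that by (cases "t i = t (i + 1)") auto
    then show False using t(2)[of i] t(2)[of "i + 1"] that by simp
  qed
  define x where "x = (\<lambda>i. w * (t (i + 1) - t i))"
  have x: "0 < x i" "x i \<le> pi / 2" if "i < 2 * m" for i
  proof -
    show "0 < x i" using tless[OF that] w by (simp add: x_def)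
    have "x i \<le> \<Phi> (t (i + 1)) - \<Phi> (t i)" unfolding x_def
      using t(1)[of i] t(1)[of "i + 1"] tless[OF that] that by (intro growth) auto
    then show "x i \<le> pi / 2" using t(2)[of i] t(2)[of "i + 1"] that by (simp add: algebra_simps add_divide_distrib)
  qed
  have wq: "T / (4 * real n) = (pi / 2) / w" using T n by (simp add: w_def)
  have xd: "t (i + 1) - t i = x i / w" for i using w by (simp add: x_def)
  have le: "t (i + 1) - t i \<le> T / (4 * real n)" if "i < 2 * m" for i
    unfolding wq xd using x(2)[OF that] w by (intro divide_right_mono) auto
  have sumx: "(\<Sum>i<2 * m. x i) = w * T"
    using sum_lessThan_telescope[of t "2 * m"] t0 tm by (simp add: x_def flip: sum_distrib_left)
  \<comment> \<open>If every piece had phase \<open>pi / 2\<close>, the phases would add up to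
    \<open>m * pi = \<Phi> T\<close>, yet their sum is \<open>w * T < \<Phi> T\<close>.\<close>
  have ex: "\<exists>i<2 * m. t (i + 1) - t i < T / (4 * real n)"
  proof (rule ccontr)
    assume no: "\<not> ?thesis"
    have "x i = pi / 2" if "i < 2 * m" for i
    proof -
      have "x i / w = pi / 2 / w" using no that le[OF that] unfolding wq xd by force
      then show ?thesis using w by (simp add: field_simps)
    qed
    then have "(\<Sum>i<2 * m. x i) = (\<Sum>i<2 * m. pi / 2)" by (intro sum.cong) auto
    then show False using sumx \<Phi>T m(1) by simp
  qed
  obtain B where B: "ac B (\<lambda>x. a x - w\<^sup>2)" using ac_primitive[OF locint_diff[OF a locint_const]] by blast
  have quarter: "w * cot (x i) \<le> B (t (i + 1)) - B (t i)"
    "\<not> negligible {x \<in> {t i..t (i + 1)}. w\<^sup>2 < a x} \<Longrightarrow> w * cot (x i) < B (t (i + 1)) - B (t i)" if i: "i < 2 * m" for i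
  proof -
    \<comment> \<open>Even pieces begin at a zero of \<open>U\<close>, odd pieces end at
      one.\<close>
    define z e where "z = (if even i then t i else t (i + 1))" and "e = (if even i then t (i + 1) else t i)"
    have ti: "t i \<in> {0..T}" "t (i + 1) \<in> {0..T}" "\<Phi> (t i) = real i * (pi / 2)" "\<Phi> (t (i + 1)) = real (i + 1) * (pi / 2)"
      by (rule t; use i in simp)+
    have ze: "z = t i \<and> e = t (i + 1) \<or> z = t (i + 1) \<and> e = t i" by (auto simp: z_def e_def)
    have "sin (\<Phi> z) = 0"
    proof (cases "even i")
      case True
      then have "z = t i" by (simp add: z_def)
      then show ?thesis using sin_cos_multiple_half_pi(1)[OF True] ti by (simp only:)
    next
      case False
      then have "z = t (i + 1)" "even (i + 1)" by (simp_all add: z_def)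
      then show ?thesis using sin_cos_multiple_half_pi(1)[of "i + 1"] ti by (simp only:)
    qed
    then have Uz: "U z = 0" by (simp add: U)
    have ce: "cos (\<Phi> e) = 0"
    proof (cases "even i")
      case True
      then have "e = t (i + 1)" "odd (i + 1)" by (simp_all add: e_def)
      then show ?thesis using sin_cos_multiple_half_pi(2)[of "i + 1"] ti by (simp only: not_False_eq_True)
    next
      case False
      then have "e = t i" by (simp add: e_def)
      then show ?thesis using sin_cos_multiple_half_pi(2)[OF False] ti by (simp only:)
    qed
    then have Ve: "V e = 0" by (simp add: V)
    have "sin (\<Phi> e) \<noteq> 0" using ce sin_zero_abs_cos_one[of "\<Phi> e"] by auto
    then have Ue: "U e \<noteq> 0" using r(1) by (simp add: U)
    have U2: "ac (\<lambda>t. U t * U t) (\<lambda>t. V t * U t + U t * V t)"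
      using s unfolding sol_def by (intro ac_mult) auto
    \<comment> \<open>The density of \<open>U^2\<close> has the sign of
      \<open>sin (2 \<Phi>)\<close>, which alternates from piece to piece; hence \<open>U^2\<close>
      increases towards the extremum \<open>e\<close>.\<close>
    have sgn: "0 \<le> (-1) ^ i * (V y * U y + U y * V y)" if y: "y \<in> {t i..t (i + 1)}" for y
    proof -
      have "\<Phi> (t i) \<le> \<Phi> y" "\<Phi> y \<le> \<Phi> (t (i + 1))"
        using y ti(1,2) by (auto intro!: mono_le)
      then have yb: "0 \<le> 2 * \<Phi> y - real i * pi" "2 * \<Phi> y - real i * pi \<le> pi" unfolding ti(3,4) by (simp_all add: algebra_simps)
      define v where "v = 2 * \<Phi> y - real i * pi"
      have "2 * \<Phi> y = v + real i * pi" by (simp add: v_def)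
      then have "sin (2 * \<Phi> y) = (-1) ^ i * sin v" by (simp only: sin_add cos_npi sin_npi) simp
      then have "(-1) ^ i * sin (2 * \<Phi> y) = sin v" by simp
      then have "0 \<le> (-1) ^ i * sin (2 * \<Phi> y)" using sin_ge_zero[OF yb] by (simp only: v_def)
      then have "0 \<le> (r y)\<^sup>2 * w * ((-1) ^ i * sin (2 * \<Phi> y))" using w by simp
      also have "\<dots> = (-1) ^ i * (V y * U y + U y * V y)"
        unfolding sin_double U V by (simp add: power2_eq_square algebra_simps)
      finally show ?thesis .
    qed
    have max: "(U y)\<^sup>2 \<le> (U e)\<^sup>2" if y: "y \<in> {t i..t (i + 1)}" for y
    proof (cases "even i")
      case True
      have "U y * U y \<le> U (t (i + 1)) * U (t (i + 1))"
        using y sgn True by (intro ac_mono[OF U2] AE_I2) auto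
      then show ?thesis using True by (simp add: e_def power2_eq_square)
    next
      case False
      have "- (U (t i) * U (t i)) \<le> - (U y * U y)"
        using y sgn False by (intro ac_mono[OF ac_uminus[OF U2]] AE_I2) auto
      then show ?thesis using False by (simp add: e_def power2_eq_square)
    qed
    have ge': "AE y in lebesgue. y \<in> {t i..t (i + 1)} \<longrightarrow> w\<^sup>2 \<le> a y"
      by (rule eventually_mono[OF ge]) (use ti in auto)
    note qw = quarter_wave[OF w s tless[OF i] x(2)[OF i, unfolded x_def] ze Uz Ve Ue max ge' B]
    show "w * cot (x i) \<le> B (t (i + 1)) - B (t i)"
      "\<not> negligible {x \<in> {t i..t (i + 1)}. w\<^sup>2 < a x} \<Longrightarrow> w * cot (x i) < B (t (i + 1)) - B (t i)"
      unfolding x_def by (rule qw; assumption)+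
  qed
  \<comment> \<open>One piece with a strict inequality makes the summed inequality strict.\<close>
  have "\<exists>i<2 * m. \<not> negligible {x \<in> {t i..t (i + 1)}. w\<^sup>2 < a x}"
  proof (rule ccontr)
    assume "\<not> ?thesis"
    then have "negligible (\<Union>i<2 * m. {x \<in> {t i..t (i + 1)}. w\<^sup>2 < a x})" by (intro negligible_Union) auto
    then have "negligible ((\<Union>i<2 * m. {x \<in> {t i..t (i + 1)}. w\<^sup>2 < a x}) \<union> {t 0})" by simp
    then have "negligible {x \<in> {0..T}. w\<^sup>2 < a x}"
    proof (rule negligible_subset)
      show "{x \<in> {0..T}. w\<^sup>2 < a x} \<subseteq> (\<Union>i<2 * m. {x \<in> {t i..t (i + 1)}. w\<^sup>2 < a x}) \<union> {t 0}"
      proof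
        fix y assume y: "y \<in> {x \<in> {0..T}. w\<^sup>2 < a x}"
        then have "y \<in> {t 0..t (2 * m)}" using t0 tm by simp
        from subsetD[OF interval_subset_UN this] y
        show "y \<in> (\<Union>i<2 * m. {x \<in> {t i..t (i + 1)}. w\<^sup>2 < a x}) \<union> {t 0}" by auto
      qed
    qed
    then show False using neg by blast
  qed
  then have "(\<Sum>i<2 * m. w * cot (x i)) < (\<Sum>i<2 * m. B (t (i + 1)) - B (t i))"
    using quarter by (intro sum_strict_mono_ex1) auto
  also have "\<dots> = B T - B 0"
    using sum_lessThan_telescope[of "\<lambda>i. B (t i)" "2 * m"] t0 tm by simp
  also have "\<dots> = integral {0..T} (\<lambda>x. a x - w\<^sup>2)" using ac_int[OF B, of 0 T] T by simp
  finally have up: "(\<Sum>i<2 * m. w * cot (x i)) < integral {0..T} (\<lambda>x. a x - w\<^sup>2)" .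
  have c: "0 < c" "c \<le> pi / 2" using n by (auto simp: c_def field_simps)
  have c4: "4 * (real n + 1) * c = w * T" unfolding wT by (simp add: c_def field_simps)
  have sc: "sin c > 0" "cos c \<ge> 0" using c by (auto intro!: sin_gt_zero cos_ge_zero)
  then have cot: "cot c \<ge> 0" by (simp add: cot_def)
  have "real (2 * (n + 1)) \<le> real m" using m2 by (simp only: of_nat_le_iff)
  then have m4: "4 * (real n + 1) \<le> real (2 * m)" by simp
  \<comment> \<open>Only for \<open>2 * m = 4 (n + 1)\<close> is \<open>c\<close> the mean phase.
    With more pieces the mean is smaller, the linear terms of the tangents have the favourable sign,
    and the larger number of terms only helps, as \<open>cot c \<ge> 0\<close>.\<close>
  have "w * T - real (2 * m) * c \<le> 0"
    using mult_right_mono[OF m4 less_imp_le[OF c(1)]] unfolding c4 by linarith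
  then have neg': "(w * T - real (2 * m) * c) / (sin c)\<^sup>2 \<le> 0" by (intro divide_nonpos_nonneg) auto
  have "4 * (real n + 1) * w * cot c \<le> w * (real (2 * m) * cot c)"
    using mult_right_mono[OF m4, of "w * cot c"] w cot by (simp add: mult_ac)
  also have "\<dots> \<le> w * (real (2 * m) * cot c - (w * T - real (2 * m) * c) / (sin c)\<^sup>2)"
    using w neg' by (intro mult_left_mono) linarith+
  also have "\<dots> = (\<Sum>i<2 * m. w * (cot c - (x i - c) / (sin c)\<^sup>2))"
    by (simp add: sum_subtractf sumx flip: sum_distrib_left sum_divide_distrib)
  also have "\<dots> \<le> (\<Sum>i<2 * m. w * cot (x i))"
    using w x by (intro sum_mono mult_left_mono cot_tangent c) auto
  finally have "4 * (real n + 1) * w * cot c < integral {0..T} (\<lambda>x. a x - w\<^sup>2)" using up by linarith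
  then show ?thesis using zl tless le ex ev m2 by blast
qed

section \<open>Translation and the lower bound for the norm\<close>

lemma locint_shift_arg:
  assumes "locint f" shows "locint (\<lambda>t. f (t + z))"
  unfolding locint_def
proof (intro allI)
  fix s t :: real
  have "f absolutely_integrable_on {s + z..t + z}" using assms by (simp add: locint_def)
  then have "f integrable_on {s + z..t + z}" "(\<lambda>x. norm (f x)) integrable_on {s + z..t + z}"
    by (auto simp: absolutely_integrable_on_def)
  from this[THEN integrable_shift_real_ivl, of z]
  show "(\<lambda>t. f (t + z)) absolutely_integrable_on {s..t}" by (simp add: absolutely_integrable_on_def)
qed

lemma locint_reflect:
  assumes "locint f" shows "locint (\<lambda>t. f (- t))"
  unfolding locint_def
proof (intro allI)
  fix s t :: real
  have "f absolutely_integrable_on {- t..- s}" using assms by (simp add: locint_def)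
  then show "(\<lambda>t. f (- t)) absolutely_integrable_on {s..t}"
    using absolutely_integrable_reflect_real[where f = f and a = "- t" and b = "- s"] by simp
qed

lemma ac_shift: "ac F f \<Longrightarrow> ac (\<lambda>t. F (t + z)) (\<lambda>t. f (t + z))"
proof (rule acI)
  assume F: "ac F f"
  show "locint (\<lambda>t. f (t + z))" by (rule locint_shift_arg[OF ac_locint[OF F]])
  fix s t :: real assume "s \<le> t"
  then show "((\<lambda>t. f (t + z)) has_integral F (t + z) - F (s + z)) {s..t}"
    using has_integral_shift_real_ivl[OF ac_has_int[OF F, of "s + z" "t + z"], of z] by simp
qed

lemma ac_reflect: "ac F f \<Longrightarrow> ac (\<lambda>t. F (z - t)) (\<lambda>t. - f (z - t))"
proof -
  assume F: "ac F f"
  have "ac (\<lambda>t. F (- t)) (\<lambda>t. - f (- t))"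
  proof (rule acI)
    show "locint (\<lambda>t. - f (- t))" by (intro locint_uminus locint_reflect ac_locint[OF F])
    fix s t :: real assume "s \<le> t"
    then have "(f has_integral F (- s) - F (- t)) {- t..- s}" by (intro ac_has_int[OF F]) simp
    then have "((\<lambda>x. f (- x)) has_integral F (- s) - F (- t)) {s..t}"
      using has_integral_reflect_real[of f "F (- s) - F (- t)" "- s" "- t"] by simp
    from has_integral_neg[OF this] show "((\<lambda>t. - f (- t)) has_integral F (- t) - F (- s)) {s..t}" by simp
  qed
  from ac_shift[OF this, of "- z"] show ?thesis by simp
qed

lemma sol_shift: "sol q u v \<Longrightarrow> sol (\<lambda>t. q (t + z)) (\<lambda>t. u (t + z)) (\<lambda>t. v (t + z))"
  unfolding sol_def using ac_shift[of u v z] ac_shift[of v "\<lambda>t. - q t * u t" z] by auto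

lemma sol_reflect: "sol q u v \<Longrightarrow> sol (\<lambda>t. q (z - t)) (\<lambda>t. u (z - t)) (\<lambda>t. - v (z - t))"
  unfolding sol_def using ac_reflect[of u v z] ac_uminus[OF ac_reflect[of v "\<lambda>t. - q t * u t" z]] by auto

lemma periodic_int:
  fixes f :: "real \<Rightarrow> 'a"
  assumes per: "\<And>t. f (t + T) = f t"
  shows "f (t + of_int k * T) = f t"
proof -
  have nat: "f (t + real n * T) = f t" for n t
  proof (induction n)
    case (Suc n)
    then show ?case using per[of "t + real n * T"] by (simp add: algebra_simps)
  qed simp
  show ?thesis
  proof (cases "k \<ge> 0")
    case True
    then show ?thesis using nat[of t "nat k"] by simp
  next
    case False
    then show ?thesis using nat[of "t + of_int k * T" "nat (- k)"] by simp
  qed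
qed

lemma locint_periodic:
  assumes T: "T > 0" and per: "\<And>t. f (t + T) = f t" and f: "f absolutely_integrable_on {0..T}"
  shows "locint f"
proof -
  have piece: "f absolutely_integrable_on {of_int k * T..of_int k * T + T}" for k :: int
  proof -
    have "f integrable_on {0..T}" "(\<lambda>x. norm (f x)) integrable_on {0..T}"
      using f by (auto simp: absolutely_integrable_on_def)
    from this[THEN integrable_shift_real_ivl, of "of_int (- k) * T"]
    show ?thesis unfolding periodic_int[of f, OF per] by (simp add: absolutely_integrable_on_def add.commute)
  qed
  have sym: "f absolutely_integrable_on {- (real n * T)..real n * T}" for n
  proof (induction n)
    case 0
    show ?case by (rule absolutely_integrable_on_subinterval[OF f]) (use T in auto)
  next
    case (Suc n)
    have "{- (real (Suc n) * T)..real (Suc n) * T} = ({of_int (- int (Suc n)) * T..of_int (- int (Suc n)) * T + T}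
      \<union> {- (real n * T)..real n * T}) \<union> {of_int (int n) * T..of_int (int n) * T + T}"
    proof -
      define y where "y = real n * T"
      have y: "y \<ge> 0" using T by (simp add: y_def)
      have e: "real (Suc n) * T = y + T" "of_int (- int (Suc n)) * T = - y - T" "of_int (int n) * T = y"
        by (simp_all add: y_def algebra_simps)
      show ?thesis unfolding e y_def[symmetric] using y T by auto
    qed
    moreover have "f absolutely_integrable_on \<dots>" by (intro absolutely_integrable_Un piece Suc)
    ultimately show ?case by (simp only:)
  qed
  show ?thesis unfolding locint_def
  proof (intro allI)
    fix s t :: real
    obtain n where n: "max \<bar>s\<bar> \<bar>t\<bar> < real n * T" using reals_Archimedean3[OF T] by blast
    show "f absolutely_integrable_on {s..t}"
      by (rule absolutely_integrable_on_subinterval[OF sym[of n]]) (use n in auto)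
  qed
qed

text \<open>Countably many translates of one period cover the line; the free base point
  \<open>z\<close> lets conditions almost everywhere pass to translated potentials.\<close>

lemma negligible_periodic:
  assumes T: "T > 0" and per: "\<And>t. P (t + T) = P t" and neg: "negligible {x \<in> {0..T}. P (x + z)}"
  shows "negligible {x::real. P x}"
proof -
  have "negligible (\<Union>k::int. (+) (z + of_int k * T) ` {x \<in> {0..T}. P (x + z)})"
    using negligible_translation[OF neg] by (intro negligible_countable_Union) blast+
  moreover have "{x. P x} \<subseteq> (\<Union>k::int. (+) (z + of_int k * T) ` {x \<in> {0..T}. P (x + z)})"
  proof
    fix x assume "x \<in> {x. P x}"
    define k where "k = \<lfloor>(x - z) / T\<rfloor>"
    define y where "y = x - z - of_int k * T"
    have "of_int k \<le> (x - z) / T" unfolding k_def by (rule of_int_floor_le)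
    then have 1: "0 \<le> y" using T by (simp add: y_def pos_le_divide_eq)
    have "(x - z) / T < of_int k + 1" unfolding k_def by (rule real_of_int_floor_add_one_gt)
    then have 2: "y \<le> T" using T by (simp add: y_def pos_divide_less_eq algebra_simps)
    have "P (y + z)" using \<open>x \<in> {x. P x}\<close> periodic_int[of P T x "- k", OF per] by (simp add: y_def)
    then show "x \<in> (\<Union>k::int. (+) (z + of_int k * T) ` {x \<in> {0..T}. P (x + z)})"
      using 1 2 by (intro UN_I[of k] image_eqI[of _ _ y]) (auto simp: y_def)
  qed
  ultimately show ?thesis by (rule negligible_subset)
qed

lemma ac_zero_const: "ac F (\<lambda>t. 0) \<Longrightarrow> F x = F y"
  using ac_int[of F "\<lambda>t. 0" x y] ac_int[of F "\<lambda>t. 0" y x] by (cases "x \<le> y") auto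

lemma ac_periodic_increment:
  assumes "ac B b" "\<And>t. b (t + T) = b t"
  shows "B (t + T) - B t = B (s + T) - B s"
  using ac_zero_const[of "\<lambda>t. B (t + T) - B t" t s] ac_diff[OF ac_shift[OF assms(1), of T] assms(1)] assms(2) by simp

text \<open>The set of strict inequality is measurable because \<open>a\<close> is, so positive
  measure and failure to be negligible coincide.\<close>

lemma ae_prec_const_iff:
  assumes T: "T > 0" and a: "locint a"
  shows "ae_prec T (\<lambda>_. c) a \<longleftrightarrow> (AE x in lebesgue. x \<in> {0..T} \<longrightarrow> c \<le> a x) \<and> \<not> negligible {x \<in> {0..T}. c < a x}"
proof -
  have "{x \<in> space (lebesgue_on {0..T}). c < a x} \<in> sets (lebesgue_on {0..T})"
    using locint_measurable[OF a, of 0 T] by measurable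
  then have "{x \<in> {0..T}. c < a x} \<in> sets lebesgue"
    by (auto simp: sets_restrict_space_iff space_restrict_space)
  then have "emeasure lebesgue {x \<in> {0..T}. c < a x} = 0 \<longleftrightarrow> negligible {x \<in> {0..T}. c < a x}"
    by (auto simp: negligible_iff_null_sets)
  then show ?thesis unfolding ae_prec_def using zero_less_iff_neq_zero by blast
qed

lemma L1_norm_eq:
  assumes T: "T > 0" and a: "locint a" and ge: "AE x in lebesgue. x \<in> {0..T} \<longrightarrow> 0 \<le> a x"
  shows "L1_norm T a = integral {0..T} a"
proof -
  have "set_integrable lebesgue {0..T} (\<lambda>t. \<bar>a t\<bar>)" using locint_abs[OF a] by (simp add: locint_def)
  then have "L1_norm T a = integral {0..T} (\<lambda>t. \<bar>a t\<bar>)"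
    unfolding L1_norm_def by (rule set_lebesgue_integral_eq_integral)
  also have "\<dots> = integral {0..T} a"
  proof (rule antisym)
    have i: "((\<lambda>t. \<bar>a t\<bar>) has_integral integral {0..T} (\<lambda>t. \<bar>a t\<bar>)) {0..T}" "(a has_integral integral {0..T} a) {0..T}"
      by (intro integrable_integral locint_integrable locint_abs a)+
    show "integral {0..T} (\<lambda>t. \<bar>a t\<bar>) \<le> integral {0..T} a"
      by (rule has_integral_mono_AE[OF i]) (use ge in \<open>auto elim!: eventually_mono\<close>)
    show "integral {0..T} a \<le> integral {0..T} (\<lambda>t. \<bar>a t\<bar>)"
      by (rule has_integral_mono_AE[OF i(2,1)]) auto
  qed
  finally show ?thesis .
qed

lemma L_per_locint: "T > 0 \<Longrightarrow> a \<in> L_per T \<Longrightarrow> locint a"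
  unfolding L_per_def by (intro locint_periodic) auto

lemma Lambda_setD:
  assumes T: "T > 0" and n: "n \<ge> 1" and a: "a \<in> Lambda_set T n"
  shows "locint a" "\<And>t. a (t + T) = a t"
    "AE x in lebesgue. x \<in> {0..T} \<longrightarrow> (2 * pi * real n / T)\<^sup>2 \<le> a x"
    "\<not> negligible {x \<in> {0..T}. (2 * pi * real n / T)\<^sup>2 < a x}"
proof -
  show l: "locint a" using a L_per_locint[OF T] by (auto simp: Lambda_set_def)
  show "\<And>t. a (t + T) = a t" using a by (auto simp: Lambda_set_def L_per_def)
  have "ae_prec T (\<lambda>_. (2 * pi * real n / T)\<^sup>2) a"
    using a unfolding Lambda_set_def eig0_eq[OF T n] by blast
  then show "AE x in lebesgue. x \<in> {0..T} \<longrightarrow> (2 * pi * real n / T)\<^sup>2 \<le> a x"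
    "\<not> negligible {x \<in> {0..T}. (2 * pi * real n / T)\<^sup>2 < a x}"
    unfolding ae_prec_const_iff[OF T l] by blast+
qed

lemma nontrivial_initial_data:
  assumes T: "T > 0" and q: "locint q" and s: "sol q U V" and nt: "nontrivial_on T u"
    and eq: "\<And>t. t \<in> {0..T} \<Longrightarrow> U t = u t"
  shows "U x \<noteq> 0 \<or> V x \<noteq> 0"
proof -
  obtain t where "t \<in> {0..T}" "u t \<noteq> 0" using nt by (auto simp: nontrivial_on_def)
  then have "U t \<noteq> 0" using eq by simp
  then show ?thesis using sol_zero(1)[OF q s, of x t] by blast
qed

lemma periodic_sol:
  assumes q: "locint q" and per: "\<And>t. q (t + T) = q t" and s: "sol q U V" and ends: "U T = U 0" "V T = V 0"
  shows "U (t + T) = U t" "V (t + T) = V t"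
  using sol_unique[OF q sol_shift[OF s, of T, unfolded per] s, of 0] ends by auto

text \<open>Membership in \<open>Lambda_set\<close> does not provide a zero at the end points; the
  angle gains at least \<open>w * T \<ge> \<pi>\<close> and therefore passes a multiple of
  \<pi>.\<close>

lemma sol_has_zero:
  assumes T: "T > 0" and w: "w > 0" and wT: "w * T \<ge> pi" and q: "locint q"
    and ge: "AE x in lebesgue. x \<in> {0..T} \<longrightarrow> w\<^sup>2 \<le> q x"
    and s: "sol q U V" and nz: "U 0 \<noteq> 0 \<or> V 0 \<noteq> 0"
  shows "\<exists>z. U z = 0"
proof -
  have "U 0 \<noteq> 0 \<or> V 0 / w \<noteq> 0" using nz w by auto
  then obtain \<rho> \<theta> where p: "\<rho> > 0" "U 0 = \<rho> * sin \<theta>" "V 0 / w = \<rho> * cos \<theta>" using polar_real by metis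
  then have "V 0 = w * (\<rho> * cos \<theta>)" using w by (simp add: field_simps)
  then have "\<exists>\<Theta> r. is_prufer w q \<Theta> \<and> \<Theta> 0 = \<theta> \<and> (\<forall>t. U t = r t * sin (\<Theta> t))"
    by (rule sol_prufer[OF w q s p(2) _ p(1)]) blast
  then obtain \<Theta> r where \<Theta>: "is_prufer w q \<Theta>" "\<Theta> 0 = \<theta>" and U: "\<And>t. U t = r t * sin (\<Theta> t)" by blast
  have "\<theta> + w * T \<le> \<Theta> T"
    using prufer_mono(1)[OF w T locint_const q ge, of \<theta>] prufer_eqI[OF w q \<Theta>(1), of T] \<Theta>(2)
    by (simp add: prufer_const[OF w])
  then have up: "\<theta> + pi \<le> \<Theta> T" using wT by simp
  obtain k where k: "\<theta> \<le> 0 + of_int k * pi" "0 + of_int k * pi < \<theta> + pi" by (rule reduce_pi)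
  have "\<exists>z. 0 \<le> z \<and> z \<le> T \<and> \<Theta> z = of_int k * pi"
    by (rule IVT') (use k up \<Theta>(2) T continuous_on_subset[OF is_prufer_cont[OF \<Theta>(1)]] in auto)
  then obtain z where "\<Theta> z = of_int k * pi" by blast
  then have "U z = 0" unfolding U by (simp add: mult.commute[of "of_int k"])
  then show ?thesis by blast
qed

text \<open>Translating by a zero of the solution reduces to functions vanishing at both ends; by
  periodicity neither the hypotheses on the potential nor its integral over a period change.\<close>

lemma Lambda_norm_gt:
  assumes T: "T > 0" and n: "n \<ge> 1" and aL: "a \<in> Lambda_set T n"
  shows "T * (2 * pi * real n / T)\<^sup>2 + 8 * pi * real n * (real n + 1) / T * cot (real n * pi / (2 * (real n + 1))) < L1_norm T a"
proof -
  define w where "w = 2 * pi * real n / T"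
  have w: "w > 0" using T n by (simp add: w_def)
  note a = Lambda_setD[OF T n aL, folded w_def]
  obtain u u' where u: "periodic_solution T a u u'" "nontrivial_on T u" using aL by (auto simp: Lambda_set_def)
  obtain U V where s: "sol a U V" and eq: "\<And>t. t \<in> {0..T} \<Longrightarrow> U t = u t" "\<And>t. t \<in> {0..T} \<Longrightarrow> V t = u' t"
    using periodic_solution_global[OF T a(1) u(1)] by metis
  have ends: "U T = U 0" "V T = V 0" using u(1) eq T by (simp_all add: periodic_solution_def)
  note per = periodic_sol[OF a(1,2) s ends]
  note nz = nontrivial_initial_data[OF T a(1) s u(2) eq(1)]
  have "pi * 1 \<le> pi * (2 * real n)" using n by (intro mult_left_mono) auto
  then have "w * T \<ge> pi" using T by (simp add: w_def mult_ac)
  then obtain z where z: "U z = 0" using sol_has_zero[OF T w _ a(1,3) s nz] by blast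
  let ?a = "\<lambda>t. a (t + z)"
  have ge: "AE x in lebesgue. x \<in> {0..T} \<longrightarrow> w\<^sup>2 \<le> ?a x"
  proof -
    have "{x. \<not> (x \<in> {0..T} \<longrightarrow> w\<^sup>2 \<le> a x)} = {x \<in> {0..T}. a (x + 0) < w\<^sup>2}" by auto
    with a(3) have "negligible {x \<in> {0..T}. a (x + 0) < w\<^sup>2}" unfolding AE_lebesgue_iff by simp
    then have "negligible {x. a x < w\<^sup>2}" by (rule negligible_periodic[OF T, rotated]) (simp add: a(2))
    then have "negligible ((+) (- z) ` {x. a x < w\<^sup>2})" by (rule negligible_translation)
    then show ?thesis unfolding AE_lebesgue_iff
    proof (rule negligible_subset)
      show "{x. \<not> (x \<in> {0..T} \<longrightarrow> w\<^sup>2 \<le> ?a x)} \<subseteq> (+) (- z) ` {x. a x < w\<^sup>2}"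
      proof
        fix x assume "x \<in> {x. \<not> (x \<in> {0..T} \<longrightarrow> w\<^sup>2 \<le> ?a x)}"
        then show "x \<in> (+) (- z) ` {x. a x < w\<^sup>2}" by (intro image_eqI[of _ _ "x + z"]) auto
      qed
    qed
  qed
  have neg: "\<not> negligible {x \<in> {0..T}. w\<^sup>2 < ?a x}"
  proof
    assume "negligible {x \<in> {0..T}. w\<^sup>2 < ?a x}"
    then have "negligible {x. w\<^sup>2 < a x}" by (rule negligible_periodic[OF T, rotated]) (simp add: a(2))
    then have "negligible {x \<in> {0..T}. w\<^sup>2 < a x}" by (rule negligible_subset) auto
    then show False using a(4) by blast
  qed
  have ends': "U (0 + z) = 0" "U (T + z) = 0" "V (T + z) = V (0 + z)" "V (0 + z) \<noteq> 0"
    using per[of z] z nz[of z] by (simp_all add: add.commute[of T z])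
  have less: "4 * (real n + 1) * w * cot (real n * pi / (2 * (real n + 1))) < integral {0..T} (\<lambda>x. ?a x - w\<^sup>2)"
    using sol_vanishing_at_ends[OF T n, folded w_def, OF locint_shift_arg[OF a(1), of z] ge neg sol_shift[OF s, of z] ends'] by blast
  obtain B where B: "ac B (\<lambda>x. a x - w\<^sup>2)" using ac_primitive[OF locint_diff[OF a(1) locint_const]] by blast
  have "integral {0..T} (\<lambda>x. ?a x - w\<^sup>2) = B (z + T) - B z"
    using ac_int[OF ac_shift[OF B, of z], of 0 T] T by (simp add: add.commute)
  also have "\<dots> = B T - B 0" using ac_periodic_increment[OF B, of T z 0] a(2) by simp
  also have "\<dots> = integral {0..T} (\<lambda>x. a x - w\<^sup>2)" using ac_int[OF B, of 0 T] T by simp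
  also have "\<dots> = integral {0..T} a - T * w\<^sup>2"
    using T by (subst integral_diff) (auto intro: locint_integrable a(1))
  also have "integral {0..T} a = L1_norm T a"
    using a(3) by (intro L1_norm_eq[symmetric] T a(1)) (auto elim!: eventually_mono intro: order_trans[OF zero_le_power2])
  finally have norm: "4 * (real n + 1) * w * cot (real n * pi / (2 * (real n + 1))) < L1_norm T a - T * w\<^sup>2" using less by simp
  \<comment> \<open>The factor of the cotangent: \<open>4 (n + 1)\<close> quarter waves of frequency
    \<open>w = 2 n \<pi> / T\<close>.\<close>
  have eq: "4 * (real n + 1) * w = 8 * pi * real n * (real n + 1) / T" using T by (simp add: w_def field_simps)
  show ?thesis using norm[unfolded eq] unfolding w_def by linarith
qed

section \<open>Almost optimal potentials and the theorem\<close>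

lemma L_perI:
  assumes "\<And>t. a (t + T) = a t" "locint a"
  shows "a \<in> L_per T"
  using assms by (auto simp: L_per_def locint_def)

lemma Lambda_setI:
  assumes T: "T > 0" and n: "n \<ge> 1" and a: "a \<in> L_per T"
    and prec: "ae_prec T (\<lambda>_. (2 * pi * real n / T)\<^sup>2) a"
    and s: "sol a U V" and ends: "U T = U 0" "V T = V 0" and nz: "U 0 \<noteq> 0 \<or> V 0 \<noteq> 0"
  shows "a \<in> Lambda_set T n" "periodic_solution T a U V" "nontrivial_on T U"
proof -
  show p: "periodic_solution T a U V" by (rule periodic_solution_of_sol[OF T s ends]) auto
  show nt: "nontrivial_on T U"
    unfolding nontrivial_on_def using sol_zero_on_interval[OF T L_per_locint[OF T a] s, of 0] nz by blast
  show "a \<in> Lambda_set T n"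
    unfolding Lambda_set_def eig0_eq[OF T n] using a prec p nt by blast
qed

lemma ae_prec_const: "T > 0 \<Longrightarrow> c < d \<Longrightarrow> ae_prec T (\<lambda>_. c) (\<lambda>_. d)"
  using not_negligible_interval[of T] by (simp add: ae_prec_const_iff atLeastAtMost_def atLeast_def atMost_def Int_def)

text \<open>Constant potentials suffice: \<open>sin (k t)\<close> with
  \<open>k = m \<pi> / T\<close> is periodic since \<open>m\<close> is even, and
  \<open>m > 2 n\<close> puts the constant above \<open>(2 n \<pi> / T)^2\<close>.\<close>

lemma every_even_value_occurs:
  assumes T: "T > 0" and n: "n \<ge> 1" and m: "even m" "m \<ge> 2 * (n + 1)"
  shows "\<exists>a\<in>Lambda_set T n. \<exists>u u' t. periodic_solution T a u u' \<and> nontrivial_on T u \<and>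
     u 0 = 0 \<and> u T = 0 \<and> zero_listing T u u' m t"
proof -
  define k where "k = real m * pi / T"
  have "m > 0" using m(2) by simp
  then have m0: "real m > 0" by simp
  have k: "k > 0" using m0 T by (simp add: k_def)
  have kT: "k * T = real m * pi" using T by (simp add: k_def)
  \<comment> \<open>The instance of \<open>sol_const\<close> with value \<open>0\<close> and slope
    \<open>k\<close> at \<open>0\<close>.\<close>
  define u v where "u = (\<lambda>t. 0 * cos (k * (t - 0)) + k / k * sin (k * (t - 0)))"
    and "v = (\<lambda>t. k * cos (k * (t - 0)) - 0 * k * sin (k * (t - 0)))"
  have s: "sol (\<lambda>_. k\<^sup>2) u v" unfolding u_def v_def by (rule sol_const) (use k in simp)
  have u: "u t = 1 * sin (k * t)" and v: "v t = 1 * (k * cos (k * t))" for t using k by (simp_all add: u_def v_def)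
  have "sin (k * T) = 0" "cos (k * T) = 1" unfolding kT using m(1) by simp_all
  then have ends: "u T = u 0" "v T = v 0" "u 0 = 0" "v 0 \<noteq> 0" using k by (simp_all add: u v)
  have "2 * pi * real n < pi * real m" using m(2) by simp
  then have "2 * pi * real n / T < k" unfolding k_def using T by (intro divide_strict_right_mono) (simp_all add: mult.commute)
  then have "(2 * pi * real n / T)\<^sup>2 < k\<^sup>2" using T by (intro power_strict_mono) auto
  then have prec: "ae_prec T (\<lambda>_. (2 * pi * real n / T)\<^sup>2) (\<lambda>_. k\<^sup>2)" by (rule ae_prec_const[OF T])
  have L: "(\<lambda>_. k\<^sup>2) \<in> L_per T" by (rule L_perI) auto
  have "\<exists>t. zero_listing T u v m t"
    by (rule zero_listing_of_angle[where \<Phi> = "\<lambda>t. k * t" and r = "\<lambda>_. 1" and c = k and m = m and u = u and v = v, OF T])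
      (use k kT u v in \<open>auto intro!: continuous_intros\<close>)
  then show ?thesis
    using Lambda_setI[OF T n L prec s ends(1,2)] ends by auto
qed

text \<open>
  An almost optimal potential: on the distance \<open>\<delta>\<close> to the lattice \<open>2 L \<int>\<close> of zeros it equals
  \<open>w\<^sup>2\<close> up to \<open>L - \<epsilon>\<close>, so that the solution is \<open>sin (w \<delta>)\<close> there; near the extremum the
  solution is continued by a parabola \<open>A - B (L - \<delta>)\<^sup>2\<close>, whose potential is \<open>2 B / (A - B (L - \<delta>)\<^sup>2)\<close>.
\<close>

context
  fixes L w \<epsilon> :: real
  assumes L: "L > 0" and w: "w > 0" and wL: "w * L < pi / 2" and \<epsilon>: "0 < \<epsilon>" "\<epsilon> < L"
    and small: "w * \<epsilon> * (1 + w * \<epsilon> / 2) \<le> cos (w * L)"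
begin

text \<open>The slope \<open>2 * pB * \<epsilon>\<close> of the parabola at
  \<open>L - \<epsilon>\<close> equals that of the sine; \<open>pA\<close> then matches the values,
  so the two arcs join differentiably.\<close>

definition "pB = w * cos (w * (L - \<epsilon>)) / (2 * \<epsilon>)"

definition "pA = sin (w * (L - \<epsilon>)) + pB * \<epsilon>\<^sup>2"

text \<open>A triangular wave: continuity, period \<open>2 * L\<close> and symmetry about
  \<open>L\<close> are inherited from the cosine.\<close>

definition "lattice_dist t = L / pi * arccos (cos (pi * t / L))"

definition "potential t =
  (if lattice_dist t < L - \<epsilon> then w\<^sup>2 else 2 * pB / (pA - pB * (L - lattice_dist t)\<^sup>2))"

lemma phase: "0 < w * (L - \<epsilon>)" "w * (L - \<epsilon>) \<le> w * L"
  using w \<epsilon> by auto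

lemma sin_phase: "sin (w * (L - \<epsilon>)) > 0"
  using phase wL by (intro sin_gt_zero) auto

lemma cos_phase: "cos (w * L) \<le> cos (w * (L - \<epsilon>))" "cos (w * (L - \<epsilon>)) > 0"
proof -
  show "cos (w * L) \<le> cos (w * (L - \<epsilon>))"
    using phase wL by (intro cos_monotone_0_pi_le) auto
  show "cos (w * (L - \<epsilon>)) > 0" using phase wL by (intro cos_gt_zero) auto
qed

lemma pB_pos: "pB > 0"
  using cos_phase w \<epsilon> by (simp add: pB_def)

lemma lattice_dist_bounds: "0 \<le> lattice_dist t" "lattice_dist t \<le> L"
proof -
  have "0 \<le> arccos (cos (pi * t / L))" "arccos (cos (pi * t / L)) \<le> pi"
    by (auto intro: arccos_lbound arccos_ubound)
  then show "0 \<le> lattice_dist t" "lattice_dist t \<le> L"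
    using L mult_left_mono[of "arccos (cos (pi * t / L))" pi "L / pi"] by (auto simp: lattice_dist_def)
qed

lemma lattice_dist_eq: "0 \<le> t \<Longrightarrow> t \<le> L \<Longrightarrow> lattice_dist t = t"
  using L by (simp add: lattice_dist_def arccos_cos divide_le_eq)

lemma potential_sym: "potential (t + 2 * L) = potential t" "potential (2 * L - t) = potential t"
proof -
  have "pi * (t + 2 * L) / L = pi * t / L + 2 * pi" "pi * (2 * L - t) / L = 2 * pi - pi * t / L"
    using L by (auto simp: field_simps)
  then have "lattice_dist (t + 2 * L) = lattice_dist t" "lattice_dist (2 * L - t) = lattice_dist t"
    by (simp_all add: lattice_dist_def cos_diff)
  then show "potential (t + 2 * L) = potential t" "potential (2 * L - t) = potential t"
    by (simp_all add: potential_def)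
qed

lemma parabola_bounds:
  assumes "L - \<epsilon> \<le> x" "x \<le> L"
  shows "sin (w * (L - \<epsilon>)) \<le> pA - pB * (L - x)\<^sup>2" "pA - pB * (L - x)\<^sup>2 \<le> pA"
proof -
  have "(L - x)\<^sup>2 \<le> \<epsilon>\<^sup>2" using assms by (intro power_mono) auto
  then have "pB * (L - x)\<^sup>2 \<le> pB * \<epsilon>\<^sup>2" using pB_pos by (intro mult_left_mono) auto
  then show "sin (w * (L - \<epsilon>)) \<le> pA - pB * (L - x)\<^sup>2" by (simp add: pA_def)
  show "pA - pB * (L - x)\<^sup>2 \<le> pA" using pB_pos by simp
qed

text \<open>On the parabolic part the lower bound follows from \<open>w^2 * pA \<le> 2 * pB\<close>.
  Since \<open>2 * pB * \<epsilon>\<close> is \<open>w * cos (w * (L - \<epsilon>))\<close> and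
  \<open>pA \<le> 1 + w * \<epsilon> / 2\<close>, this is the purpose of
  \<open>small\<close>.\<close>

lemma potential_bounds: "w\<^sup>2 \<le> potential t" "potential t \<le> w\<^sup>2 + 2 * pB / sin (w * (L - \<epsilon>))"
proof -
  let ?d = "lattice_dist t"
  have q0: "0 < 2 * pB / sin (w * (L - \<epsilon>))" using pB_pos sin_phase by simp
  have "w\<^sup>2 \<le> potential t \<and> potential t \<le> w\<^sup>2 + 2 * pB / sin (w * (L - \<epsilon>))"
  proof (cases "?d < L - \<epsilon>")
    case True
    then show ?thesis using q0 by (simp add: potential_def)
  next
    case False
    then have b: "sin (w * (L - \<epsilon>)) \<le> pA - pB * (L - ?d)\<^sup>2" "pA - pB * (L - ?d)\<^sup>2 \<le> pA"
      using parabola_bounds[of ?d] lattice_dist_bounds[of t] by auto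
    have pos: "0 < pA - pB * (L - ?d)\<^sup>2" using b(1) sin_phase by linarith
    have Be: "pB * \<epsilon>\<^sup>2 = w * \<epsilon> * cos (w * (L - \<epsilon>)) / 2" "pB * 2 * \<epsilon> = w * cos (w * (L - \<epsilon>))"
      using \<epsilon> by (auto simp: pB_def power2_eq_square)
    have "pA \<le> 1 + w * \<epsilon> / 2"
      unfolding pA_def Be(1) using w \<epsilon> by (intro add_mono) (auto simp: mult_left_le)
    then have "w * (pA * w * \<epsilon>) \<le> w * ((1 + w * \<epsilon> / 2) * w * \<epsilon>)"
      using w \<epsilon> by (intro mult_left_mono mult_right_mono) auto
    also have "\<dots> \<le> w * cos (w * L)" using small w by (simp add: mult_ac)
    also have "\<dots> \<le> w * cos (w * (L - \<epsilon>))" using cos_phase w by simp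
    finally have "\<epsilon> * (w\<^sup>2 * pA) \<le> \<epsilon> * (2 * pB)" unfolding Be(2)[symmetric] by (simp add: mult_ac power2_eq_square)
    then have "w\<^sup>2 * pA \<le> 2 * pB" using \<epsilon> by simp
    moreover have "w\<^sup>2 * (pA - pB * (L - ?d)\<^sup>2) \<le> w\<^sup>2 * pA" using b(2) by (intro mult_left_mono) auto
    ultimately have "w\<^sup>2 \<le> 2 * pB / (pA - pB * (L - ?d)\<^sup>2)" using pos by (simp add: pos_le_divide_eq)
    moreover have "2 * pB / (pA - pB * (L - ?d)\<^sup>2) \<le> 2 * pB / sin (w * (L - \<epsilon>))"
      using b(1) sin_phase pB_pos by (intro divide_left_mono) auto
    moreover have "2 * pB / sin (w * (L - \<epsilon>)) \<le> w\<^sup>2 + 2 * pB / sin (w * (L - \<epsilon>))" by simp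
    moreover have "potential t = 2 * pB / (pA - pB * (L - ?d)\<^sup>2)" using False by (simp add: potential_def)
    ultimately show ?thesis by linarith
  qed
  then show "w\<^sup>2 \<le> potential t" "potential t \<le> w\<^sup>2 + 2 * pB / sin (w * (L - \<epsilon>))" by auto
qed

lemma locint_potential: "locint potential"
proof -
  have "continuous_on UNIV lattice_dist"
    unfolding lattice_dist_def using L by (intro continuous_intros) auto
  then have [measurable]: "lattice_dist \<in> borel_measurable borel" by (rule borel_measurable_continuous_onI)
  have "potential \<in> borel_measurable borel" unfolding potential_def by measurable
  moreover have "\<bar>potential t\<bar> \<le> w\<^sup>2 + 2 * pB / sin (w * (L - \<epsilon>))" for t
    using potential_bounds[of t] zero_le_power2[of w] by linarith
  then have "bounded (potential ` S)" for S by (auto simp: bounded_iff)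
  ultimately have "locint (\<lambda>t. potential t * 1)" by (intro locint_mult) auto
  then show ?thesis by simp
qed

text \<open>Uniqueness, applied first to the sine and then to the parabola, gives
  \<open>V L = 0\<close>. Reflection at \<open>L\<close> therefore fixes the solution, and
  translation by the arch \<open>2 * L\<close> turns it into its negative.\<close>

lemma potential_sol:
  assumes s: "sol potential U V" and init: "U 0 = 0" "V 0 = w"
  shows "U (t + 2 * L) = - U t" "V (t + 2 * L) = - V t" "V L = 0"
proof -
  note q = locint_potential
  have ac: "ac U V" "ac V (\<lambda>t. - potential t * U t)" using s by (auto simp: sol_def)
  have sn: "ac (\<lambda>t. sin (w * t)) (\<lambda>t. w * cos (w * t))"
    by (rule deriv_ac) (auto intro!: derivative_eq_intros continuous_intros)
  have cs: "ac (\<lambda>t. w * cos (w * t)) (\<lambda>t. - w\<^sup>2 * sin (w * t))"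
    by (rule deriv_ac) (auto intro!: derivative_eq_intros continuous_intros simp: power2_eq_square)
  have ne: "AE x in lebesgue. x \<noteq> L - \<epsilon>" by (auto simp: AE_lebesgue_iff)
  have "U (L - \<epsilon>) - sin (w * (L - \<epsilon>)) = 0 \<and> V (L - \<epsilon>) - w * cos (w * (L - \<epsilon>)) = 0"
  proof (rule ac_energy_zero_on[OF ac_diff[OF ac(1) sn] ac_diff[OF ac(2) cs] q, of 0 "L - \<epsilon>" 0])
    show "AE x in lebesgue. x \<in> {0..L - \<epsilon>} \<longrightarrow> - potential x * U x - - w\<^sup>2 * sin (w * x) = - potential x * (U x - sin (w * x))"
      using ne by eventually_elim (use \<epsilon> in \<open>auto simp: potential_def lattice_dist_eq algebra_simps\<close>)
  qed (use init \<epsilon> in auto)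
  then have mid: "U (L - \<epsilon>) = sin (w * (L - \<epsilon>))" "V (L - \<epsilon>) = w * cos (w * (L - \<epsilon>))" by auto
  have p1: "ac (\<lambda>t. pA - pB * (L - t)\<^sup>2) (\<lambda>t. 2 * pB * (L - t))"
    by (rule deriv_ac) (auto intro!: derivative_eq_intros continuous_intros simp: algebra_simps)
  have p2: "ac (\<lambda>t. 2 * pB * (L - t)) (\<lambda>t. - 2 * pB)"
    by (rule deriv_ac) (auto intro!: derivative_eq_intros continuous_intros)
  have "U L - (pA - pB * (L - L)\<^sup>2) = 0 \<and> V L - 2 * pB * (L - L) = 0"
  proof (rule ac_energy_zero_on[OF ac_diff[OF ac(1) p1] ac_diff[OF ac(2) p2] q, of "L - \<epsilon>" L "L - \<epsilon>"])
    show "AE x in lebesgue. x \<in> {L - \<epsilon>..L} \<longrightarrow> - potential x * U x - - 2 * pB = - potential x * (U x - (pA - pB * (L - x)\<^sup>2))"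
    proof (intro AE_I2 impI)
      fix x assume x: "x \<in> {L - \<epsilon>..L}"
      have "pA - pB * (L - x)\<^sup>2 > 0" using parabola_bounds[of x] sin_phase x by auto
      moreover have "potential x = 2 * pB / (pA - pB * (L - x)\<^sup>2)" using x \<epsilon> by (simp add: potential_def lattice_dist_eq)
      ultimately have "potential x * (pA - pB * (L - x)\<^sup>2) = 2 * pB" by simp
      then show "- potential x * U x - - 2 * pB = - potential x * (U x - (pA - pB * (L - x)\<^sup>2))"
        by (simp only: right_diff_distrib)
    qed
    show "U (L - \<epsilon>) - (pA - pB * (L - (L - \<epsilon>))\<^sup>2) = 0" "V (L - \<epsilon>) - 2 * pB * (L - (L - \<epsilon>)) = 0"
      unfolding mid using \<epsilon> by (simp_all add: pA_def pB_def)
  qed (use \<epsilon> in auto)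
  then show VL: "V L = 0" by simp
  have "sol potential (\<lambda>t. U (2 * L - t)) (\<lambda>t. - V (2 * L - t))"
    using sol_reflect[OF s, of "2 * L"] by (simp only: potential_sym)
  from sol_unique[OF q this s, of L] VL have refl: "U (2 * L - t) = U t" "- V (2 * L - t) = V t" for t by auto
  have "sol potential (\<lambda>t. U (t + 2 * L)) (\<lambda>t. V (t + 2 * L))"
    using sol_shift[OF s, of "2 * L"] by (simp only: potential_sym)
  from sol_lincomb[OF this this, of "-1" 0]
  have "sol potential (\<lambda>t. - U (t + 2 * L)) (\<lambda>t. - V (t + 2 * L))" by simp
  from sol_unique[OF q this s, of 0 t] refl[of 0] init
  show "U (t + 2 * L) = - U t" "V (t + 2 * L) = - V t" by auto
qed

text \<open>The parabolic part costs at most its height bound times \<open>\<epsilon>\<close>, and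
  \<open>pB\<close> makes this \<open>w * cot (w * (L - \<epsilon>))\<close>; as
  \<open>\<epsilon>\<close> tends to \<open>0\<close>, equality in the quarter-wave estimate is
  approached.\<close>

lemma potential_integral: "integral {0..real k * (2 * L)} potential \<le> real (2 * k) * (w\<^sup>2 * L + w * cot (w * (L - \<epsilon>)))"
proof -
  obtain P where P: "ac P potential" using ac_primitive[OF locint_potential] by blast
  have "P (L - \<epsilon>) - P 0 = w\<^sup>2 * (L - \<epsilon>)"
  proof -
    have "((\<lambda>x. w\<^sup>2) has_integral P (L - \<epsilon>) - P 0) {0..L - \<epsilon>}"
      by (rule has_integral_spike[OF negligible_sing[of "L - \<epsilon>"] _ ac_has_int[OF P]])
        (use \<epsilon> in \<open>auto simp: potential_def lattice_dist_eq\<close>)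
    moreover have "((\<lambda>x. w\<^sup>2) has_integral w\<^sup>2 * (L - \<epsilon>)) {0..L - \<epsilon>}"
      using has_integral_const_real[of "w\<^sup>2" 0 "L - \<epsilon>"] \<epsilon> by (simp add: mult.commute)
    ultimately show ?thesis by (rule has_integral_unique)
  qed
  moreover have "P L - P (L - \<epsilon>) \<le> w * cot (w * (L - \<epsilon>))"
  proof -
    have "P L - P (L - \<epsilon>) \<le> 2 * pB / sin (w * (L - \<epsilon>)) * \<epsilon>"
    proof (rule has_integral_le)
      show "(potential has_integral P L - P (L - \<epsilon>)) {L - \<epsilon>..L}" using ac_has_int[OF P] \<epsilon> by simp
      show "((\<lambda>x. 2 * pB / sin (w * (L - \<epsilon>))) has_integral 2 * pB / sin (w * (L - \<epsilon>)) * \<epsilon>) {L - \<epsilon>..L}"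
        using has_integral_const_real[of "2 * pB / sin (w * (L - \<epsilon>))" "L - \<epsilon>" L] \<epsilon> by (simp add: mult.commute)
      fix x assume x: "x \<in> {L - \<epsilon>..L}"
      then have "potential x = 2 * pB / (pA - pB * (L - x)\<^sup>2)" using \<epsilon> by (simp add: potential_def lattice_dist_eq)
      also have "\<dots> \<le> 2 * pB / sin (w * (L - \<epsilon>))"
        using parabola_bounds[of x] x sin_phase pB_pos by (intro divide_left_mono) auto
      finally show "potential x \<le> 2 * pB / sin (w * (L - \<epsilon>))" .
    qed
    also have "\<dots> = w * cot (w * (L - \<epsilon>))" using \<epsilon> by (simp add: pB_def cot_def)
    finally show ?thesis .
  qed
  moreover have "w\<^sup>2 * (L - \<epsilon>) \<le> w\<^sup>2 * L" using \<epsilon> by (intro mult_left_mono) auto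
  ultimately have quarter: "P L - P 0 \<le> w\<^sup>2 * L + w * cot (w * (L - \<epsilon>))" by linarith
  have "ac (\<lambda>t. P t + P (2 * L - t)) (\<lambda>t. 0)"
    using ac_add[OF P ac_reflect[OF P, of "2 * L"]] by (simp only: potential_sym) simp
  from ac_zero_const[OF this, of 0 L] have half: "P (2 * L) - P 0 = 2 * (P L - P 0)" by simp
  have "P (real j * (2 * L)) = P 0 + real j * (P (2 * L) - P 0)" for j
  proof (induction j)
    case (Suc j)
    have "P (real j * (2 * L) + 2 * L) - P (real j * (2 * L)) = P (0 + 2 * L) - P 0"
      by (rule ac_periodic_increment[OF P potential_sym(1)])
    then show ?case using Suc by (simp add: algebra_simps)
  qed simp
  then have "P (real k * (2 * L)) - P 0 = real (2 * k) * (P L - P 0)" unfolding half by simp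
  also have "\<dots> \<le> real (2 * k) * (w\<^sup>2 * L + w * cot (w * (L - \<epsilon>)))" using quarter by (intro mult_left_mono) auto
  finally show ?thesis using ac_int[OF P, of 0 "real k * (2 * L)"] L by simp
qed

end

text \<open>Equality in the tangent estimate needs \<open>4 (n + 1)\<close> equal pieces, hence the
  choice of \<open>L\<close>; the phase \<open>w * L\<close> is then the argument of the cotangent,
  and small \<open>\<epsilon>\<close> brings the norm as close as desired.\<close>

lemma Lambda_norm_near:
  assumes T: "T > 0" and n: "n \<ge> 1" and \<eta>: "\<eta> > 0"
  shows "\<exists>a\<in>Lambda_set T n. L1_norm T a <
    T * (2 * pi * real n / T)\<^sup>2 + 8 * pi * real n * (real n + 1) / T * cot (real n * pi / (2 * (real n + 1))) + \<eta>"
proof -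
  define w where "w = 2 * pi * real n / T"
  define L where "L = T / (4 * (real n + 1))"
  have w: "w > 0" and L: "L > 0" using T n by (auto simp: w_def L_def)
  have c: "w * L = real n * pi / (2 * (real n + 1))" using T by (simp add: w_def L_def field_simps)
  have TL: "T = 4 * (real n + 1) * L" using T by (simp add: L_def)
  have "w * L < pi / 2" unfolding c by (simp add: field_simps)
  then have wL: "0 < w * L" "w * L < pi / 2" using w L by simp_all
  have sinL: "sin (w * L) \<noteq> 0" using sin_gt_zero[of "w * L"] wL by auto
  have cosL: "cos (w * L) > 0" using wL by (intro cos_gt_zero) auto
  \<comment> \<open>The bound of \<open>potential_integral\<close> for \<open>2 * n + 2\<close>
    arches; it is continuous at \<open>\<epsilon> = 0\<close>, where it takes the claimed
    value.\<close>
  define N where "N = (\<lambda>\<epsilon>. real (2 * (2 * n + 2)) * (w\<^sup>2 * L + w * cot (w * (L - \<epsilon>))))"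
  have "isCont N 0" unfolding N_def using sinL by (intro continuous_intros isCont_cot) auto
  then have "(N \<longlongrightarrow> N 0) (at_right 0)" by (simp add: isCont_def filterlim_at_split)
  then have ev1: "\<forall>\<^sub>F \<epsilon> in at_right 0. N \<epsilon> < N 0 + \<eta>" using \<eta> by (intro order_tendstoD) auto
  have "isCont (\<lambda>\<epsilon>. w * \<epsilon> * (1 + w * \<epsilon> / 2)) 0" by (intro continuous_intros) auto
  then have "((\<lambda>\<epsilon>. w * \<epsilon> * (1 + w * \<epsilon> / 2)) \<longlongrightarrow> 0) (at_right 0)" by (simp add: isCont_def filterlim_at_split)
  then have ev2: "\<forall>\<^sub>F \<epsilon> in at_right 0. w * \<epsilon> * (1 + w * \<epsilon> / 2) < cos (w * L)" using cosL by (intro order_tendstoD) auto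
  have ev3: "\<forall>\<^sub>F \<epsilon> in at_right 0. \<epsilon> \<in> {0<..<L}" using L by (rule eventually_at_right_real)
  have "\<forall>\<^sub>F \<epsilon> in at_right 0. N \<epsilon> < N 0 + \<eta> \<and> w * \<epsilon> * (1 + w * \<epsilon> / 2) < cos (w * L) \<and> \<epsilon> \<in> {0<..<L}"
    using ev1 ev2 ev3 by eventually_elim auto
  then obtain \<epsilon> where \<epsilon>: "N \<epsilon> < N 0 + \<eta>" "w * \<epsilon> * (1 + w * \<epsilon> / 2) \<le> cos (w * L)" "0 < \<epsilon>" "\<epsilon> < L"
    using eventually_happens[of _ "at_right (0::real)"] trivial_limit_at_right_real by fastforce
  note h = L w wL(2) \<epsilon>(3,4,2)
  define a where "a = potential L w \<epsilon>"
  have la: "locint a" unfolding a_def by (rule locint_potential[OF h])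
  have ge: "w\<^sup>2 \<le> a t" for t unfolding a_def by (rule potential_bounds(1)[OF h])
  have TL2: "T = of_int (int (2 * n + 2)) * (2 * L)" using TL by (simp add: algebra_simps)
  have per: "a (t + T) = a t" for t
    unfolding TL2 by (rule periodic_int) (simp add: a_def potential_sym(1)[OF h])
  have aL: "a \<in> L_per T" by (rule L_perI[OF per la])
  obtain U V where s: "sol a U V" "U 0 = 0" "V 0 = w" using sol_exists[OF la] by metis
  note anti = potential_sol(1,2)[OF h s[unfolded a_def]]
  \<comment> \<open>Two sign changes make the period \<open>4 * L\<close>, and \<open>T\<close>
    consists of \<open>n + 1\<close> such periods.\<close>
  have "U (t + 4 * L) = U t" "V (t + 4 * L) = V t" for t
    using anti[of t] anti[of "t + 2 * L"] by (simp_all add: add.assoc)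
  then have "U (0 + of_int (int (n + 1)) * (4 * L)) = U 0" "V (0 + of_int (int (n + 1)) * (4 * L)) = V 0"
    by (intro periodic_int; simp)+
  moreover have "0 + of_int (int (n + 1)) * (4 * L) = T" using TL by (simp add: algebra_simps)
  ultimately have ends: "U T = U 0" "V T = V 0" by simp_all
  have int: "integral {0..T} a \<le> N \<epsilon>"
    using potential_integral[OF h, of "2 * n + 2"] TL2 unfolding a_def N_def by simp
  \<comment> \<open>Otherwise the solution would be \<open>sin (w t)\<close> on
    \<open>[0, L]\<close>, whose slope at \<open>L\<close> is positive, whereas
    \<open>V L = 0\<close>.\<close>
  have neg: "\<not> negligible {x \<in> {0..T}. w\<^sup>2 < a x}"
  proof
    assume *: "negligible {x \<in> {0..T}. w\<^sup>2 < a x}"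
    have "negligible {x \<in> {0..L}. w\<^sup>2 < a x}"
      by (rule negligible_subset[OF *]) (use TL n L in \<open>auto simp: algebra_simps add_increasing2\<close>)
    then have "AE x in lebesgue. x \<in> {0..L} \<longrightarrow> a x \<le> w\<^sup>2"
      unfolding AE_lebesgue_iff by (rule negligible_subset) auto
    then have "AE x in lebesgue. x \<in> {0..L} \<longrightarrow> a x = w\<^sup>2"
      by (rule eventually_mono) (use ge antisym in blast)
    then have ae: "AE x in lebesgue. x \<in> {0..L} \<longrightarrow> - a x * U x - - w\<^sup>2 * sin (w * x) = - a x * (U x - sin (w * x))"
      by (rule eventually_mono) (simp add: algebra_simps)
    have sn: "ac (\<lambda>t. sin (w * t)) (\<lambda>t. w * cos (w * t))"
      by (rule deriv_ac) (auto intro!: derivative_eq_intros continuous_intros)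
    have cs: "ac (\<lambda>t. w * cos (w * t)) (\<lambda>t. - w\<^sup>2 * sin (w * t))"
      by (rule deriv_ac) (auto intro!: derivative_eq_intros continuous_intros simp: power2_eq_square)
    have "V L - w * cos (w * L) = 0"
      using ac_energy_zero_on[OF ac_diff[of U V] ac_diff[of V "\<lambda>t. - a t * U t"] la ae, OF _ sn _ cs, of 0 L] s L
      by (simp add: sol_def)
    moreover have "V L = 0" by (rule potential_sol(3)[OF h s[unfolded a_def]])
    ultimately show False using cosL w by simp
  qed
  have prec: "ae_prec T (\<lambda>_. w\<^sup>2) a" unfolding ae_prec_const_iff[OF T la] using ge neg by simp
  have "U 0 \<noteq> 0 \<or> V 0 \<noteq> 0" using s(3) w by simp
  then have mem: "a \<in> Lambda_set T n"
    by (rule Lambda_setI(1)[OF T n aL prec[unfolded w_def] s(1) ends])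
  have "0 \<le> a t" for t using ge[of t] zero_le_power2[of w] by linarith
  then have norm: "L1_norm T a = integral {0..T} a" by (intro L1_norm_eq[OF T la] AE_I2) simp
  have N0: "N 0 = T * w\<^sup>2 + 8 * pi * real n * (real n + 1) / T * cot (w * L)"
  proof -
    have "N 0 = 4 * (real n + 1) * L * w\<^sup>2 + 4 * (real n + 1) * w * cot (w * L)" by (simp add: N_def algebra_simps)
    also have "4 * (real n + 1) * L * w\<^sup>2 = T * w\<^sup>2" unfolding TL by simp
    also have "4 * (real n + 1) * w = 8 * pi * real n * (real n + 1) / T" using T by (simp add: w_def field_simps)
    finally show ?thesis .
  qed
  show ?thesis unfolding c[symmetric] w_def[symmetric]
  proof (rule bexI[OF _ mem])
    show "L1_norm T a < T * w\<^sup>2 + 8 * pi * real n * (real n + 1) / T * cot (w * L) + \<eta>"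
      using int \<epsilon>(1) norm N0 by linarith
  qed
qed

section \<open>Assembling the four claims\<close>

lemma zero_listing_cong:
  assumes "\<And>t. t \<in> {0..T} \<Longrightarrow> U t = u t" "\<And>t. t \<in> {0..T} \<Longrightarrow> V t = v t"
  shows "zero_listing T U V m t \<longleftrightarrow> zero_listing T u v m t"
proof -
  have "{s \<in> {0..T}. U s = 0} = {s \<in> {0..T}. u s = 0}" using assms(1) by auto
  moreover have "{s \<in> {0<..<T}. V s = 0} = {s \<in> {0<..<T}. v s = 0}" using assms(2) by auto
  ultimately show ?thesis unfolding zero_listing_def by (simp only:)
qed

lemma zeros_of_solution:
  assumes T: "T > 0" and n: "n \<ge> 1" and a: "a \<in> Lambda_set T n" and ps: "periodic_solution T a u u'"
    and nt: "nontrivial_on T u" and u: "u 0 = 0" "u T = 0"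
  shows "(\<exists>m t. zero_listing T u u' m t) \<and>
       (\<forall>m t. zero_listing T u u' m t \<longrightarrow>
          (\<forall>i<2 * m. t i < t (i + 1)) \<and>
          (\<forall>i<2 * m. t (i + 1) - t i \<le> T / (4 * real n)) \<and>
          (\<exists>i<2 * m. t (i + 1) - t i < T / (4 * real n)) \<and>
          even m \<and> m \<ge> 2 * (n + 1))"
proof -
  note L = Lambda_setD[OF T n a]
  obtain U V where s: "sol a U V" and eq: "\<And>t. t \<in> {0..T} \<Longrightarrow> U t = u t" "\<And>t. t \<in> {0..T} \<Longrightarrow> V t = u' t"
    using periodic_solution_global[OF T L(1) ps] by metis
  have ends: "U 0 = 0" "U T = 0" "V T = V 0"
    using ps u T eq[of 0] eq[of T] by (auto simp: periodic_solution_def)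
  have nz: "V 0 \<noteq> 0" using nontrivial_initial_data[OF T L(1) s nt eq(1), of 0] ends(1) by blast
  note cong = zero_listing_cong[of T U u V u', OF eq]
  obtain m t where zl: "zero_listing T u u' m t" and i: "\<forall>i<2 * m. t i < t (i + 1)"
    "\<forall>i<2 * m. t (i + 1) - t i \<le> T / (4 * real n)" "\<exists>i<2 * m. t (i + 1) - t i < T / (4 * real n)"
    "even m" "m \<ge> 2 * (n + 1)"
    using sol_vanishing_at_ends[OF T n L(1,3,4) s ends nz] cong by blast
  show ?thesis
  proof (intro conjI allI impI)
    show "\<exists>m t. zero_listing T u u' m t" using zl by blast
    fix m' t' assume zl': "zero_listing T u u' m' t'"
    have m: "m' = m" using zero_listing_unique(1)[OF zl' zl] .
    have t: "t' i = t i" if "i \<le> 2 * m" for i using zero_listing_unique(2)[OF zl' zl] that m by simp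
    have t1: "t' i = t i" "t' (i + 1) = t (i + 1)" if "i < 2 * m" for i using t that by simp_all
    show "t' i < t' (i + 1)" if "i < 2 * m'" for i using i(1) that unfolding m by (simp only: t1)
    show "t' (i + 1) - t' i \<le> T / (4 * real n)" if "i < 2 * m'" for i using i(2) that unfolding m by (simp only: t1)
    show "\<exists>i<2 * m'. t' (i + 1) - t' i < T / (4 * real n)" using i(3) t1 unfolding m by metis
    show "even m'" "m' \<ge> 2 * (n + 1)" using i(4,5) m by blast+
  qed
qed

text \<open>The strict lower bound holds for every member while \<open>Lambda_norm_near\<close>
  comes arbitrarily close; both the value and the failure to attain it follow.\<close>

lemma gamma1_eq:
  assumes T: "T > 0" and n: "n \<ge> 1"
  shows "gamma1 T n = T * eig0 T (2 * n - 1) +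
    8 * pi * real n * (real n + 1) / T * cot (real n * pi / (2 * (real n + 1)))" (is "_ = ?F")
    and "a \<in> Lambda_set T n \<Longrightarrow> gamma1 T n < L1_norm T a"
proof -
  have gt: "?F < L1_norm T a" if "a \<in> Lambda_set T n" for a
    using Lambda_norm_gt[OF T n that] unfolding eig0_eq[OF T n] .
  have near: "\<exists>a\<in>Lambda_set T n. L1_norm T a < ?F + \<eta>" if "\<eta> > 0" for \<eta>
    using Lambda_norm_near[OF T n that] unfolding eig0_eq[OF T n] .
  have ne: "Lambda_set T n \<noteq> {}" using near[of 1] by auto
  have bdd: "bdd_below (L1_norm T ` Lambda_set T n)" using gt by (intro bdd_belowI2[of _ ?F]) (auto intro: less_imp_le)
  have eq: "gamma1 T n = ?F"
  proof (rule antisym)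
    show "?F \<le> gamma1 T n" unfolding gamma1_def using gt ne by (intro cINF_greatest) (auto intro: less_imp_le)
    show "gamma1 T n \<le> ?F"
    proof (rule field_le_epsilon)
      fix \<eta> :: real assume "\<eta> > 0"
      then obtain a where a: "a \<in> Lambda_set T n" "L1_norm T a < ?F + \<eta>" using near by blast
      have "gamma1 T n \<le> L1_norm T a" unfolding gamma1_def by (rule cINF_lower[OF bdd a(1)])
      then show "gamma1 T n \<le> ?F + \<eta>" using a(2) by linarith
    qed
  qed
  show "gamma1 T n = ?F" by (rule eq)
  show "gamma1 T n < L1_norm T a" if "a \<in> Lambda_set T n" using gt[OF that] unfolding eq .
qed

text \<open>If the maximal turning of \<open>a\<close> were \<open>2 (n + 1) \<pi>\<close> or more,
  continuity along the segment from \<open>w\<^sup>2\<close> to \<open>a\<close> would give a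
  potential where it is exactly \<open>2 (n + 1) \<pi>\<close>. That potential has a periodic
  solution, so it belongs to \<open>Lambda_set\<close> and its norm exceeds \<open>gamma1\<close>,
  although it is at most the norm of \<open>a\<close>.\<close>

lemma eigenvalues_near_zero:
  assumes T: "T > 0" and n: "n \<ge> 1" and aL: "a \<in> L_per T"
    and prec: "ae_prec T (\<lambda>_. eig0 T (2 * n - 1)) a" and norm: "L1_norm T a \<le> gamma1 T n"
  shows "eig T a (2 * n) < 0" "0 < eig T a (2 * n + 1)"
proof -
  define w where "w = 2 * pi * real n / T"
  have w: "w > 0" using T n by (simp add: w_def)
  have la: "locint a" by (rule L_per_locint[OF T aL])
  have "ae_prec T (\<lambda>_. w\<^sup>2) a" using prec unfolding eig0_eq[OF T n] w_def .
  then have ge: "AE x in lebesgue. x \<in> {0..T} \<longrightarrow> w\<^sup>2 \<le> a x" and neg: "\<not> negligible {x \<in> {0..T}. w\<^sup>2 < a x}"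
    unfolding ae_prec_const_iff[OF T la] by blast+
  have ge0: "AE x in lebesgue. x \<in> {0..T} \<longrightarrow> 0 \<le> a x"
    using ge by (rule eventually_mono) (auto intro: order_trans[OF zero_le_power2])
  have turn: "turn w T (\<lambda>_. w\<^sup>2) \<theta> = 2 * pi * real n" for \<theta>
    using T by (simp add: turn_def prufer_const[OF w]) (simp add: w_def)
  have const: "turn_min w T (\<lambda>_. w\<^sup>2) = 2 * pi * real n" "turn_max w T (\<lambda>_. w\<^sup>2) = 2 * pi * real n"
    using turn_min(2)[OF w T locint_const[of "w\<^sup>2"]] turn_max(2)[OF w T locint_const[of "w\<^sup>2"]] unfolding turn by auto
  show "eig T a (2 * n) < 0"
    unfolding eig_neg_iff[OF w T la ge0] const(1)[symmetric]
    by (rule turn_extrema_mono(4)[OF w T locint_const la ge neg])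
  show "0 < eig T a (2 * n + 1)"
    unfolding eig_pos_iff[OF w T la ge0]
  proof (rule ccontr)
    assume "\<not> turn_max w T a < 2 * pi * (real n + 1)"
    then have hi: "2 * pi * (real n + 1) \<le> turn_max w T a" by simp
    define b where "b = (\<lambda>s t. w\<^sup>2 + s * (a t - w\<^sup>2))"
    have lb: "locint (b s)" for s unfolding b_def by (intro locint_intros la)
    have "continuous_on UNIV (\<lambda>s. turn_max w T (b s))"
    proof (rule continuous_on_local_lipschitz)
      fix x y
      have "integral {0..T} (\<lambda>t. \<bar>b y t - b x t\<bar> / w) = \<bar>y - x\<bar> * integral {0..T} (\<lambda>t. \<bar>a t - w\<^sup>2\<bar> / w)"
      proof -
        have "(\<lambda>t. \<bar>b y t - b x t\<bar> / w) = (\<lambda>t. \<bar>y - x\<bar> * (\<bar>a t - w\<^sup>2\<bar> / w))"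
          by (simp add: b_def fun_eq_iff flip: left_diff_distrib abs_mult)
        then show ?thesis by simp
      qed
      then show "\<bar>turn_max w T (b y) - turn_max w T (b x)\<bar> \<le>
        (exp (2 * integral {0..T} (\<lambda>t. \<bar>b x t / w - w\<bar>)) * integral {0..T} (\<lambda>t. \<bar>a t - w\<^sup>2\<bar> / w)) * \<bar>y - x\<bar>"
        using turn_extrema_lipschitz(1)[OF w T lb[of x] lb[of y]] by (simp only: mult_ac)
    qed
    moreover have "b 0 = (\<lambda>_. w\<^sup>2)" "b 1 = a" by (auto simp: b_def)
    moreover have "2 * pi * real n < 2 * pi * (real n + 1)" by simp
    ultimately obtain s where s: "0 \<le> s" "s \<le> 1" "turn_max w T (b s) = 2 * pi * (real n + 1)"
      using IVT'[of "\<lambda>s. turn_max w T (b s)" 0 "2 * pi * (real n + 1)" 1] hi const(2)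
        continuous_on_subset[of UNIV _ "{0..1}"] by auto
    \<comment> \<open>\<open>s = 0\<close> would be the constant \<open>w\<^sup>2\<close>, for which
      the strict part of \<open>ae_prec\<close> fails.\<close>
    have "s \<noteq> 0" using s(3) const(2) \<open>b 0 = _\<close> by auto
    then have "s > 0" using s(1) by simp
    have "turn_max w T (b s) = 2 * pi * of_int (int n + 1)" using s(3) by simp
    then obtain U V where UV: "sol (b s) U V" "U T = U 0" "V T = V 0" "U 0 \<noteq> 0 \<or> V 0 \<noteq> 0"
      using turn_extremum_iff[OF w T lb, of s] by blast
    have bL: "b s \<in> L_per T" using aL lb by (intro L_perI) (auto simp: b_def L_per_def)
    have geb: "AE x in lebesgue. x \<in> {0..T} \<longrightarrow> w\<^sup>2 \<le> b s x"
      by (rule eventually_mono[OF ge]) (use s(1) in \<open>auto simp: b_def\<close>)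
    moreover have "{x \<in> {0..T}. w\<^sup>2 < b s x} = {x \<in> {0..T}. w\<^sup>2 < a x}"
      using \<open>s > 0\<close> by (auto simp: b_def zero_less_mult_iff)
    ultimately have "ae_prec T (\<lambda>_. w\<^sup>2) (b s)" unfolding ae_prec_const_iff[OF T lb] using neg by simp
    then have "b s \<in> Lambda_set T n" using Lambda_setI(1)[OF T n bL _ UV] unfolding w_def by blast
    then have "gamma1 T n < L1_norm T (b s)" by (rule gamma1_eq(2)[OF T n])
    also have "\<dots> \<le> L1_norm T a"
    proof -
      have "AE x in lebesgue. x \<in> {0..T} \<longrightarrow> 0 \<le> b s x"
        using geb by (rule eventually_mono) (auto intro: order_trans[OF zero_le_power2])
      then have "L1_norm T (b s) = integral {0..T} (b s)" by (rule L1_norm_eq[OF T lb])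
      also have "\<dots> \<le> integral {0..T} a"
      proof (rule has_integral_mono_AE)
        show "(b s has_integral integral {0..T} (b s)) {0..T}" "(a has_integral integral {0..T} a) {0..T}"
          by (intro integrable_integral locint_integrable lb la)+
        show "AE x in lebesgue. x \<in> {0..T} \<longrightarrow> b s x \<le> a x"
        proof (rule eventually_mono[OF ge], intro impI)
          fix x assume x: "x \<in> {0..T} \<longrightarrow> w\<^sup>2 \<le> a x" "x \<in> {0..T}"
          then have "s * (a x - w\<^sup>2) \<le> 1 * (a x - w\<^sup>2)" using s by (intro mult_right_mono) auto
          then show "b s x \<le> a x" by (simp add: b_def)
        qed
      qed
      also have "\<dots> = L1_norm T a" by (rule L1_norm_eq[OF T la ge0, symmetric])
      finally show ?thesis .
    qed
    \<comment> \<open>Strictness of \<open>gamma1_eq(2)\<close> settles the borderline norm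
      \<open>gamma1 T n\<close> as well.\<close>
    finally show False using norm by simp
  qed
qed

theorem theorem2p1:
  fixes T :: real and n :: nat
  assumes "T > 0" and "n \<ge> 1"
  shows
    "(\<forall>a u u'. a \<in> Lambda_set T n \<and> periodic_solution T a u u' \<and> nontrivial_on T u \<and>
         u 0 = 0 \<and> u T = 0 \<longrightarrow>
       (\<exists>m t. zero_listing T u u' m t) \<and>
       (\<forall>m t. zero_listing T u u' m t \<longrightarrow>
          (\<forall>i<2 * m. t i < t (i + 1)) \<and>
          (\<forall>i<2 * m. t (i + 1) - t i \<le> T / (4 * real n)) \<and>
          (\<exists>i<2 * m. t (i + 1) - t i < T / (4 * real n)) \<and>
          even m \<and> m \<ge> 2 * (n + 1)))
     \<and> (\<forall>m. even m \<and> m \<ge> 2 * (n + 1) \<longrightarrow>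
          (\<exists>a\<in>Lambda_set T n. \<exists>u u' t. periodic_solution T a u u' \<and> nontrivial_on T u \<and>
             u 0 = 0 \<and> u T = 0 \<and> zero_listing T u u' m t))
     \<and> \<not> (\<exists>a\<in>Lambda_set T n. L1_norm T a = gamma1 T n)
     \<and> gamma1 T n = T * eig0 T (2 * n - 1) +
         8 * pi * real n * (real n + 1) / T * cot (real n * pi / (2 * (real n + 1)))
     \<and> (\<forall>a\<in>L_per T. ae_prec T (\<lambda>_. eig0 T (2 * n - 1)) a \<and> L1_norm T a \<le> gamma1 T n \<longrightarrow>
          eig T a (2 * n) < 0 \<and> 0 < eig T a (2 * n + 1))"
proof (intro conjI, goal_cases)
  case 1
  show ?case by (intro allI impI, elim conjE, rule zeros_of_solution[OF assms])
next
  case 2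
  show ?case using every_even_value_occurs[OF assms] by blast
next
  case 3
  show ?case using gamma1_eq(2)[OF assms] by (metis less_irrefl)
next
  case 4
  show ?case by (rule gamma1_eq(1)[OF assms])
next
  case 5
  show ?case using eigenvalues_near_zero[OF assms] by blast
qed

end
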